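(* Let $\tau>0$ and $b\in(0,1/2]$ be fixed, and consider asymptotics $\epsilon\to0$, $d\to+\infty$. Let $r_\epsilon>0$ be a family with $r_\epsilon\to 0$, let $a(r_\epsilon)$ be the value of the extremal problem defined in the context, and let $\gamma=\gamma(\Theta_d(\tau,r_\epsilon,b))$ be the minimax total error probability. Then: (i) Lower bound. If $a(r_\epsilon)d^{1/2-b}=o(1)$, then $\gamma\to1$. If $a(r_\epsilon)d^{1/2-b}=O(1)$, then $\liminf\gamma>0$. (ii) Upper bound. Let $r^\star_\epsilon=r^\star_\epsilon(b)>0$ be a family determined by the relation $a(r^\star_\epsilon)\asymp d^{b-1/2}$, and for $\alpha\in(0,1)$ let $\psi^{\chi^2}_\alpha=\mathbf 1\{t_b>T_\alpha\}$, where $T_\alpha$ is the $(1-\alpha)$-quantile of the standard Gaussian distribution and $$t_b=\frac1{\sqrt d}\sum_{j=1}^d t_{j,b},\qquad t_{j,b}=\sum_{k\in\mathbb Z}w_k(r^\star_\epsilon)\left(\Big(\frac{x_{j,k}}{\epsilon}\Big)^2-1\right).$$ Then (type I error) for every $\alpha\in(0,1)$, $\omega(\psi^{\chi^2}_\alpha)=\alpha+o(1)$; and (type II error) if $a(r_\epsilon)d^{1/2-b}\to+\infty$, then $\beta(\psi^{\chi^2}_\alpha,\Theta_d(\tau,r_\epsilon,b))=o(1)$.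
   Context: Observation model: for a noise level $\epsilon>0$ and dimension $d$, one observes $x_{j,k}=\xi_j\theta_{j,k}+\epsilon\,\eta_{j,k}$, $j\in\{1,\dots,d\}$, $k\in\mathbb Z$, with $\eta_{j,k}$ i.i.d. $\mathcal N(0,1)$, $\xi_j\in\{0,1\}$ deterministic, $\theta_j=(\theta_{j,k})_{k\in\mathbb Z}\in \ell_2(\mathbb Z)$. (This is the sequence form of detecting a sparse additive signal $f(t)=\sum_j\xi_jf_j(t_j)$ in $d$-dimensional Gaussian white noise, $\theta_{j,k}$ being the Fourier coefficients of $f_j$.) Write $\overline{\boldsymbol\theta}=(\xi_1\theta_1,\dots,\xi_d\theta_d)$, $\mathbb P_{\overline{\boldsymbol\theta}}$ for the law of the observations, $\mathbb E_{\overline{\boldsymbol\theta}}$ for its expectation, and $\mathbb P_0,\mathbb E_0$ when $\overline{\boldsymbol\theta}=0$. Classes: for $r>0$, $\Theta(\tau,r)=\{\theta\in \ell_2(\mathbb Z):(2\pi)^{2\tau}\sum_{k}|k|^{2\tau}\theta_k^2\le1,\ \sum_k\theta_k^2\ge r^2\}$, and $\Theta_d(\tau,r,b)=\{\overline{\boldsymbol\theta}=(\theta_1\xi_1,\dots,\theta_d\xi_d):\ \xi_j\in\{0,1\},\ \sum_{j=1}^d\xi_j=K,\ \theta_j\in\Theta(\tau,r)\ \forall j\}$, where $K=d^{1-b}$ (its integer part if it is not an integer). Testing problem: $H_0:\overline{\boldsymbol\theta}=0$ versus $H_1:\overline{\boldsymbol\theta}\in\Theta_d(\tau,r_\epsilon,b)$.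 A test $\psi$ is a measurable function of the observations with values in $[0,1]$; $\omega(\psi)=\mathbb E_0(\psi)$, $\beta(\psi,\Theta)=\sup_{\overline{\boldsymbol\theta}\in\Theta}\mathbb E_{\overline{\boldsymbol\theta}}(1-\psi)$, and $\gamma(\Theta)=\inf_\psi\{\omega(\psi)+\beta(\psi,\Theta)\}$, the infimum being over all tests. Extremal problem: for $r>0$, $a(r)\ge 0$ (depending also on $\epsilon,\tau$) is defined by $a^2(r)=\frac1{2\epsilon^4}\inf_{\theta\in\Theta(\tau,r)}\sum_{k\in\mathbb Z}\theta_k^4$; $\theta^\star(r)=(\theta^\star_k(r))_{k}$ denotes a minimizing sequence (element of $\Theta(\tau,r)$ attaining the infimum), and $w_k(r)=\frac{(\theta_k^\star(r))^2}{2a(r)\epsilon^2}$, $k\in\mathbb Z$. The symbols $o,O,\asymp$ and limits are along $\epsilon\to0$, $d\to+\infty$; $A\asymp B$ means $A/B$ is bounded and bounded away from $0$. *)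

theory Defs
  imports "HOL-Probability.Probability" "HOL-Library.Landau_Symbols"
begin

text \<open>
  Sequence form of the \<open>d\<close>-dimensional Gaussian white noise model. An observation is a function
  on the index set \<open>{1..d} \<times> \<int>\<close>; a (masked) parameter \<open>(\<xi>\<^sub>1 \<theta>\<^sub>1, \<dots>, \<xi>\<^sub>d \<theta>\<^sub>d)\<close> is a function
  \<open>u :: nat \<Rightarrow> int \<Rightarrow> real\<close>, of which only the values at \<open>j \<in> {1..d}\<close> matter.
\<close>

definition obs_index :: "nat \<Rightarrow> (nat \<times> int) set" where
  "obs_index d = {1..d} \<times> UNIV"

definition obs_space :: "nat \<Rightarrow> (nat \<times> int \<Rightarrow> real) measure" where
  "obs_space d = (\<Pi>\<^sub>M i\<in>obs_index d. borel)"

definition noise_law :: "nat \<Rightarrow> (nat \<times> int \<Rightarrow> real) measure" where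
  "noise_law d = (\<Pi>\<^sub>M i\<in>obs_index d. density lborel std_normal_density)"

definition obs_law :: "real \<Rightarrow> nat \<Rightarrow> (nat \<Rightarrow> int \<Rightarrow> real) \<Rightarrow> (nat \<times> int \<Rightarrow> real) measure" where
  "obs_law \<epsilon> d u =
     distr (noise_law d) (obs_space d)
       (\<lambda>\<eta>. \<lambda>(j, k)\<in>obs_index d. u j k + \<epsilon> * \<eta> (j, k))"

text \<open>
  Summability is required explicitly because \<open>infsum\<close> is \<open>0\<close> for non-summable families.
\<close>

definition ell2 :: "(int \<Rightarrow> real) set" where
  "ell2 = {\<theta>. (\<lambda>k. (\<theta> k)\<^sup>2) summable_on UNIV}"

definition sobolev_class :: "real \<Rightarrow> real \<Rightarrow> (int \<Rightarrow> real) set" where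
  "sobolev_class \<tau> r = {\<theta> \<in> ell2.
     (\<lambda>k. \<bar>real_of_int k\<bar> powr (2 * \<tau>) * (\<theta> k)\<^sup>2) summable_on UNIV \<and>
     (2 * pi) powr (2 * \<tau>) * (\<Sum>\<^sub>\<infinity>k. \<bar>real_of_int k\<bar> powr (2 * \<tau>) * (\<theta> k)\<^sup>2) \<le> 1 \<and>
     (\<Sum>\<^sub>\<infinity>k. (\<theta> k)\<^sup>2) \<ge> r\<^sup>2}"

definition num_active :: "nat \<Rightarrow> real \<Rightarrow> nat" where
  "num_active d b = nat \<lfloor>real d powr (1 - b)\<rfloor>"

text \<open>
  Coordinates \<open>j \<notin> {1..d}\<close> are set to \<open>0\<close>, so that functions correspond to \<open>d\<close>-tuples.
\<close>

definition sparse_class :: "nat \<Rightarrow> real \<Rightarrow> real \<Rightarrow> real \<Rightarrow> (nat \<Rightarrow> int \<Rightarrow> real) set" where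
  "sparse_class d \<tau> r b = {(\<lambda>j k. if j \<in> {1..d} then \<xi> j * \<theta> j k else 0) |\<xi> \<theta>.
     (\<forall>j\<in>{1..d}. \<xi> j \<in> {0, 1}) \<and> (\<Sum>j=1..d. \<xi> j) = real (num_active d b) \<and>
     (\<forall>j\<in>{1..d}. \<theta> j \<in> sobolev_class \<tau> r)}"

definition is_test :: "nat \<Rightarrow> ((nat \<times> int \<Rightarrow> real) \<Rightarrow> real) \<Rightarrow> bool" where
  "is_test d \<psi> \<longleftrightarrow> \<psi> \<in> borel_measurable (obs_space d) \<and> (\<forall>x\<in>space (obs_space d). \<psi> x \<in> {0..1})"

definition type_I_error :: "real \<Rightarrow> nat \<Rightarrow> ((nat \<times> int \<Rightarrow> real) \<Rightarrow> real) \<Rightarrow> real" where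
  "type_I_error \<epsilon> d \<psi> = (\<integral>x. \<psi> x \<partial>obs_law \<epsilon> d (\<lambda>_ _. 0))"

definition type_II_error ::
    "real \<Rightarrow> nat \<Rightarrow> ((nat \<times> int \<Rightarrow> real) \<Rightarrow> real) \<Rightarrow> (nat \<Rightarrow> int \<Rightarrow> real) set \<Rightarrow> real" where
  "type_II_error \<epsilon> d \<psi> H = (SUP u\<in>H. \<integral>x. 1 - \<psi> x \<partial>obs_law \<epsilon> d u)"

definition minimax_error :: "real \<Rightarrow> nat \<Rightarrow> (nat \<Rightarrow> int \<Rightarrow> real) set \<Rightarrow> real" where
  "minimax_error \<epsilon> d H = (INF \<psi>\<in>{\<psi>. is_test d \<psi>}. type_I_error \<epsilon> d \<psi> + type_II_error \<epsilon> d \<psi> H)"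

definition extremal_inf :: "real \<Rightarrow> real \<Rightarrow> real" where
  "extremal_inf \<tau> r = (INF \<theta>\<in>sobolev_class \<tau> r. \<Sum>\<^sub>\<infinity>k. (\<theta> k) ^ 4)"

definition extremal_a :: "real \<Rightarrow> real \<Rightarrow> real \<Rightarrow> real" where
  "extremal_a \<epsilon> \<tau> r = sqrt (1 / (2 * \<epsilon> ^ 4) * extremal_inf \<tau> r)"

definition is_minimizing :: "real \<Rightarrow> real \<Rightarrow> (int \<Rightarrow> real) \<Rightarrow> bool" where
  "is_minimizing \<tau> r \<theta> \<longleftrightarrow> \<theta> \<in> sobolev_class \<tau> r \<and> (\<Sum>\<^sub>\<infinity>k. (\<theta> k) ^ 4) = extremal_inf \<tau> r"

text \<open>In \<open>weight\<close>, \<open>chi2_stat\<close> and \<open>chi2_test\<close>, \<open>\<theta>\<close> stands for a minimizing sequence \<open>\<theta>\<^sup>\<star>(r)\<close>.\<close>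

definition weight :: "real \<Rightarrow> real \<Rightarrow> real \<Rightarrow> (int \<Rightarrow> real) \<Rightarrow> int \<Rightarrow> real" where
  "weight \<epsilon> \<tau> r \<theta> k = (\<theta> k)\<^sup>2 / (2 * extremal_a \<epsilon> \<tau> r * \<epsilon>\<^sup>2)"

definition chi2_stat :: "real \<Rightarrow> nat \<Rightarrow> real \<Rightarrow> real \<Rightarrow> (int \<Rightarrow> real) \<Rightarrow> (nat \<times> int \<Rightarrow> real) \<Rightarrow> real" where
  "chi2_stat \<epsilon> d \<tau> r \<theta> x =
     1 / sqrt (real d) * (\<Sum>j=1..d. \<Sum>\<^sub>\<infinity>k. weight \<epsilon> \<tau> r \<theta> k * ((x (j, k) / \<epsilon>)\<^sup>2 - 1))"

definition std_normal_quantile :: "real \<Rightarrow> real" where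
  "std_normal_quantile p = Inf {t. p \<le> cdf std_normal_distribution t}"

definition chi2_test ::
    "real \<Rightarrow> nat \<Rightarrow> real \<Rightarrow> real \<Rightarrow> (int \<Rightarrow> real) \<Rightarrow> real \<Rightarrow> (nat \<times> int \<Rightarrow> real) \<Rightarrow> real" where
  "chi2_test \<epsilon> d \<tau> r \<theta> \<alpha> x =
     (if chi2_stat \<epsilon> d \<tau> r \<theta> x > std_normal_quantile (1 - \<alpha>) then 1 else 0)"

end

theory Submission
  imports Defs
begin

text \<open>
  Upper bound. Under the null hypothesis the characteristic function of the statistic \<open>t\<^sub>b\<close> is a product
  of those of \<open>w\<^sub>k (\<eta>\<^sup>2 - 1) / \<surd>d\<close>, each of which differs from a Gaussian one by a third-order term; as
  \<open>\<Sum> w\<^sub>k\<^sup>2 = 1/2\<close>, the total discrepancy is \<open>O(1/\<surd>d)\<close> uniformly in the weights, and Levy's theorem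
  applies. Under an alternative, the Laplace transform of \<open>t\<^sub>b\<close> at \<open>-1\<close> is at most \<open>exp (1/2 - m/3)\<close>,
  where \<open>m\<close> is the mean of \<open>t\<^sub>b\<close>. Convexity of the class in \<open>\<theta>\<^sup>2\<close> gives
  \<open>m \<ge> K d\<^sup>-\<^sup>1\<^sup>/\<^sup>2 (r/r\<^sup>*)\<^sup>2 a(r\<^sup>*)\<close>, and a dilation argument bounds \<open>a(M r\<^sup>*) / a(r\<^sup>*)\<close> for fixed \<open>M\<close>,
  so that \<open>a(r) / a(r\<^sup>*) \<rightarrow> \<infinity>\<close> forces \<open>r / r\<^sup>* \<rightarrow> \<infinity>\<close> and hence \<open>m \<rightarrow> \<infinity>\<close>.

  Lower bound. For a prior with random signs on a finitely supported near-minimizer and one active index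
  in each of \<open>K\<close> blocks of length about \<open>d/K\<close>, the likelihood ratio \<open>L\<close> satisfies
  \<open>E\<^sub>0 L\<^sup>2 \<le> exp (2 X e\<^sup>X)\<close> with \<open>X\<close> close to \<open>a(r)\<^sup>2 d\<^sup>1\<^sup>-\<^sup>2\<^sup>b\<close>, which controls \<open>E\<^sub>0 min(1, L)\<close>.
\<close>


section \<open>Independent Gaussian coordinates\<close>

text \<open>Neither the growth rate of \<open>a(r)\<close> nor the shape of a minimizer is ever
  computed; inequalities comparing values of the extremal problem suffice. The limit runs along an
  arbitrary filter while Levy's theorem concerns sequences, which is why the null law is controlled
  uniformly in the weights. Under the alternative the Laplace transform is preferred to Chebyshev's
  inequality because it decreases in the squared means, so no variance has to be bounded over the
  class. In the lower bound a finite support keeps the likelihood ratio a finite product of Gaussian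
  factors. Blocks are used instead of a uniformly random \<open>K\<close>-subset because the inner
  product of two independent draws is then a sum of independent block terms and the second moment
  factors. A block of length \<open>d/K\<close> gives a coincidence of active positions with
  probability about \<open>K/d\<close>; over \<open>K\<close> blocks this yields
  \<open>K^2/d\<close>, about \<open>d^(1-2b)\<close>, times \<open>a(r)^2\<close>. The condition
  \<open>b \<le> 1/2\<close> keeps \<open>d^(1-2b)\<close> at least 1, so that \<open>X\<close> also
  bounds the energy of one component.\<close>

lemma indep_vars_PiM_coordinate:
  assumes M: "\<And>i. i \<in> I \<Longrightarrow> prob_space (M i)" and J: "J \<subseteq> I" "J \<noteq> {}"
  shows "prob_space.indep_vars (PiM I M) M (\<lambda>i \<omega>. \<omega> i) J"
proof -
  interpret prob_space "PiM I M" by (rule prob_space_PiM) (rule M)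
  have "distr (PiM I M) (PiM J M) (\<lambda>\<omega>. \<lambda>i\<in>J. \<omega> i) = PiM J M"
    using distr_PiM_reindex[of I M "\<lambda>x. x" J] M J by auto
  also have "PiM J M = (\<Pi>\<^sub>M i\<in>J. distr (PiM I M) (M i) (\<lambda>\<omega>. \<omega> i))"
    using M J by (intro PiM_cong refl distr_PiM_component[symmetric]) auto
  finally show ?thesis
    using J by (subst indep_vars_iff_distr_eq_PiM') auto
qed

text \<open>The index set may be infinite while only finitely many coordinates enter, so
  independence of the coordinates takes the place of Fubini's theorem.\<close>

lemma
  fixes f :: "'i \<Rightarrow> 'a \<Rightarrow> 'b::{real_normed_field, banach, second_countable_topology}"
  assumes M: "\<And>i. i \<in> I \<Longrightarrow> prob_space (M i)" and J: "finite J" "J \<subseteq> I"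
    and f: "\<And>i. i \<in> J \<Longrightarrow> integrable (M i) (f i)"
  shows integral_PiM_prod: "(\<integral>\<omega>. (\<Prod>i\<in>J. f i (\<omega> i)) \<partial>PiM I M) = (\<Prod>i\<in>J. \<integral>x. f i x \<partial>M i)"
    and integrable_PiM_prod: "integrable (PiM I M) (\<lambda>\<omega>. \<Prod>i\<in>J. f i (\<omega> i))"
proof -
  interpret prob_space "PiM I M" by (rule prob_space_PiM) (rule M)
  have ind: "indep_vars (\<lambda>_. borel) (\<lambda>i \<omega>. f i (\<omega> i)) J"
  proof (cases "J = {}")
    case False
    show ?thesis
      by (rule indep_vars_compose2[OF indep_vars_PiM_coordinate[OF M J(2) False]])
         (use f in auto)
  qed (auto simp: indep_vars_def indep_sets_def)
  have eq: "(\<integral>\<omega>. f i (\<omega> i) \<partial>PiM I M) = (\<integral>x. f i x \<partial>M i)"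
    and int: "integrable (PiM I M) (\<lambda>\<omega>. f i (\<omega> i))" if "i \<in> J" for i
  proof -
    have d: "distr (PiM I M) (M i) (\<lambda>\<omega>. \<omega> i) = M i"
      using that J M by (intro distr_PiM_component) auto
    have m: "(\<lambda>\<omega>. \<omega> i) \<in> measurable (PiM I M) (M i)"
      using that J by (intro measurable_component_singleton) auto
    show "(\<integral>\<omega>. f i (\<omega> i) \<partial>PiM I M) = (\<integral>x. f i x \<partial>M i)"
      using integral_distr[OF m, of "f i"] f[OF that] d by simp
    show "integrable (PiM I M) (\<lambda>\<omega>. f i (\<omega> i))"
      using integrable_distr[OF m, of "f i"] f[OF that] d by simp
  qed
  show "(\<integral>\<omega>. (\<Prod>i\<in>J. f i (\<omega> i)) \<partial>PiM I M) = (\<Prod>i\<in>J. \<integral>x. f i x \<partial>M i)"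
    by (subst indep_vars_lebesgue_integral[OF J(1) ind int]) (auto simp: eq)
  show "integrable (PiM I M) (\<lambda>\<omega>. \<Prod>i\<in>J. f i (\<omega> i))"
    by (rule indep_vars_integrable[OF J(1) ind int])
qed

lemma nn_integral_PiM_component:
  assumes M: "\<And>i. i \<in> I \<Longrightarrow> prob_space (M i)" and i: "i \<in> I"
    and f: "f \<in> borel_measurable (M i)"
  shows "(\<integral>\<^sup>+\<omega>. f (\<omega> i) \<partial>PiM I M) = (\<integral>\<^sup>+x. f x \<partial>M i)"
proof -
  have "distr (PiM I M) (M i) (\<lambda>\<omega>. \<omega> i) = M i"
    using M i by (intro distr_PiM_component) auto
  moreover have "(\<lambda>\<omega>. \<omega> i) \<in> measurable (PiM I M) (M i)"
    using i by (intro measurable_component_singleton) auto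
  ultimately show ?thesis
    using nn_integral_distr[of "\<lambda>\<omega>. \<omega> i" "PiM I M" "M i" f] f by simp
qed

lemma nn_integral_PiM_prod:
  fixes f :: "'i \<Rightarrow> 'a \<Rightarrow> ennreal"
  assumes M: "\<And>i. i \<in> I \<Longrightarrow> prob_space (M i)" and J: "finite J" "J \<subseteq> I"
    and f: "\<And>i. i \<in> J \<Longrightarrow> f i \<in> borel_measurable (M i)"
  shows "(\<integral>\<^sup>+\<omega>. (\<Prod>i\<in>J. f i (\<omega> i)) \<partial>PiM I M) = (\<Prod>i\<in>J. \<integral>\<^sup>+x. f i x \<partial>M i)"
proof -
  interpret prob_space "PiM I M" by (rule prob_space_PiM) (rule M)
  have ind: "indep_vars (\<lambda>_. borel) (\<lambda>i \<omega>. f i (\<omega> i)) J"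
  proof (cases "J = {}")
    case False
    show ?thesis
      by (rule indep_vars_compose2[OF indep_vars_PiM_coordinate[OF M J(2) False]])
         (use f in auto)
  qed (auto simp: indep_vars_def indep_sets_def)
  show ?thesis
    by (subst indep_vars_nn_integral[OF J(1) ind])
       (use J in \<open>auto intro!: prod.cong nn_integral_PiM_component M f\<close>)
qed

section \<open>Laws of the noise and of the observations; Gaussian shifts and Laplace
  transforms\<close>

lemma prob_space_std_normal: "prob_space std_normal_distribution"
  by (rule prob_space_normal_density) simp

lemma space_noise_law: "space (noise_law d) = PiE (obs_index d) (\<lambda>_. UNIV)"
  by (simp add: noise_law_def space_PiM)

lemma space_obs_space: "space (obs_space d) = PiE (obs_index d) (\<lambda>_. UNIV)"
  by (simp add: obs_space_def space_PiM)

lemma sets_noise_law [measurable_cong]: "sets (noise_law d) = sets (obs_space d)"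
  unfolding noise_law_def obs_space_def by (intro sets_PiM_cong) auto

lemma prob_space_noise_law: "prob_space (noise_law d)"
  unfolding noise_law_def by (intro prob_space_PiM prob_space_std_normal)

lemma measurable_obs_coordinate:
  "i \<in> obs_index d \<Longrightarrow> (\<lambda>x. x i) \<in> borel_measurable (obs_space d)"
  unfolding obs_space_def by (rule measurable_component_singleton)

lemma measurable_affine_obs:
  "(\<lambda>\<eta>. \<lambda>(j, k)\<in>obs_index d. u j k + \<epsilon> * \<eta> (j, k)) \<in> measurable (noise_law d) (obs_space d)"
  unfolding obs_space_def
proof (rule measurable_restrict)
  fix i assume "i \<in> obs_index d"
  then have "(\<lambda>\<eta>. \<eta> i) \<in> borel_measurable (noise_law d)"
    using measurable_obs_coordinate measurable_cong_sets[OF sets_noise_law refl] by blast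
  then show "(\<lambda>\<eta>. case i of (j, k) \<Rightarrow> u j k + \<epsilon> * \<eta> (j, k)) \<in> borel_measurable (noise_law d)"
    by (cases i) simp
qed

lemma prob_space_obs_law: "prob_space (obs_law \<epsilon> d u)"
  unfolding obs_law_def
  by (rule prob_space.prob_space_distr[OF prob_space_noise_law measurable_affine_obs])

lemma sets_obs_law [measurable_cong]: "sets (obs_law \<epsilon> d u) = sets (obs_space d)"
  by (simp add: obs_law_def)

lemma space_obs_law: "space (obs_law \<epsilon> d u) = space (obs_space d)"
  by (simp add: obs_law_def)

lemma integral_obs_law:
  fixes g :: "(nat \<times> int \<Rightarrow> real) \<Rightarrow> real"
  assumes "g \<in> borel_measurable (obs_space d)"
  shows "(\<integral>x. g x \<partial>obs_law \<epsilon> d u) =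
    (\<integral>\<eta>. g (\<lambda>(j, k)\<in>obs_index d. u j k + \<epsilon> * \<eta> (j, k)) \<partial>noise_law d)"
  unfolding obs_law_def by (rule integral_distr[OF measurable_affine_obs assms])

lemma std_normal_density_shift:
  "std_normal_density (x - v) = exp (v * x - v\<^sup>2 / 2) * std_normal_density x"
  unfolding std_normal_density_def
  by (simp add: mult_exp_exp power2_eq_square field_simps)

text \<open>One-coordinate Cameron-Martin formula; the density of a translated noise vector is a
  product of such factors.\<close>

lemma distr_shift_std_normal:
  "distr std_normal_distribution borel (\<lambda>x. v + x) =
   density std_normal_distribution (\<lambda>x. ennreal (exp (v * x - v\<^sup>2 / 2)))"
proof (rule measure_eqI)
  fix A assume "A \<in> sets (distr std_normal_distribution borel (\<lambda>x. v + x))"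
  then have A [measurable]: "A \<in> sets borel" by simp
  have "emeasure (distr std_normal_distribution borel (\<lambda>x. v + x)) A =
      (\<integral>\<^sup>+x. indicator A x \<partial>distr std_normal_distribution borel (\<lambda>x. v + x))"
    by simp
  also have "\<dots> = (\<integral>\<^sup>+x. indicator A (v + x) \<partial>std_normal_distribution)"
    by (rule nn_integral_distr) auto
  also have "\<dots> = (\<integral>\<^sup>+x. ennreal (std_normal_density x) * indicator A (v + x) \<partial>lborel)"
    by (rule nn_integral_density) auto
  also have "\<dots> = (\<integral>\<^sup>+x. ennreal (std_normal_density (x - v)) * indicator A x \<partial>lborel)"
    by (subst nn_integral_real_affine[where c = 1 and t = "-v"]) simp_all
  also have "\<dots> = (\<integral>\<^sup>+x. ennreal (std_normal_density x) *
      (ennreal (exp (v * x - v\<^sup>2 / 2)) * indicator A x) \<partial>lborel)"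
    by (intro nn_integral_cong)
       (simp add: std_normal_density_shift ennreal_mult normal_density_nonneg mult_ac)
  also have "\<dots> = emeasure (density std_normal_distribution (\<lambda>x. ennreal (exp (v * x - v\<^sup>2 / 2)))) A"
    by (simp add: emeasure_density nn_integral_density)
  finally show "emeasure (distr std_normal_distribution borel (\<lambda>x. v + x)) A =
    emeasure (density std_normal_distribution (\<lambda>x. ennreal (exp (v * x - v\<^sup>2 / 2)))) A" .
qed simp

lemma nn_integral_normal_density:
  assumes "\<sigma> > 0" shows "(\<integral>\<^sup>+x. ennreal (normal_density \<mu> \<sigma> x) \<partial>lborel) = 1"
proof -
  interpret prob_space "density lborel (normal_density \<mu> \<sigma>)"
    using assms by (rule prob_space_normal_density)
  show ?thesis using emeasure_space_1 by (simp add: emeasure_density)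
qed

lemma nn_integral_exp_std_normal:
  "(\<integral>\<^sup>+x. ennreal (exp (v * x)) \<partial>std_normal_distribution) = ennreal (exp (v\<^sup>2 / 2))"
proof -
  have eq: "std_normal_density x * exp (v * x) = exp (v\<^sup>2 / 2) * normal_density v 1 x" for x
    unfolding normal_density_def
    by (simp add: mult_exp_exp power2_eq_square field_simps flip: exp_add)
  have "(\<integral>\<^sup>+x. ennreal (exp (v * x)) \<partial>std_normal_distribution) =
     (\<integral>\<^sup>+x. ennreal (exp (v\<^sup>2 / 2)) * ennreal (normal_density v 1 x) \<partial>lborel)"
    by (subst nn_integral_density)
       (auto intro!: nn_integral_cong simp: eq simp flip: ennreal_mult')
  also have "\<dots> = ennreal (exp (v\<^sup>2 / 2))"
    by (simp add: nn_integral_cmult nn_integral_normal_density)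
  finally show ?thesis .
qed

text \<open>The transform of a noncentral chi-square variable is explicit,
  \<open>\<sigma> * exp (s - s * v\<^sup>2 / (1 + 2 * s))\<close>. The only loss is the estimate
  \<open>\<sigma> \<le> exp (s\<^sup>2 - s)\<close>, whose quadratic term can be summed over all
  coordinates.\<close>

lemma std_normal_laplace_square:
  assumes s: "s \<ge> 0"
  shows "(\<integral>\<^sup>+x. ennreal (exp (- s * ((v + x)\<^sup>2 - 1))) \<partial>std_normal_distribution)
    \<le> ennreal (exp (s\<^sup>2 - s * v\<^sup>2 / (1 + 2 * s)))"
proof -
  \<comment> \<open>Completing the square in \<open>x\<close>: the tilted Gaussian density is a
    multiple of the normal density with this mean and standard deviation.\<close>
  define \<sigma> \<mu> where "\<sigma> = 1 / sqrt (1 + 2 * s)" and "\<mu> = - 2 * s * v / (1 + 2 * s)"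
  have p: "1 + 2 * s > 0" using s by simp
  have s2: "\<sigma>\<^sup>2 = 1 / (1 + 2 * s)" using p by (simp add: \<sigma>_def power_divide)
  have \<sigma>: "\<sigma> > 0" using p by (simp add: \<sigma>_def)
  have ex: "- s * ((v + x)\<^sup>2 - 1) - x\<^sup>2 / 2 = s - s * v\<^sup>2 / (1 + 2 * s) - (x - \<mu>)\<^sup>2 / (2 * \<sigma>\<^sup>2)" for x
  proof -
    have "x - \<mu> = (x * (1 + 2 * s) + 2 * s * v) / (1 + 2 * s)"
      using p by (simp add: \<mu>_def field_simps)
    then have "(x - \<mu>)\<^sup>2 / (2 * \<sigma>\<^sup>2) = (x * (1 + 2 * s) + 2 * s * v)\<^sup>2 / (2 * (1 + 2 * s))"
      using p unfolding s2 by (simp add: power_divide) (simp add: power2_eq_square)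
    then show ?thesis
    proof (rule ssubst)
      show "- s * ((v + x)\<^sup>2 - 1) - x\<^sup>2 / 2 =
        s - s * v\<^sup>2 / (1 + 2 * s) - (x * (1 + 2 * s) + 2 * s * v)\<^sup>2 / (2 * (1 + 2 * s))"
        using p by (simp add: divide_simps) (simp add: algebra_simps power2_eq_square)
    qed
  qed
  have eq: "std_normal_density x * exp (- s * ((v + x)\<^sup>2 - 1)) =
      \<sigma> * exp (s - s * v\<^sup>2 / (1 + 2 * s)) * normal_density \<mu> \<sigma> x" for x
  proof -
    have "std_normal_density x * exp (- s * ((v + x)\<^sup>2 - 1)) =
        1 / sqrt (2 * pi) * exp (- s * ((v + x)\<^sup>2 - 1) - x\<^sup>2 / 2)"
      by (simp add: std_normal_density_def flip: exp_add)
    also have "\<dots> = 1 / sqrt (2 * pi) * (exp (s - s * v\<^sup>2 / (1 + 2 * s)) * exp (- (x - \<mu>)\<^sup>2 / (2 * \<sigma>\<^sup>2)))"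
      unfolding ex by (simp flip: exp_add)
    also have "\<dots> = \<sigma> * exp (s - s * v\<^sup>2 / (1 + 2 * s)) * normal_density \<mu> \<sigma> x"
      using \<sigma> by (simp add: normal_density_def real_sqrt_mult)
    finally show ?thesis .
  qed
  have "(\<integral>\<^sup>+x. ennreal (exp (- s * ((v + x)\<^sup>2 - 1))) \<partial>std_normal_distribution) =
     (\<integral>\<^sup>+x. ennreal (\<sigma> * exp (s - s * v\<^sup>2 / (1 + 2 * s))) * ennreal (normal_density \<mu> \<sigma> x) \<partial>lborel)"
    using \<sigma> by (subst nn_integral_density)
       (auto intro!: nn_integral_cong simp: eq[simplified] simp flip: ennreal_mult')
  also have "\<dots> = ennreal (\<sigma> * exp (s - s * v\<^sup>2 / (1 + 2 * s)))"
    using \<sigma> by (simp add: nn_integral_cmult nn_integral_normal_density)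
  also have "\<dots> \<le> ennreal (exp (s\<^sup>2 - s * v\<^sup>2 / (1 + 2 * s)))"
  proof (rule ennreal_leI)
    have "ln (1 + 2 * s) \<ge> 2 * s - (2 * s)\<^sup>2 / 2"
    proof -
      \<comment> \<open>The derivative simplifies to
        \<open>8 * t\<^sup>2 / (1 + 2 * t)\<close>.\<close>
      let ?f = "\<lambda>t. ln (1 + 2 * t) - 2 * t + 2 * t\<^sup>2"
      have "?f 0 \<le> ?f s"
      proof (rule DERIV_nonneg_imp_nondecreasing[OF s])
        fix t assume t: "0 \<le> t" "t \<le> s"
        have "(?f has_real_derivative (2 / (1 + 2 * t) - 2 + 4 * t)) (at t)"
          using t by (auto intro!: derivative_eq_intros)
        moreover have "2 / (1 + 2 * t) - 2 + 4 * t \<ge> 0"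
          using t by (simp add: field_simps)
        ultimately show "\<exists>y. (?f has_real_derivative y) (at t) \<and> 0 \<le> y" by blast
      qed
      then show ?thesis by (simp add: power2_eq_square)
    qed
    moreover have "ln \<sigma> = - ln (1 + 2 * s) / 2"
      using p by (simp add: \<sigma>_def ln_div ln_sqrt)
    ultimately have "\<sigma> \<le> exp (s\<^sup>2 - s)"
      using \<sigma> by (subst ln_le_cancel_iff[symmetric]) (auto simp: power2_eq_square)
    then have "\<sigma> * exp (s - s * v\<^sup>2 / (1 + 2 * s)) \<le> exp (s\<^sup>2 - s) * exp (s - s * v\<^sup>2 / (1 + 2 * s))"
      by (intro mult_right_mono) auto
    then show "\<sigma> * exp (s - s * v\<^sup>2 / (1 + 2 * s)) \<le> exp (s\<^sup>2 - s * v\<^sup>2 / (1 + 2 * s))"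
      by (simp flip: exp_add)
  qed
  finally show ?thesis .
qed

section \<open>The chi-square statistic\<close>

text \<open>The square of a standard Gaussian minus 1 has mean 0 and variance 2, so its
  characteristic function agrees to second order with that of a centred Gaussian of variance 2; the
  finite third absolute moment controls the remainder.\<close>

lemma std_normal_char_square:
  obtains C where "C \<ge> 0"
    "\<And>s. cmod ((\<integral>x. iexp (s * (x\<^sup>2 - 1)) \<partial>std_normal_distribution) - exp (- (complex_of_real s)\<^sup>2)) \<le> C * \<bar>s\<bar> ^ 3"
proof -
  let ?N = "std_normal_distribution"
  interpret N: prob_space ?N by (rule prob_space_std_normal)
  define M where "M = (\<integral>x. \<bar>x\<^sup>2 - 1\<bar> ^ 3 \<partial>?N)"
  note int = integrable_std_normal_distribution_moment
  have U: "measure ?N UNIV = 1" using N.prob_space by simp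
  have i2: "integrable ?N (\<lambda>x. x\<^sup>2 - 1)" by (intro Bochner_Integration.integrable_diff int) simp
  have m2: "(\<integral>x. x\<^sup>2 \<partial>?N) = 1" using std_normal_distribution_even_moments(1)[of 1] by (simp add: fact_numeral)
  have m4: "(\<integral>x. x ^ 4 \<partial>?N) = 3" using std_normal_distribution_even_moments(1)[of 2] by (simp add: fact_numeral)
  have sq: "(x\<^sup>2 - 1)\<^sup>2 = x ^ 4 - 2 * x\<^sup>2 + 1" for x :: real
    by (simp add: power2_eq_square power4_eq_xxxx algebra_simps)
  have i4: "integrable ?N (\<lambda>x. (x\<^sup>2 - 1)\<^sup>2)"
    unfolding sq by (intro Bochner_Integration.integrable_add Bochner_Integration.integrable_diff integrable_mult_right int) simp
  have E: "(\<integral>x. x\<^sup>2 - 1 \<partial>?N) = 0"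
    by (subst Bochner_Integration.integral_diff[OF int]) (simp_all add: m2 U)
  have V: "(\<integral>x. (x\<^sup>2 - 1)\<^sup>2 \<partial>?N) = 2"
  proof -
    have "(\<integral>x. (x\<^sup>2 - 1)\<^sup>2 \<partial>?N) = (\<integral>x. (x ^ 4 - 2 * x\<^sup>2) + 1 \<partial>?N)"
      unfolding sq ..
    also have "\<dots> = (\<integral>x. (x ^ 4 - 2 * x\<^sup>2) \<partial>?N) + (\<integral>x. 1 \<partial>?N)"
      by (intro Bochner_Integration.integral_add Bochner_Integration.integrable_diff integrable_mult_right int) simp
    also have "(\<integral>x. (x ^ 4 - 2 * x\<^sup>2) \<partial>?N) = (\<integral>x. x ^ 4 \<partial>?N) - (\<integral>x. 2 * x\<^sup>2 \<partial>?N)"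
      by (intro Bochner_Integration.integral_diff integrable_mult_right int)
    finally show ?thesis by (simp add: m2 m4 U)
  qed
  have i6: "integrable ?N (\<lambda>x. \<bar>x\<^sup>2 - 1\<bar> ^ 3)"
  proof (rule Bochner_Integration.integrable_bound)
    have "integrable ?N (\<lambda>x. (x\<^sup>2 + 1) ^ 3)"
    proof -
      have "(x\<^sup>2 + 1) ^ 3 = x ^ 6 + 3 * x ^ 4 + 3 * x\<^sup>2 + 1" for x :: real
        by (simp add: power2_eq_square eval_nat_numeral algebra_simps)
      then show ?thesis
        by (simp only:) (intro Bochner_Integration.integrable_add integrable_mult_right int N.integrable_const)
    qed
    then show "integrable ?N (\<lambda>x. (x\<^sup>2 + 1) ^ 3)" .
    show "AE x in ?N. norm (\<bar>x\<^sup>2 - 1\<bar> ^ 3) \<le> norm ((x\<^sup>2 + 1) ^ 3)"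
    proof (rule AE_I2)
      fix x :: real
      have "\<bar>x\<^sup>2 - 1\<bar> \<le> x\<^sup>2 + 1"
        using zero_le_power2[of x] by linarith
      then have "\<bar>x\<^sup>2 - 1\<bar> ^ 3 \<le> (x\<^sup>2 + 1) ^ 3" by (intro power_mono) auto
      then show "norm (\<bar>x\<^sup>2 - 1\<bar> ^ 3) \<le> norm ((x\<^sup>2 + 1) ^ 3)" by simp
    qed
  qed measurable
  have M: "M \<ge> 0" unfolding M_def by (intro integral_nonneg_AE) auto
  show thesis
  proof (rule that[of "M / 6 + 2"])
    show "0 \<le> M / 6 + 2" using M by simp
    fix s :: real
    have "cmod (char (distr ?N borel (\<lambda>x. x\<^sup>2 - 1)) s - (1 - s\<^sup>2 * 2 / 2)) \<le>
        (s\<^sup>2 / 6) * (\<integral>x. min (6 * (x\<^sup>2 - 1)\<^sup>2) (\<bar>s\<bar> * \<bar>x\<^sup>2 - 1\<bar> ^ 3) \<partial>?N)"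
      by (rule N.char_approx3'[OF _ i2 i4 E _ refl]) (simp_all add: E V)
    also have "\<dots> \<le> (s\<^sup>2 / 6) * (\<integral>x. \<bar>s\<bar> * \<bar>x\<^sup>2 - 1\<bar> ^ 3 \<partial>?N)"
      by (intro mult_left_mono integral_mono Bochner_Integration.integrable_min integrable_mult_right i4 i6) auto
    also have "\<dots> = M / 6 * \<bar>s\<bar> ^ 3"
      by (simp add: M_def power3_eq_cube power2_eq_square mult_ac)
    finally have 1: "cmod (char (distr ?N borel (\<lambda>x. x\<^sup>2 - 1)) s - (1 - s\<^sup>2)) \<le> M / 6 * \<bar>s\<bar> ^ 3"
      by simp
    \<comment> \<open>For small \<open>s\<close>, the inequality \<open>exp y \<ge> 1 + y\<close> at
      \<open>y = - s\<^sup>2\<close> and at \<open>y = s\<^sup>2\<close> leaves an error of at most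
      \<open>s ^ 4\<close>; for large \<open>s\<close> crude bounds are enough.\<close>
    have 2: "\<bar>exp (- s\<^sup>2) - (1 - s\<^sup>2)\<bar> \<le> 2 * \<bar>s\<bar> ^ 3"
    proof (cases "\<bar>s\<bar> \<le> 1")
      case True
      have s1: "s\<^sup>2 \<le> 1" using True by (simp add: abs_square_le_1)
      have lo: "1 - s\<^sup>2 \<le> exp (- s\<^sup>2)" using exp_ge_add_one_self[of "- s\<^sup>2"] by simp
      have "exp (- s\<^sup>2) \<le> 1 / (1 + s\<^sup>2)"
        using exp_ge_add_one_self[of "s\<^sup>2"] zero_le_power2[of s]
        by (simp add: exp_minus inverse_eq_divide frac_le add_pos_nonneg)
      moreover have aux: "1 / (1 + y) \<le> 1 - y + y * y" if "y \<ge> 0" for y :: real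
      proof -
        have "1 \<le> (1 - y + y * y) * (1 + y)" using that by (simp add: algebra_simps)
        then show ?thesis using that by (subst divide_le_eq) auto
      qed
      ultimately have "exp (- s\<^sup>2) - (1 - s\<^sup>2) \<le> s\<^sup>2 * s\<^sup>2"
        using aux[OF zero_le_power2[of s]] by linarith
      also have "\<dots> = \<bar>s\<bar> * \<bar>s\<bar> ^ 3" by (simp add: power2_eq_square power3_eq_cube)
      also have "\<dots> \<le> 1 * \<bar>s\<bar> ^ 3" using True by (intro mult_right_mono) auto
      finally show ?thesis using lo by simp
    next
      case False
      then have "\<bar>s\<bar>\<^sup>2 * 1 \<le> \<bar>s\<bar>\<^sup>2 * \<bar>s\<bar>" by (intro mult_left_mono) auto
      moreover have "1 \<le> \<bar>s\<bar>\<^sup>2" using False by (intro one_le_power) auto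
      moreover have "exp (- s\<^sup>2) \<le> 1" "exp (- s\<^sup>2) > 0" "\<bar>s\<bar>\<^sup>2 = s\<^sup>2" by simp_all
      moreover have "\<bar>s\<bar> ^ 3 = \<bar>s\<bar>\<^sup>2 * \<bar>s\<bar>" by (simp add: power2_eq_square power3_eq_cube)
      ultimately show ?thesis unfolding abs_le_iff by linarith
    qed
    have c: "char (distr ?N borel (\<lambda>x. x\<^sup>2 - 1)) s = (\<integral>x. iexp (s * (x\<^sup>2 - 1)) \<partial>?N)"
      unfolding char_def by (subst integral_distr) auto
    have "exp (- (complex_of_real s)\<^sup>2) - (1 - (complex_of_real s)\<^sup>2) =
        complex_of_real (exp (- s\<^sup>2) - (1 - s\<^sup>2))"
      by (simp flip: exp_of_real)
    then have "cmod (exp (- (complex_of_real s)\<^sup>2) - (1 - (complex_of_real s)\<^sup>2)) = \<bar>exp (- s\<^sup>2) - (1 - s\<^sup>2)\<bar>"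
      by (simp only: norm_of_real)
    with 2 have 3: "cmod (exp (- (complex_of_real s)\<^sup>2) - (1 - (complex_of_real s)\<^sup>2)) \<le> 2 * \<bar>s\<bar> ^ 3" by simp
    have "cmod ((\<integral>x. iexp (s * (x\<^sup>2 - 1)) \<partial>?N) - exp (- (complex_of_real s)\<^sup>2)) \<le>
        M / 6 * \<bar>s\<bar> ^ 3 + 2 * \<bar>s\<bar> ^ 3"
      using norm_triangle_ineq4[of "char (distr ?N borel (\<lambda>x. x\<^sup>2 - 1)) s - (1 - (complex_of_real s)\<^sup>2)"
          "exp (- (complex_of_real s)\<^sup>2) - (1 - (complex_of_real s)\<^sup>2)"] 1 3
      by (simp add: c)
    then show "cmod ((\<integral>x. iexp (s * (x\<^sup>2 - 1)) \<partial>?N) - exp (- (complex_of_real s)\<^sup>2)) \<le>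
        (M / 6 + 2) * \<bar>s\<bar> ^ 3"
      by (simp add: algebra_simps)
  qed
qed

section \<open>Unordered sums over the integers\<close>

lemma filterlim_int_exhaustion:
  "filterlim (\<lambda>n. int_decode ` {..<n}) (finite_subsets_at_top UNIV) sequentially"
  unfolding filterlim_finite_subsets_at_top
proof safe
  fix X :: "int set" assume X: "finite X"
  define n where "n = Suc (Max (int_encode ` X))"
  have "X \<subseteq> int_decode ` {..<m}" if "m \<ge> n" for m
  proof
    fix x assume x: "x \<in> X"
    then have "int_encode x \<le> Max (int_encode ` X)" using X by (intro Max_ge) auto
    then have "int_encode x < m" using that by (simp add: n_def)
    then show "x \<in> int_decode ` {..<m}" by (intro image_eqI[of _ _ "int_encode x"]) auto
  qed
  then show "\<forall>\<^sub>F m in sequentially. finite (int_decode ` {..<m}) \<and> X \<subseteq> int_decode ` {..<m} \<and>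
      int_decode ` {..<m} \<subseteq> UNIV"
    by (auto simp: eventually_sequentially)
qed

text \<open>Exchanges the filter of finite sets for a sequence, since dominated convergence and
  Fatou's lemma are applied along sequences.\<close>

lemma infsum_int_tendsto:
  fixes f :: "int \<Rightarrow> real"
  assumes "f summable_on UNIV"
  shows "(\<lambda>n. sum f (int_decode ` {..<n})) \<longlonglongrightarrow> infsum f UNIV"
  using filterlim_compose[OF has_sum_infsum[OF assms, unfolded has_sum_def] filterlim_int_exhaustion] .

lemma summable_on_int_iff:
  fixes f :: "int \<Rightarrow> real"
  shows "f summable_on UNIV \<longleftrightarrow> summable (\<lambda>n. \<bar>f (int_decode n)\<bar>)"
proof -
  have "f summable_on UNIV \<longleftrightarrow> (\<lambda>k. \<bar>f k\<bar>) summable_on UNIV"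
    using summable_on_iff_abs_summable_on_real[of f UNIV] by (simp add: real_norm_def)
  also have "\<dots> \<longleftrightarrow> (\<lambda>n. \<bar>f (int_decode n)\<bar>) summable_on UNIV"
    by (rule summable_on_reindex_bij_betw[symmetric]) (rule bij_int_decode)
  also have "\<dots> \<longleftrightarrow> summable (\<lambda>n. \<bar>f (int_decode n)\<bar>)"
    by (rule summable_on_UNIV_nonneg_real_iff) simp
  finally show ?thesis .
qed

lemma summable_iff_suminf_ennreal:
  fixes f :: "nat \<Rightarrow> real"
  shows "summable (\<lambda>n. \<bar>f n\<bar>) \<longleftrightarrow> (\<Sum>n. ennreal \<bar>f n\<bar>) \<noteq> \<top>"
proof
  show "summable (\<lambda>n. \<bar>f n\<bar>) \<Longrightarrow> (\<Sum>n. ennreal \<bar>f n\<bar>) \<noteq> \<top>"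
    by (simp add: suminf_ennreal2)
  show "(\<Sum>n. ennreal \<bar>f n\<bar>) \<noteq> \<top> \<Longrightarrow> summable (\<lambda>n. \<bar>f n\<bar>)"
    by (rule summable_suminf_not_top) auto
qed

text \<open>\<open>infsum\<close> takes the default value 0 on non-summable families, so that event
  must be shown measurable too: it is the event that the ordinary series of absolute values is
  infinite. Off it, \<open>infsum\<close> is the value of an ordinary series.\<close>

lemma borel_measurable_infsum_int:
  fixes f :: "'a \<Rightarrow> int \<Rightarrow> real"
  assumes [measurable]: "\<And>k. (\<lambda>x. f x k) \<in> borel_measurable M"
  shows "(\<lambda>x. \<Sum>\<^sub>\<infinity>k. f x k) \<in> borel_measurable M"
proof -
  have "(\<Sum>\<^sub>\<infinity>k. f x k) = (if (\<Sum>n. ennreal \<bar>f x (int_decode n)\<bar>) \<noteq> \<top> then \<Sum>n. f x (int_decode n) else 0)" for x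
  proof (cases "f x summable_on UNIV")
    case True
    have "(\<lambda>n. \<Sum>m<n. f x (int_decode m)) \<longlonglongrightarrow> infsum (f x) UNIV"
      using infsum_int_tendsto[OF True] by (simp add: sum.reindex inj_int_decode o_def)
    then have "(\<Sum>n. f x (int_decode n)) = infsum (f x) UNIV"
      using sums_unique[of "\<lambda>n. f x (int_decode n)"] by (simp add: sums_def)
    then show ?thesis
      using True by (simp add: summable_on_int_iff summable_iff_suminf_ennreal)
  next
    case False
    then have "(\<Sum>\<^sub>\<infinity>k. f x k) = 0" by (rule infsum_not_exists)
    then show ?thesis
      using False by (simp add: summable_on_int_iff summable_iff_suminf_ennreal)
  qed
  then show ?thesis by simp
qed

text \<open>By Tonelli the expected sum of absolute values is finite, hence the sum itself is finite
  almost everywhere.\<close>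

lemma AE_summable_on_int:
  fixes f :: "int \<Rightarrow> 'a \<Rightarrow> real"
  assumes [measurable]: "\<And>k. f k \<in> borel_measurable M"
    and b: "\<And>k. (\<integral>\<^sup>+x. ennreal \<bar>f k x\<bar> \<partial>M) \<le> ennreal (B k)" and B: "B summable_on UNIV"
    and B0: "\<And>k. B k \<ge> 0"
  shows "AE x in M. (\<lambda>k. f k x) summable_on UNIV"
proof -
  have "(\<integral>\<^sup>+x. (\<Sum>n. ennreal \<bar>f (int_decode n) x\<bar>) \<partial>M) = (\<Sum>n. \<integral>\<^sup>+x. ennreal \<bar>f (int_decode n) x\<bar> \<partial>M)"
    by (rule nn_integral_suminf) measurable
  also have "\<dots> \<le> (\<Sum>n. ennreal (B (int_decode n)))"
    by (intro suminf_le b) auto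
  also have "\<dots> < \<top>"
    using B B0 by (auto simp: summable_on_int_iff suminf_ennreal2)
  finally have "AE x in M. (\<Sum>n. ennreal \<bar>f (int_decode n) x\<bar>) \<noteq> \<infinity>"
    by (intro nn_integral_PInf_AE) auto
  then show ?thesis
    by eventually_elim (simp add: summable_on_int_iff summable_iff_suminf_ennreal)
qed

text \<open>What the distributional estimates need from the extremal problem. The square of a
  standard Gaussian has variance 2, so the value 1/2 gives the statistic unit variance under the
  null hypothesis; it also forces every weight to be at most 1.\<close>

locale chi2_weights =
  fixes d :: nat and w :: "int \<Rightarrow> real"
  assumes d_pos: "d \<ge> 1" and w_nonneg: "w k \<ge> 0" and w_summable: "w summable_on UNIV"
    and w_sq_summable: "(\<lambda>k. (w k)\<^sup>2) summable_on UNIV"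
    and w_sq_sum: "(\<Sum>\<^sub>\<infinity>k. (w k)\<^sup>2) = 1/2"
begin

text \<open>Written in units of the noise level: an observation
  \<open>u + \<epsilon> * \<eta>\<close> divided by \<open>\<epsilon>\<close> is
  \<open>v + \<eta>\<close> with \<open>v = u / \<epsilon>\<close>.\<close>

definition shifted_stat :: "(nat \<Rightarrow> int \<Rightarrow> real) \<Rightarrow> (nat \<times> int \<Rightarrow> real) \<Rightarrow> real" where
  "shifted_stat v \<eta> = 1 / sqrt (real d) * (\<Sum>j=1..d. \<Sum>\<^sub>\<infinity>k. w k * ((v j k + \<eta> (j, k))\<^sup>2 - 1))"

definition window :: "nat \<Rightarrow> (nat \<times> int) set" where
  "window n = {1..d} \<times> int_decode ` {..<n}"

definition partial_stat :: "(nat \<Rightarrow> int \<Rightarrow> real) \<Rightarrow> nat \<Rightarrow> (nat \<times> int \<Rightarrow> real) \<Rightarrow> real" where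
  "partial_stat v n \<eta> = (\<Sum>(j, k)\<in>window n. w k / sqrt (real d) * ((v j k + \<eta> (j, k))\<^sup>2 - 1))"

lemma finite_window: "finite (window n)" and window_subset: "window n \<subseteq> obs_index d"
  by (auto simp: window_def obs_index_def)

lemma sum_w_sq_le: "finite A \<Longrightarrow> (\<Sum>k\<in>A. (w k)\<^sup>2) \<le> 1/2"
  using finite_sum_le_infsum[OF w_sq_summable, of A] w_sq_sum by auto

lemma w_le_1: "w k \<le> 1"
proof -
  have "(w k)\<^sup>2 \<le> 1\<^sup>2" using sum_w_sq_le[of "{k}"] by simp
  then show ?thesis by (rule power2_le_imp_le) simp
qed

lemma measurable_noise_coordinate: "i \<in> obs_index d \<Longrightarrow> (\<lambda>x. x i) \<in> borel_measurable (noise_law d)"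
  using measurable_obs_coordinate measurable_cong_sets[OF sets_noise_law refl] by blast

lemma measurable_shifted_stat: "shifted_stat v \<in> borel_measurable (noise_law d)"
  unfolding shifted_stat_def [abs_def]
  by (intro borel_measurable_times borel_measurable_const borel_measurable_sum
      borel_measurable_infsum_int borel_measurable_diff borel_measurable_power borel_measurable_add
      measurable_noise_coordinate) (auto simp: obs_index_def)

lemma measurable_partial_stat: "partial_stat v n \<in> borel_measurable (noise_law d)"
  unfolding partial_stat_def [abs_def] split_beta
  by (intro borel_measurable_times borel_measurable_const borel_measurable_sum
      borel_measurable_diff borel_measurable_power borel_measurable_add
      measurable_noise_coordinate) (auto simp: obs_index_def window_def)

lemma nn_integral_noise_coordinate:
  "i \<in> obs_index d \<Longrightarrow> f \<in> borel_measurable borel \<Longrightarrow>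
    (\<integral>\<^sup>+\<eta>. f (\<eta> i) \<partial>noise_law d) = (\<integral>\<^sup>+x. f x \<partial>std_normal_distribution)"
  unfolding noise_law_def by (intro nn_integral_PiM_component prob_space_std_normal) auto

lemma AE_summable_on_square:
  assumes "j \<in> {1..d}" and v: "(\<lambda>k. (v j k)\<^sup>2) summable_on UNIV"
  shows "AE \<eta> in noise_law d. (\<lambda>k. w k * ((v j k + \<eta> (j, k))\<^sup>2 - 1)) summable_on UNIV"
proof (rule AE_summable_on_int)
  have j: "(j, k) \<in> obs_index d" for k using assms by (auto simp: obs_index_def)
  show "(\<lambda>\<eta>. w k * ((v j k + \<eta> (j, k))\<^sup>2 - 1)) \<in> borel_measurable (noise_law d)" for k
    by (intro borel_measurable_times borel_measurable_const
      borel_measurable_diff borel_measurable_power borel_measurable_add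
      measurable_noise_coordinate j)
  \<comment> \<open>Origin of this majorant:
    \<open>(v + x)\<^sup>2 \<le> 2 * v\<^sup>2 + 2 * x\<^sup>2\<close>, one more for the subtracted
    1, and the second moment of a standard Gaussian is 1.\<close>
  show "0 \<le> w k * (2 * (v j k)\<^sup>2 + 3)" for k using w_nonneg by simp
  have "(\<lambda>k. w k * (v j k)\<^sup>2) summable_on UNIV"
  proof (rule summable_on_comparison_test[OF v])
    show "w k * (v j k)\<^sup>2 \<le> (v j k)\<^sup>2" for k
      using mult_right_mono[OF w_le_1 zero_le_power2[of "v j k"], of k] by simp
  qed (use w_nonneg in auto)
  then have "(\<lambda>k. 2 * (w k * (v j k)\<^sup>2) + 3 * w k) summable_on UNIV"
    by (intro summable_on_add summable_on_cmult_right w_summable)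
  then show "(\<lambda>k. w k * (2 * (v j k)\<^sup>2 + 3)) summable_on UNIV"
    by (simp add: algebra_simps)
  fix k
  let ?N = std_normal_distribution
  interpret N: prob_space ?N by (rule prob_space_std_normal)
  have m2: "(\<integral>x. x\<^sup>2 \<partial>?N) = 1" using std_normal_distribution_even_moments(1)[of 1] by (simp add: fact_numeral)
  have i: "integrable ?N (\<lambda>x. w k * (2 * x\<^sup>2 + (2 * (v j k)\<^sup>2 + 1)))"
    by (intro integrable_mult_right Bochner_Integration.integrable_add integrable_std_normal_distribution_moment
        N.integrable_const)
  have "(\<integral>\<^sup>+\<eta>. ennreal \<bar>w k * ((v j k + \<eta> (j, k))\<^sup>2 - 1)\<bar> \<partial>noise_law d) =
      (\<integral>\<^sup>+x. ennreal \<bar>w k * ((v j k + x)\<^sup>2 - 1)\<bar> \<partial>?N)"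
    by (rule nn_integral_noise_coordinate[OF j]) measurable
  also have "\<dots> \<le> (\<integral>\<^sup>+x. ennreal (w k * (2 * x\<^sup>2 + (2 * (v j k)\<^sup>2 + 1))) \<partial>?N)"
  proof (intro nn_integral_mono ennreal_leI)
    fix x
    have "0 \<le> (v j k - x)\<^sup>2" by simp
    then have "(v j k + x)\<^sup>2 \<le> 2 * x\<^sup>2 + 2 * (v j k)\<^sup>2" by (simp add: power2_sum power2_diff)
    then have "\<bar>(v j k + x)\<^sup>2 - 1\<bar> \<le> 2 * x\<^sup>2 + (2 * (v j k)\<^sup>2 + 1)"
      using zero_le_power2[of "v j k + x"] zero_le_power2[of x] zero_le_power2[of "v j k"]
      unfolding abs_le_iff by linarith
    then show "\<bar>w k * ((v j k + x)\<^sup>2 - 1)\<bar> \<le> w k * (2 * x\<^sup>2 + (2 * (v j k)\<^sup>2 + 1))"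
      using w_nonneg by (simp add: abs_mult mult_left_mono)
  qed
  also have "\<dots> = ennreal (\<integral>x. w k * (2 * x\<^sup>2 + (2 * (v j k)\<^sup>2 + 1)) \<partial>?N)"
    using w_nonneg by (intro nn_integral_eq_integral i AE_I2) simp
  also have "(\<integral>x. w k * (2 * x\<^sup>2 + (2 * (v j k)\<^sup>2 + 1)) \<partial>?N) = w k * (2 * (v j k)\<^sup>2 + 3)"
  proof -
    have U: "measure ?N UNIV = 1" using N.prob_space by simp
    have "(\<integral>x. 2 * x\<^sup>2 + (2 * (v j k)\<^sup>2 + 1) \<partial>?N) = (\<integral>x. 2 * x\<^sup>2 \<partial>?N) + (\<integral>x. 2 * (v j k)\<^sup>2 + 1 \<partial>?N)"
      by (intro Bochner_Integration.integral_add integrable_mult_right integrable_std_normal_distribution_moment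
          N.integrable_const)
    then have "(\<integral>x. 2 * x\<^sup>2 + (2 * (v j k)\<^sup>2 + 1) \<partial>?N) = 2 * (v j k)\<^sup>2 + 3"
      by (simp add: m2 U)
    then show ?thesis by simp
  qed
  finally show "(\<integral>\<^sup>+\<eta>. ennreal \<bar>w k * ((v j k + \<eta> (j, k))\<^sup>2 - 1)\<bar> \<partial>noise_law d) \<le>
      ennreal (w k * (2 * (v j k)\<^sup>2 + 3))" .
qed

lemma sum_window: "(\<Sum>(j, k)\<in>window n. f j k) = (\<Sum>j=1..d. \<Sum>k\<in>int_decode ` {..<n}. f j k)"
  unfolding window_def by (rule sum.cartesian_product[symmetric])

lemma AE_partial_stat_tendsto:
  assumes v: "\<And>j. j \<in> {1..d} \<Longrightarrow> (\<lambda>k. (v j k)\<^sup>2) summable_on UNIV"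
  shows "AE \<eta> in noise_law d. (\<lambda>n. partial_stat v n \<eta>) \<longlonglongrightarrow> shifted_stat v \<eta>"
proof -
  have "AE \<eta> in noise_law d. \<forall>j\<in>{1..d}. (\<lambda>k. w k * ((v j k + \<eta> (j, k))\<^sup>2 - 1)) summable_on UNIV"
    by (rule AE_finite_allI) (use AE_summable_on_square v in auto)
  then show ?thesis
  proof eventually_elim
    case (elim \<eta>)
    have "(\<lambda>n. 1 / sqrt (real d) * (\<Sum>j=1..d. \<Sum>k\<in>int_decode ` {..<n}. w k * ((v j k + \<eta> (j, k))\<^sup>2 - 1)))
        \<longlonglongrightarrow> shifted_stat v \<eta>"
      unfolding shifted_stat_def
      by (intro tendsto_mult_left tendsto_sum infsum_int_tendsto) (use elim in auto)
    then show ?case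
      by (simp add: partial_stat_def sum_window sum_distrib_left)
  qed
qed

text \<open>On a finite window the characteristic function is a product and is compared with the
  Gaussian one factor by factor; the window then grows by dominated convergence, all integrands
  having modulus 1. The bound depends on the weights only through their normalisation.\<close>

lemma char_shifted_stat_bound:
  assumes C: "C \<ge> 0"
    "\<And>s. cmod ((\<integral>x. iexp (s * (x\<^sup>2 - 1)) \<partial>std_normal_distribution) - exp (- (complex_of_real s)\<^sup>2)) \<le> C * \<bar>s\<bar> ^ 3"
  shows "cmod (char (distr (noise_law d) borel (shifted_stat (\<lambda>_ _. 0))) s - exp (- s\<^sup>2 / 2))
    \<le> C * \<bar>s\<bar> ^ 3 / sqrt (real d)"
proof -
  let ?N = std_normal_distribution and ?v = "\<lambda>_ _. 0 :: real"
  interpret N: prob_space ?N by (rule prob_space_std_normal)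
  interpret P: prob_space "noise_law d" by (rule prob_space_noise_law)
  define \<phi> where "\<phi> s = (\<integral>x. iexp (s * (x\<^sup>2 - 1)) \<partial>?N)" for s
  define a where "a i = s * w (snd i) / sqrt (real d)" for i :: "nat \<times> int"
  have d0: "sqrt (real d) > 0" using d_pos by simp
  have sq: "(\<Sum>i\<in>window n. (a i)\<^sup>2) = s\<^sup>2 * (\<Sum>k\<in>int_decode ` {..<n}. (w k)\<^sup>2)" for n
  proof -
    have "(\<Sum>i\<in>window n. (a i)\<^sup>2) = (\<Sum>(j, k)\<in>window n. s\<^sup>2 * (w k)\<^sup>2 / real d)"
      by (intro sum.cong) (auto simp: a_def power_mult_distrib power_divide)
    also have "\<dots> = s\<^sup>2 * (\<Sum>k\<in>int_decode ` {..<n}. (w k)\<^sup>2)"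
      using d_pos by (simp add: sum_window sum_distrib_left)
    finally show ?thesis .
  qed
  \<comment> \<open>Cubes are dominated by squares because \<open>w k \<le> 1\<close>, so each of
    the \<open>d\<close> rows contributes at most a multiple of
    \<open>d powr (-3/2)\<close>.\<close>
  have cube: "(\<Sum>i\<in>window n. \<bar>a i\<bar> ^ 3) \<le> \<bar>s\<bar> ^ 3 / sqrt (real d)" for n
  proof -
    have "(\<Sum>i\<in>window n. \<bar>a i\<bar> ^ 3) = (\<Sum>(j, k)\<in>window n. \<bar>s\<bar> ^ 3 * (w k) ^ 3 / sqrt (real d) ^ 3)"
      using w_nonneg d0
      by (intro sum.cong) (auto simp: a_def power_mult_distrib power_divide abs_mult)
    also have "\<dots> = real d * (\<bar>s\<bar> ^ 3 * (\<Sum>k\<in>int_decode ` {..<n}. (w k) ^ 3) / sqrt (real d) ^ 3)"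
      by (simp add: sum_window sum_distrib_left sum_divide_distrib[symmetric])
    also have "\<dots> \<le> real d * (\<bar>s\<bar> ^ 3 * 1 / sqrt (real d) ^ 3)"
    proof (intro mult_left_mono divide_right_mono)
      have "(\<Sum>k\<in>int_decode ` {..<n}. (w k) ^ 3) \<le> (\<Sum>k\<in>int_decode ` {..<n}. (w k)\<^sup>2)"
      proof (rule sum_mono)
        fix k show "(w k) ^ 3 \<le> (w k)\<^sup>2"
          using mult_right_mono[OF w_le_1 zero_le_power2[of "w k"], of k]
          by (simp add: power3_eq_cube power2_eq_square)
      qed
      also have "\<dots> \<le> 1/2" by (rule sum_w_sq_le) simp
      finally show "(\<Sum>k\<in>int_decode ` {..<n}. (w k) ^ 3) \<le> 1" by simp
    qed auto
    also have "\<dots> = \<bar>s\<bar> ^ 3 / sqrt (real d)"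
      using d0 by (simp add: power3_eq_cube)
    finally show ?thesis .
  qed
  have bound: "cmod ((\<integral>\<eta>. iexp (s * partial_stat ?v n \<eta>) \<partial>noise_law d)
      - exp (- (s\<^sup>2 * (\<Sum>k\<in>int_decode ` {..<n}. (w k)\<^sup>2)))) \<le> C * (\<bar>s\<bar> ^ 3 / sqrt (real d))" for n
  proof -
    have "(\<integral>\<eta>. iexp (s * partial_stat ?v n \<eta>) \<partial>noise_law d) =
        (\<integral>\<eta>. (\<Prod>i\<in>window n. iexp (a i * ((\<eta> i)\<^sup>2 - 1))) \<partial>noise_law d)"
    proof (rule Bochner_Integration.integral_cong[OF refl])
      fix \<eta>
      have "s * partial_stat ?v n \<eta> = (\<Sum>i\<in>window n. a i * ((\<eta> i)\<^sup>2 - 1))"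
        unfolding partial_stat_def sum_distrib_left
        by (intro sum.cong) (auto simp: a_def)
      then show "iexp (s * partial_stat ?v n \<eta>) = (\<Prod>i\<in>window n. iexp (a i * ((\<eta> i)\<^sup>2 - 1)))"
        by (simp only: of_real_sum sum_distrib_left exp_sum[OF finite_window])
    qed
    also have "\<dots> = (\<Prod>i\<in>window n. \<phi> (a i))"
      unfolding noise_law_def \<phi>_def
      by (subst integral_PiM_prod[OF prob_space_std_normal finite_window window_subset])
         (auto intro!: N.integrable_const_bound[where B = 1])
    finally have 1: "(\<integral>\<eta>. iexp (s * partial_stat ?v n \<eta>) \<partial>noise_law d) = (\<Prod>i\<in>window n. \<phi> (a i))" .
    have 2: "complex_of_real (exp (- (s\<^sup>2 * (\<Sum>k\<in>int_decode ` {..<n}. (w k)\<^sup>2)))) =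
       (\<Prod>i\<in>window n. exp (- (complex_of_real (a i))\<^sup>2))"
      unfolding sq[symmetric]
      by (simp add: exp_sum[OF finite_window] sum_negf[symmetric] flip: exp_of_real)
    \<comment> \<open>All factors lie in the closed unit disc, so exchanging them one at a time
      bounds the difference of the products by the sum of the differences.\<close>
    have "cmod ((\<Prod>i\<in>window n. \<phi> (a i)) - (\<Prod>i\<in>window n. exp (- (complex_of_real (a i))\<^sup>2))) \<le>
        (\<Sum>i\<in>window n. cmod (\<phi> (a i) - exp (- (complex_of_real (a i))\<^sup>2)))"
    proof (rule norm_prod_diff)
      fix i
      have "cmod (\<phi> (a i)) \<le> (\<integral>x. cmod (iexp (a i * (x\<^sup>2 - 1))) \<partial>?N)"
        unfolding \<phi>_def by (rule integral_norm_bound)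
      also have "\<dots> = 1" using N.prob_space by simp
      finally show "cmod (\<phi> (a i)) \<le> 1" .
      show "cmod (exp (- (complex_of_real (a i))\<^sup>2)) \<le> 1"
        by (simp add: norm_exp_eq_Re flip: of_real_power)
    qed
    also have "\<dots> \<le> (\<Sum>i\<in>window n. C * \<bar>a i\<bar> ^ 3)"
      unfolding \<phi>_def by (intro sum_mono C)
    also have "\<dots> = C * (\<Sum>i\<in>window n. \<bar>a i\<bar> ^ 3)" by (simp add: sum_distrib_left)
    also have "\<dots> \<le> C * (\<bar>s\<bar> ^ 3 / sqrt (real d))" by (intro mult_left_mono cube C)
    finally show ?thesis unfolding 1 2 .
  qed
  have lim: "(\<lambda>n. \<integral>\<eta>. iexp (s * partial_stat ?v n \<eta>) \<partial>noise_law d) \<longlonglongrightarrow>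
      (\<integral>\<eta>. iexp (s * shifted_stat ?v \<eta>) \<partial>noise_law d)"
  proof (rule integral_dominated_convergence[where w = "\<lambda>_. 1"])
    note [measurable] = measurable_shifted_stat measurable_partial_stat
    show "(\<lambda>\<eta>. iexp (s * shifted_stat ?v \<eta>)) \<in> borel_measurable (noise_law d)" by measurable
    show "(\<lambda>\<eta>. iexp (s * partial_stat ?v n \<eta>)) \<in> borel_measurable (noise_law d)" for n by measurable
    show "AE \<eta> in noise_law d. (\<lambda>n. iexp (s * partial_stat ?v n \<eta>)) \<longlonglongrightarrow> iexp (s * shifted_stat ?v \<eta>)"
      using AE_partial_stat_tendsto[of ?v]
      by (auto elim!: eventually_mono intro!: tendsto_intros)
  qed auto
  have "(\<lambda>n. \<Sum>k\<in>int_decode ` {..<n}. (w k)\<^sup>2) \<longlonglongrightarrow> 1/2"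
    using infsum_int_tendsto[OF w_sq_summable] w_sq_sum by simp
  then have "(\<lambda>n. complex_of_real (exp (- (s\<^sup>2 * (\<Sum>k\<in>int_decode ` {..<n}. (w k)\<^sup>2))))) \<longlonglongrightarrow>
      complex_of_real (exp (- (s\<^sup>2 * (1/2))))"
    by (intro tendsto_intros)
  then have "(\<lambda>n. cmod ((\<integral>\<eta>. iexp (s * partial_stat ?v n \<eta>) \<partial>noise_law d)
      - complex_of_real (exp (- (s\<^sup>2 * (\<Sum>k\<in>int_decode ` {..<n}. (w k)\<^sup>2)))))) \<longlonglongrightarrow>
      cmod ((\<integral>\<eta>. iexp (s * shifted_stat ?v \<eta>) \<partial>noise_law d) - complex_of_real (exp (- (s\<^sup>2 * (1/2)))))"
    by (intro tendsto_norm tendsto_diff lim)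
  then have "cmod ((\<integral>\<eta>. iexp (s * shifted_stat ?v \<eta>) \<partial>noise_law d) - complex_of_real (exp (- (s\<^sup>2 * (1/2)))))
      \<le> C * (\<bar>s\<bar> ^ 3 / sqrt (real d))"
    by (rule LIMSEQ_le_const2) (use bound in auto)
  moreover have "char (distr (noise_law d) borel (shifted_stat ?v)) s = (\<integral>\<eta>. iexp (s * shifted_stat ?v \<eta>) \<partial>noise_law d)"
    unfolding char_def by (subst integral_distr) (auto intro: measurable_shifted_stat)
  ultimately show ?thesis by simp
qed

text \<open>Markov's inequality for \<open>exp (- shifted_stat v \<eta>)\<close>. The summand 1/2
  bounds the sum of the quadratic terms \<open>(s i)\<^sup>2\<close>; the divisor 3 bounds
  \<open>1 + 2 * s i\<close>, since \<open>s i \<le> 1\<close>.\<close>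

lemma prob_shifted_stat_le:
  assumes v: "\<And>j. j \<in> {1..d} \<Longrightarrow> (\<lambda>k. (v j k)\<^sup>2) summable_on UNIV"
  shows "measure (noise_law d) {\<eta> \<in> space (noise_law d). shifted_stat v \<eta> \<le> T}
    \<le> exp (T + 1/2 - 1 / sqrt (real d) * (\<Sum>j=1..d. \<Sum>\<^sub>\<infinity>k. w k * (v j k)\<^sup>2) / 3)"
proof -
  let ?N = std_normal_distribution
  interpret P: prob_space "noise_law d" by (rule prob_space_noise_law)
  note [measurable] = measurable_shifted_stat measurable_partial_stat
  define s where "s i = w (snd i) / sqrt (real d)" for i :: "nat \<times> int"
  define m where "m n = (\<Sum>(j, k)\<in>window n. w k / sqrt (real d) * (v j k)\<^sup>2)" for n
  define m' where "m' = 1 / sqrt (real d) * (\<Sum>j=1..d. \<Sum>\<^sub>\<infinity>k. w k * (v j k)\<^sup>2)"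
  have d0: "sqrt (real d) \<ge> 1" using d_pos by simp
  have s0: "s i \<ge> 0" for i using w_nonneg d0 by (simp add: s_def)
  have s1: "s i \<le> 1" for i
    using w_le_1[of "snd i"] d0 w_nonneg[of "snd i"] unfolding s_def
    by (intro divide_le_eq_1_pos[THEN iffD2]) linarith+
  have sq: "(\<Sum>i\<in>window n. (s i)\<^sup>2) \<le> 1/2" for n
  proof -
    have "(\<Sum>i\<in>window n. (s i)\<^sup>2) = (\<Sum>(j, k)\<in>window n. (w k)\<^sup>2 / real d)"
      by (intro sum.cong) (auto simp: s_def power_divide)
    also have "\<dots> = (\<Sum>k\<in>int_decode ` {..<n}. (w k)\<^sup>2)"
      using d_pos by (simp add: sum_window sum_distrib_left)
    finally show ?thesis using sum_w_sq_le by simp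
  qed
  have bd: "(\<integral>\<^sup>+\<eta>. ennreal (exp (- partial_stat v n \<eta>)) \<partial>noise_law d) \<le> ennreal (exp (1/2 - m n / 3))" for n
  proof -
    have "(\<integral>\<^sup>+\<eta>. ennreal (exp (- partial_stat v n \<eta>)) \<partial>noise_law d) =
        (\<integral>\<^sup>+\<eta>. (\<Prod>i\<in>window n. ennreal (exp (- s i * ((v (fst i) (snd i) + \<eta> i)\<^sup>2 - 1)))) \<partial>noise_law d)"
    proof (rule nn_integral_cong)
      fix \<eta>
      have "- partial_stat v n \<eta> = (\<Sum>i\<in>window n. - s i * ((v (fst i) (snd i) + \<eta> i)\<^sup>2 - 1))"
        unfolding partial_stat_def sum_negf[symmetric]
        by (intro sum.cong) (auto simp: s_def)
      then show "ennreal (exp (- partial_stat v n \<eta>)) =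
          (\<Prod>i\<in>window n. ennreal (exp (- s i * ((v (fst i) (snd i) + \<eta> i)\<^sup>2 - 1))))"
        by (simp only: exp_sum[OF finite_window] prod_ennreal exp_ge_zero)
    qed
    also have "\<dots> = (\<Prod>i\<in>window n. \<integral>\<^sup>+x. ennreal (exp (- s i * ((v (fst i) (snd i) + x)\<^sup>2 - 1))) \<partial>?N)"
      unfolding noise_law_def
      by (rule nn_integral_PiM_prod[OF prob_space_std_normal finite_window window_subset]) simp
    also have "\<dots> \<le> (\<Prod>i\<in>window n. ennreal (exp ((s i)\<^sup>2 - s i * (v (fst i) (snd i))\<^sup>2 / (1 + 2 * s i))))"
      by (intro prod_mono_ennreal std_normal_laplace_square s0)
    also have "\<dots> \<le> (\<Prod>i\<in>window n. ennreal (exp ((s i)\<^sup>2 - s i * (v (fst i) (snd i))\<^sup>2 / 3)))"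
    proof (intro prod_mono_ennreal ennreal_leI)
      fix i
      have "s i * (v (fst i) (snd i))\<^sup>2 / 3 \<le> s i * (v (fst i) (snd i))\<^sup>2 / (1 + 2 * s i)"
        using s0[of i] s1[of i] by (intro divide_left_mono) auto
      then show "exp ((s i)\<^sup>2 - s i * (v (fst i) (snd i))\<^sup>2 / (1 + 2 * s i)) \<le>
         exp ((s i)\<^sup>2 - s i * (v (fst i) (snd i))\<^sup>2 / 3)" by simp
    qed
    also have "\<dots> = ennreal (exp (\<Sum>i\<in>window n. (s i)\<^sup>2 - s i * (v (fst i) (snd i))\<^sup>2 / 3))"
      by (simp add: prod_ennreal exp_sum[OF finite_window])
    also have "(\<Sum>i\<in>window n. (s i)\<^sup>2 - s i * (v (fst i) (snd i))\<^sup>2 / 3) = (\<Sum>i\<in>window n. (s i)\<^sup>2) - m n / 3"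
      by (simp add: sum_subtractf m_def s_def split_beta sum_divide_distrib)
    also have "ennreal (exp ((\<Sum>i\<in>window n. (s i)\<^sup>2) - m n / 3)) \<le> ennreal (exp (1/2 - m n / 3))"
      using sq[of n] by (intro ennreal_leI) simp
    finally show ?thesis .
  qed
  have wv: "(\<lambda>k. w k * (v j k)\<^sup>2) summable_on UNIV" if "j \<in> {1..d}" for j
  proof (rule summable_on_comparison_test[OF v[OF that]])
    show "w k * (v j k)\<^sup>2 \<le> (v j k)\<^sup>2" for k
      using mult_right_mono[OF w_le_1 zero_le_power2[of "v j k"], of k] by simp
  qed (use w_nonneg in auto)
  have "(\<lambda>n. 1 / sqrt (real d) * (\<Sum>j=1..d. \<Sum>k\<in>int_decode ` {..<n}. w k * (v j k)\<^sup>2)) \<longlonglongrightarrow> m'"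
    unfolding m'_def by (intro tendsto_mult_left tendsto_sum infsum_int_tendsto wv)
  then have "m \<longlonglongrightarrow> m'"
    by (simp add: m_def [abs_def] sum_window sum_distrib_left)
  then have lim: "(\<lambda>n. ennreal (exp (1/2 - m n / 3))) \<longlonglongrightarrow> ennreal (exp (1/2 - m' / 3))"
    by (intro tendsto_intros) simp_all
  have conv: "AE \<eta> in noise_law d. (\<lambda>n. partial_stat v n \<eta>) \<longlonglongrightarrow> shifted_stat v \<eta>"
    by (rule AE_partial_stat_tendsto) (rule v)
  \<comment> \<open>Only an upper bound is wanted, so Fatou's lemma suffices and no common
    integrable majorant of the exponentials has to be found.\<close>
  have "(\<integral>\<^sup>+\<eta>. ennreal (exp (- shifted_stat v \<eta>)) \<partial>noise_law d) =
      (\<integral>\<^sup>+\<eta>. liminf (\<lambda>n. ennreal (exp (- partial_stat v n \<eta>))) \<partial>noise_law d)"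
  proof (rule nn_integral_cong_AE)
    show "AE \<eta> in noise_law d. ennreal (exp (- shifted_stat v \<eta>)) =
        liminf (\<lambda>n. ennreal (exp (- partial_stat v n \<eta>)))"
      using conv
    proof eventually_elim
      case (elim \<eta>)
      then have "(\<lambda>n. ennreal (exp (- partial_stat v n \<eta>))) \<longlonglongrightarrow> ennreal (exp (- shifted_stat v \<eta>))"
        by (intro tendsto_intros) simp_all
      then show ?case by (intro lim_imp_Liminf[symmetric]) auto
    qed
  qed
  also have "\<dots> \<le> liminf (\<lambda>n. \<integral>\<^sup>+\<eta>. ennreal (exp (- partial_stat v n \<eta>)) \<partial>noise_law d)"
    by (rule nn_integral_liminf) measurable
  also have "\<dots> \<le> liminf (\<lambda>n. ennreal (exp (1/2 - m n / 3)))"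
    by (intro Liminf_mono always_eventually allI bd)
  also have "\<dots> = ennreal (exp (1/2 - m' / 3))"
    using lim by (intro lim_imp_Liminf) auto
  finally have E: "(\<integral>\<^sup>+\<eta>. ennreal (exp (- shifted_stat v \<eta>)) \<partial>noise_law d) \<le> ennreal (exp (1/2 - m' / 3))" .
  have "emeasure (noise_law d) {\<eta> \<in> space (noise_law d). shifted_stat v \<eta> \<le> T} =
      (\<integral>\<^sup>+\<eta>. indicator {\<eta> \<in> space (noise_law d). shifted_stat v \<eta> \<le> T} \<eta> \<partial>noise_law d)"
    by simp
  also have "\<dots> \<le> (\<integral>\<^sup>+\<eta>. ennreal (exp T) * ennreal (exp (- shifted_stat v \<eta>)) \<partial>noise_law d)"
  proof (rule nn_integral_mono)
    fix \<eta>
    show "indicator {\<eta> \<in> space (noise_law d). shifted_stat v \<eta> \<le> T} \<eta> \<le> ennreal (exp T) * ennreal (exp (- shifted_stat v \<eta>))"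
      by (auto simp: indicator_def simp flip: ennreal_mult' exp_add)
  qed
  also have "\<dots> = ennreal (exp T) * (\<integral>\<^sup>+\<eta>. ennreal (exp (- shifted_stat v \<eta>)) \<partial>noise_law d)"
    by (rule nn_integral_cmult) measurable
  also have "\<dots> \<le> ennreal (exp T) * ennreal (exp (1/2 - m' / 3))"
    by (intro mult_left_mono E) simp
  also have "\<dots> = ennreal (exp (T + 1/2 - m' / 3))"
    by (simp flip: ennreal_mult' exp_add)
  finally show ?thesis
    unfolding m'_def by (simp add: P.emeasure_eq_measure)
qed

end

section \<open>The extremal problem\<close>

lemma summable_on_power4:
  assumes "(\<lambda>k. (\<theta> k)\<^sup>2) summable_on (UNIV :: int set)"
  shows "(\<lambda>k. (\<theta> k :: real) ^ 4) summable_on UNIV"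
proof (rule summable_on_comparison_test)
  let ?S = "\<Sum>\<^sub>\<infinity>k. (\<theta> k)\<^sup>2"
  show "(\<lambda>k. ?S * (\<theta> k)\<^sup>2) summable_on UNIV" by (intro summable_on_cmult_right assms)
  fix k
  have "(\<theta> k)\<^sup>2 \<le> ?S" using finite_sum_le_infsum[OF assms, of "{k}"] by simp
  then have "(\<theta> k)\<^sup>2 * (\<theta> k)\<^sup>2 \<le> ?S * (\<theta> k)\<^sup>2" by (intro mult_right_mono) auto
  then show "\<theta> k ^ 4 \<le> ?S * (\<theta> k)\<^sup>2" by (simp add: power4_eq_xxxx power2_eq_square mult.assoc)
qed simp

lemma sobolev_classD:
  assumes "\<theta> \<in> sobolev_class \<tau> r"
  shows "(\<lambda>k. (\<theta> k)\<^sup>2) summable_on UNIV"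
    "(\<lambda>k. \<bar>real_of_int k\<bar> powr (2 * \<tau>) * (\<theta> k)\<^sup>2) summable_on UNIV"
    "(2 * pi) powr (2 * \<tau>) * (\<Sum>\<^sub>\<infinity>k. \<bar>real_of_int k\<bar> powr (2 * \<tau>) * (\<theta> k)\<^sup>2) \<le> 1"
    "r\<^sup>2 \<le> (\<Sum>\<^sub>\<infinity>k. (\<theta> k)\<^sup>2)"
    "(\<lambda>k. (\<theta> k) ^ 4) summable_on UNIV"
  using assms summable_on_power4[of \<theta>] by (auto simp: sobolev_class_def ell2_def)

text \<open>Tailored to sequences built from a member of the class by a change that does not raise
  the weighted energy; the radius may change.\<close>

lemma sobolev_classI:
  assumes "\<theta> \<in> sobolev_class \<tau> r"
    and "(\<lambda>k. (\<theta>' k)\<^sup>2) summable_on UNIV"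
    and "(\<lambda>k. \<bar>real_of_int k\<bar> powr (2 * \<tau>) * (\<theta>' k)\<^sup>2) summable_on UNIV"
    and "(\<Sum>\<^sub>\<infinity>k. \<bar>real_of_int k\<bar> powr (2 * \<tau>) * (\<theta>' k)\<^sup>2) \<le>
      (\<Sum>\<^sub>\<infinity>k. \<bar>real_of_int k\<bar> powr (2 * \<tau>) * (\<theta> k)\<^sup>2)"
    and "r'\<^sup>2 \<le> (\<Sum>\<^sub>\<infinity>k. (\<theta>' k)\<^sup>2)"
  shows "\<theta>' \<in> sobolev_class \<tau> r'"
proof -
  have "(2 * pi) powr (2 * \<tau>) * (\<Sum>\<^sub>\<infinity>k. \<bar>real_of_int k\<bar> powr (2 * \<tau>) * (\<theta>' k)\<^sup>2) \<le> 1"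
    by (rule order_trans[OF mult_left_mono[OF assms(4)] sobolev_classD(3)[OF assms(1)]]) simp
  then show ?thesis using assms by (auto simp: sobolev_class_def ell2_def)
qed

lemma summable_on_finite_support:
  fixes f :: "int \<Rightarrow> real"
  assumes "finite A" "\<And>k. k \<notin> A \<Longrightarrow> f k = 0"
  shows "f summable_on UNIV" "infsum f UNIV = sum f A"
proof -
  have "(f has_sum sum f A) UNIV" using assms by (intro has_sum_finite_neutralI) auto
  then show "f summable_on UNIV" "infsum f UNIV = sum f A" by (auto simp: summable_on_def infsumI)
qed

text \<open>The frequency \<open>k = 0\<close> carries no Sobolev weight, so the class is never empty.\<close>

lemma sobolev_class_nonempty: "\<exists>\<theta>. \<theta> \<in> sobolev_class \<tau> r"
proof
  define \<theta> where "\<theta> k = (if k = 0 then r else 0)" for k :: int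
  have 0: "(\<lambda>k. \<bar>real_of_int k\<bar> powr (2 * \<tau>) * (\<theta> k)\<^sup>2) = (\<lambda>_. 0)"
    by (auto simp: \<theta>_def)
  have "(\<lambda>k. (\<theta> k)\<^sup>2) summable_on UNIV" "(\<Sum>\<^sub>\<infinity>k. (\<theta> k)\<^sup>2) = r\<^sup>2"
    using summable_on_finite_support[of "{0}" "\<lambda>k. (\<theta> k)\<^sup>2"] by (auto simp: \<theta>_def)
  then show "\<theta> \<in> sobolev_class \<tau> r"
    unfolding sobolev_class_def ell2_def mem_Collect_eq 0 by simp
qed

lemma bdd_below_power4: "bdd_below ((\<lambda>\<theta>. \<Sum>\<^sub>\<infinity>k. (\<theta> k :: real) ^ 4) ` A)"
  by (rule bdd_belowI2[where m = 0]) (auto intro!: infsum_nonneg)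

lemma extremal_inf_le: "\<theta> \<in> sobolev_class \<tau> r \<Longrightarrow> extremal_inf \<tau> r \<le> (\<Sum>\<^sub>\<infinity>k. (\<theta> k) ^ 4)"
  unfolding extremal_inf_def by (rule cINF_lower[OF bdd_below_power4])

lemma extremal_inf_nonneg: "extremal_inf \<tau> r \<ge> 0"
  unfolding extremal_inf_def
  by (rule cINF_greatest) (use sobolev_class_nonempty in \<open>auto intro!: infsum_nonneg\<close>)

lemma extremal_inf_approx:
  assumes "\<delta> > 0" obtains \<theta> where "\<theta> \<in> sobolev_class \<tau> r" "(\<Sum>\<^sub>\<infinity>k. (\<theta> k) ^ 4) < extremal_inf \<tau> r + \<delta>"
proof -
  have "(INF \<theta>\<in>sobolev_class \<tau> r. \<Sum>\<^sub>\<infinity>k. (\<theta> k) ^ 4) < extremal_inf \<tau> r + \<delta>"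
    using assms by (simp add: extremal_inf_def)
  then show thesis
    using that sobolev_class_nonempty by (subst (asm) cINF_less_iff[OF _ bdd_below_power4]) auto
qed

lemma extremal_inf_mono:
  assumes "0 \<le> r" "r \<le> r'" shows "extremal_inf \<tau> r \<le> extremal_inf \<tau> r'"
  unfolding extremal_inf_def[of \<tau> r']
proof (rule cINF_greatest)
  show "sobolev_class \<tau> r' \<noteq> {}" using sobolev_class_nonempty by auto
  fix \<theta> assume \<theta>: "\<theta> \<in> sobolev_class \<tau> r'"
  have "r\<^sup>2 \<le> r'\<^sup>2" using assms by (intro power_mono)
  then have "\<theta> \<in> sobolev_class \<tau> r"
    using sobolev_classD[OF \<theta>] by (intro sobolev_classI[OF \<theta>]) auto
  then show "extremal_inf \<tau> r \<le> (\<Sum>\<^sub>\<infinity>k. (\<theta> k) ^ 4)" by (rule extremal_inf_le)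
qed

text \<open>The class is convex in \<open>\<theta>\<^sup>2\<close>; this is the first-order condition at a minimizer.\<close>

lemma minimizing_cross_ge:
  assumes min: "is_minimizing \<tau> r \<theta>'" and \<theta>: "\<theta> \<in> sobolev_class \<tau> r"
  shows "(\<lambda>k. (\<theta>' k)\<^sup>2 * (\<theta> k)\<^sup>2) summable_on UNIV"
    and "extremal_inf \<tau> r \<le> (\<Sum>\<^sub>\<infinity>k. (\<theta>' k)\<^sup>2 * (\<theta> k)\<^sup>2)"
proof -
  have \<theta>': "\<theta>' \<in> sobolev_class \<tau> r" and eq: "(\<Sum>\<^sub>\<infinity>k. (\<theta>' k) ^ 4) = extremal_inf \<tau> r"
    using min by (auto simp: is_minimizing_def)
  note D = sobolev_classD[OF \<theta>] and D' = sobolev_classD[OF \<theta>']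
  show cr: "(\<lambda>k. (\<theta>' k)\<^sup>2 * (\<theta> k)\<^sup>2) summable_on UNIV"
  proof (rule summable_on_comparison_test[OF summable_on_add[OF D(5) D'(5)]])
    fix k
    have "0 \<le> ((\<theta>' k)\<^sup>2 - (\<theta> k)\<^sup>2)\<^sup>2" by simp
    moreover have "((\<theta>' k)\<^sup>2)\<^sup>2 = \<theta>' k ^ 4" "((\<theta> k)\<^sup>2)\<^sup>2 = \<theta> k ^ 4" by simp_all
    ultimately have "2 * ((\<theta>' k)\<^sup>2 * (\<theta> k)\<^sup>2) \<le> \<theta> k ^ 4 + \<theta>' k ^ 4"
      by (simp add: power2_diff)
    then show "(\<theta>' k)\<^sup>2 * (\<theta> k)\<^sup>2 \<le> \<theta> k ^ 4 + \<theta>' k ^ 4"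
      using mult_nonneg_nonneg[OF zero_le_power2[of "\<theta>' k"] zero_le_power2[of "\<theta> k"]] by linarith
  qed simp
  define A B C where "A = (\<Sum>\<^sub>\<infinity>k. (\<theta>' k) ^ 4)" and "B = (\<Sum>\<^sub>\<infinity>k. (\<theta> k) ^ 4)"
    and "C = (\<Sum>\<^sub>\<infinity>k. (\<theta>' k)\<^sup>2 * (\<theta> k)\<^sup>2)"
  \<comment> \<open>Along the segment from \<open>\<theta>'\<close> to \<open>\<theta>\<close> in
    squared coordinates the objective is a quadratic polynomial in \<open>t\<close> with value
    \<open>A\<close> at \<open>t = 0\<close>, and minimality keeps it above
    \<open>A\<close>.\<close>
  have key: "A \<le> (1 - t)\<^sup>2 * A + 2 * t * (1 - t) * C + t\<^sup>2 * B" if t: "0 \<le> t" "t \<le> 1" for t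
  proof -
    define \<eta> where "\<eta> k = sqrt ((1 - t) * (\<theta>' k)\<^sup>2 + t * (\<theta> k)\<^sup>2)" for k
    have \<eta>2: "(\<eta> k)\<^sup>2 = (1 - t) * (\<theta>' k)\<^sup>2 + t * (\<theta> k)\<^sup>2" for k
      using t by (simp add: \<eta>_def)
    have w: "\<bar>real_of_int k\<bar> powr (2 * \<tau>) * (\<eta> k)\<^sup>2 = (1 - t) * (\<bar>real_of_int k\<bar> powr (2 * \<tau>) * (\<theta>' k)\<^sup>2)
        + t * (\<bar>real_of_int k\<bar> powr (2 * \<tau>) * (\<theta> k)\<^sup>2)" for k
      by (simp add: \<eta>2 algebra_simps)
    have "\<eta> \<in> sobolev_class \<tau> r"
    proof -
      have s1: "(\<lambda>k. (\<eta> k)\<^sup>2) summable_on UNIV"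
        unfolding \<eta>2 by (intro summable_on_add summable_on_cmult_right D D')
      have s2: "(\<lambda>k. \<bar>real_of_int k\<bar> powr (2 * \<tau>) * (\<eta> k)\<^sup>2) summable_on UNIV"
        unfolding w by (intro summable_on_add summable_on_cmult_right D D')
      have "(2 * pi) powr (2 * \<tau>) * (\<Sum>\<^sub>\<infinity>k. \<bar>real_of_int k\<bar> powr (2 * \<tau>) * (\<eta> k)\<^sup>2) =
          (1 - t) * ((2 * pi) powr (2 * \<tau>) * (\<Sum>\<^sub>\<infinity>k. \<bar>real_of_int k\<bar> powr (2 * \<tau>) * (\<theta>' k)\<^sup>2))
          + t * ((2 * pi) powr (2 * \<tau>) * (\<Sum>\<^sub>\<infinity>k. \<bar>real_of_int k\<bar> powr (2 * \<tau>) * (\<theta> k)\<^sup>2))"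
        unfolding w by (subst infsum_add)
          (auto intro!: summable_on_cmult_right D D' simp: infsum_cmult_right' distrib_left)
      also have "\<dots> \<le> (1 - t) * 1 + t * 1"
        using t by (intro add_mono mult_left_mono D D') auto
      finally have s3: "(2 * pi) powr (2 * \<tau>) * (\<Sum>\<^sub>\<infinity>k. \<bar>real_of_int k\<bar> powr (2 * \<tau>) * (\<eta> k)\<^sup>2) \<le> 1" by simp
      have "r\<^sup>2 = (1 - t) * r\<^sup>2 + t * r\<^sup>2" by (simp add: algebra_simps)
      also have "\<dots> \<le> (1 - t) * (\<Sum>\<^sub>\<infinity>k. (\<theta>' k)\<^sup>2) + t * (\<Sum>\<^sub>\<infinity>k. (\<theta> k)\<^sup>2)"
        using t by (intro add_mono mult_left_mono D D') auto
      also have "\<dots> = (\<Sum>\<^sub>\<infinity>k. (\<eta> k)\<^sup>2)"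
        unfolding \<eta>2 by (subst infsum_add) (auto intro!: summable_on_cmult_right D D' simp: infsum_cmult_right')
      finally show ?thesis using s1 s2 s3 by (auto simp: sobolev_class_def ell2_def)
    qed
    then have "A \<le> (\<Sum>\<^sub>\<infinity>k. (\<eta> k) ^ 4)" unfolding A_def eq by (rule extremal_inf_le)
    also have "\<dots> = (\<Sum>\<^sub>\<infinity>k. ((1 - t)\<^sup>2 * (\<theta>' k) ^ 4 + 2 * t * (1 - t) * ((\<theta>' k)\<^sup>2 * (\<theta> k)\<^sup>2)) + t\<^sup>2 * (\<theta> k) ^ 4)"
    proof (rule infsum_cong)
      fix k
      have "\<eta> k ^ 4 = ((\<eta> k)\<^sup>2)\<^sup>2" by simp
      then show "\<eta> k ^ 4 = ((1 - t)\<^sup>2 * (\<theta>' k) ^ 4 + 2 * t * (1 - t) * ((\<theta>' k)\<^sup>2 * (\<theta> k)\<^sup>2)) + t\<^sup>2 * (\<theta> k) ^ 4"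
        unfolding \<eta>2 by (simp add: power2_sum power_mult_distrib)
    qed
    also have "\<dots> = (1 - t)\<^sup>2 * A + 2 * t * (1 - t) * C + t\<^sup>2 * B"
      unfolding A_def B_def C_def
      by (subst infsum_add, (auto intro!: summable_on_add summable_on_cmult_right D D' cr simp: infsum_cmult_right')[2])
         (subst infsum_add, auto intro!: summable_on_cmult_right D D' cr simp: infsum_cmult_right')
    finally show ?thesis .
  qed
  have "A \<le> C"
  proof (rule ccontr)
    assume "\<not> A \<le> C"
    then have pos: "A - C > 0" by simp
    \<comment> \<open>If \<open>C < A\<close>, the polynomial has slope
      \<open>2 * (C - A) < 0\<close> at 0. \<open>E\<close> dominates the second-order coefficient,
      and \<open>t\<close> is so small that the second-order term recovers at most half of what the
      linear term loses.\<close>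
    define E where "E = \<bar>A - 2 * C + B\<bar> + 1"
    define t where "t = min 1 ((A - C) / E)"
    have E: "E > 0" by (simp add: E_def)
    have t: "0 < t" "t \<le> 1" using pos E by (auto simp: t_def)
    have "t * (A - 2 * C + B) \<le> t * E" using t by (intro mult_left_mono) (auto simp: E_def)
    also have "\<dots> \<le> (A - C) / E * E" using E by (intro mult_right_mono) (auto simp: t_def)
    also have "\<dots> = A - C" using E by simp
    also have "\<dots> < 2 * (A - C)" using pos by simp
    finally have "2 * (C - A) + t * (A - 2 * C + B) < 0" by simp
    then have "t * (2 * (C - A) + t * (A - 2 * C + B)) < 0" using t by (simp add: mult_pos_neg)
    then show False using key[of t] t by (simp add: power2_eq_square algebra_simps)
  qed
  then show "extremal_inf \<tau> r \<le> (\<Sum>\<^sub>\<infinity>k. (\<theta>' k)\<^sup>2 * (\<theta> k)\<^sup>2)"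
    by (simp add: A_def C_def eq)
qed

text \<open>Shrinking \<open>\<theta>\<close> by \<open>r' / r\<close> lowers its weighted energy
  and brings it to radius \<open>r'\<close>, where the first-order condition applies; undoing this
  in the squares gives the factor \<open>(r / r')\<^sup>2\<close>. That factor is what drives the
  mean of the statistic to infinity.\<close>

lemma minimizing_cross_ge_scaled:
  assumes min: "is_minimizing \<tau> r' \<theta>'" and \<theta>: "\<theta> \<in> sobolev_class \<tau> r" and r: "0 < r'" "r' \<le> r"
  shows "(r / r')\<^sup>2 * extremal_inf \<tau> r' \<le> (\<Sum>\<^sub>\<infinity>k. (\<theta>' k)\<^sup>2 * (\<theta> k)\<^sup>2)"
proof -
  note D = sobolev_classD[OF \<theta>]
  define c where "c = (r' / r)\<^sup>2"
  have c: "0 < c" "c \<le> 1" using r by (auto simp: c_def power_le_one)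
  define \<eta> where "\<eta> k = (r' / r) * \<theta> k" for k
  have \<eta>2: "(\<eta> k)\<^sup>2 = c * (\<theta> k)\<^sup>2" for k by (simp add: \<eta>_def c_def power_mult_distrib power_divide)
  have w: "\<bar>real_of_int k\<bar> powr (2 * \<tau>) * (\<eta> k)\<^sup>2 = c * (\<bar>real_of_int k\<bar> powr (2 * \<tau>) * (\<theta> k)\<^sup>2)" for k
    by (simp add: \<eta>2)
  have "\<eta> \<in> sobolev_class \<tau> r'"
  proof (rule sobolev_classI[OF \<theta>])
    show "(\<lambda>k. (\<eta> k)\<^sup>2) summable_on UNIV"
      unfolding \<eta>2 by (intro summable_on_cmult_right D)
    show "(\<lambda>k. \<bar>real_of_int k\<bar> powr (2 * \<tau>) * (\<eta> k)\<^sup>2) summable_on UNIV"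
      unfolding w by (intro summable_on_cmult_right D)
    have "(\<Sum>\<^sub>\<infinity>k. \<bar>real_of_int k\<bar> powr (2 * \<tau>) * (\<theta> k)\<^sup>2) \<ge> 0" by (intro infsum_nonneg) auto
    from mult_right_mono[OF c(2) this]
    show "(\<Sum>\<^sub>\<infinity>k. \<bar>real_of_int k\<bar> powr (2 * \<tau>) * (\<eta> k)\<^sup>2) \<le> (\<Sum>\<^sub>\<infinity>k. \<bar>real_of_int k\<bar> powr (2 * \<tau>) * (\<theta> k)\<^sup>2)"
      unfolding w infsum_cmult_right' by simp
    have "r'\<^sup>2 = c * r\<^sup>2" using r by (simp add: c_def power_divide)
    then show "r'\<^sup>2 \<le> (\<Sum>\<^sub>\<infinity>k. (\<eta> k)\<^sup>2)"
      unfolding \<eta>2 infsum_cmult_right' using c D(4) by simp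
  qed
  from minimizing_cross_ge(2)[OF min this]
  have "extremal_inf \<tau> r' \<le> (\<Sum>\<^sub>\<infinity>k. c * ((\<theta>' k)\<^sup>2 * (\<theta> k)\<^sup>2))"
    by (simp add: \<eta>2 mult.left_commute)
  also have "\<dots> = c * (\<Sum>\<^sub>\<infinity>k. (\<theta>' k)\<^sup>2 * (\<theta> k)\<^sup>2)" by (rule infsum_cmult_right')
  finally have "extremal_inf \<tau> r' / c \<le> (\<Sum>\<^sub>\<infinity>k. (\<theta>' k)\<^sup>2 * (\<theta> k)\<^sup>2)"
    using c by (simp add: divide_le_eq mult.commute)
  then show ?thesis using r by (simp add: c_def power_divide mult.commute)
qed

text \<open>Fubini over the graph of \<open>q\<close>, in which \<open>l\<close> corresponds to the
  pair \<open>(q l, l)\<close>.\<close>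

lemma infsum_fibres:
  fixes g :: "int \<Rightarrow> real" and q :: "int \<Rightarrow> int"
  assumes g: "g summable_on UNIV" and fin: "\<And>k. finite (q -` {k})"
  shows "(\<lambda>k. \<Sum>l\<in>q -` {k}. g l) summable_on UNIV"
    and "(\<Sum>\<^sub>\<infinity>k. \<Sum>l\<in>q -` {k}. g l) = infsum g UNIV"
proof -
  have bij: "bij_betw (\<lambda>l. (q l, l)) UNIV (Sigma UNIV (\<lambda>k. q -` {k}))"
    by (auto simp: bij_betw_def inj_on_def)
  have s: "(\<lambda>(k, l). g l) summable_on Sigma UNIV (\<lambda>k. q -` {k})"
    using summable_on_reindex_bij_betw[OF bij, of "\<lambda>(k, l). g l"] g by simp
  show "(\<lambda>k. \<Sum>l\<in>q -` {k}. g l) summable_on UNIV"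
    using summable_on_Sigma_banach[OF s] fin by simp
  show "(\<Sum>\<^sub>\<infinity>k. \<Sum>l\<in>q -` {k}. g l) = infsum g UNIV"
    using infsum_Sigma'_banach[OF s] infsum_reindex_bij_betw[OF bij, of "\<lambda>(k, l). g l"] fin by simp
qed

text \<open>Pooling the energy of blocks of \<open>m\<close> frequencies and rescaling it by \<open>m\<^sup>2\<^sup>\<tau>\<close> respects the
  smoothness constraint, since the frequencies shrink by the factor \<open>m\<close>.\<close>

lemma extremal_inf_dilation:
  fixes m :: nat
  assumes \<tau>: "\<tau> > 0" and m: "m \<ge> 1" and r: "r \<ge> 0"
  shows "extremal_inf \<tau> (real m powr \<tau> * r) \<le> 2 * real m * real m powr (4 * \<tau>) * extremal_inf \<tau> r"
proof (rule field_le_epsilon)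
  fix e :: real assume e: "e > 0"
  define Cm where "Cm = 2 * real m * real m powr (4 * \<tau>)"
  have Cm: "Cm > 0" using m by (simp add: Cm_def)
  obtain \<theta> where \<theta>: "\<theta> \<in> sobolev_class \<tau> r" and lt: "(\<Sum>\<^sub>\<infinity>k. (\<theta> k) ^ 4) < extremal_inf \<tau> r + e / Cm"
    using extremal_inf_approx[of "e / Cm"] e Cm by auto
  note D = sobolev_classD[OF \<theta>]
  \<comment> \<open>Rounding is towards zero, so that
    \<open>m * \<bar>q l\<bar> \<le> \<bar>l\<bar>\<close> holds for negative frequencies as
    well.\<close>
  define q :: "int \<Rightarrow> int" where "q l = (if l \<ge> 0 then l div int m else - ((- l) div int m))" for l
  \<comment> \<open>Sign and residue of the modulus single out a frequency within its fibre. The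
    fibre over 0 has \<open>2 * m - 1\<close> elements, hence the count \<open>2 * m\<close> rather
    than \<open>m\<close>.\<close>
  define h where "h l = (l \<ge> 0, nat (\<bar>l\<bar> mod int m))" for l :: int
  have m0: "int m > 0" using m by simp
  have inj: "inj_on h (q -` {k})" for k
  proof (rule inj_onI)
    fix l l' assume a: "l \<in> q -` {k}" "l' \<in> q -` {k}" and b: "h l = h l'"
    have s: "(l \<ge> 0) = (l' \<ge> 0)" and md: "\<bar>l\<bar> mod int m = \<bar>l'\<bar> mod int m"
      using b m0 by (auto simp: h_def nat_eq_iff)
    have "\<bar>l\<bar> div int m = \<bar>l'\<bar> div int m" using a s by (auto simp: q_def split: if_splits)
    with md have "\<bar>l\<bar> = \<bar>l'\<bar>" by (metis mult_div_mod_eq)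
    with s show "l = l'" by auto
  qed
  have sub: "h ` A \<subseteq> UNIV \<times> {..<m}" for A
    using m0 by (auto simp: h_def nat_less_iff)
  have fin: "finite (q -` {k})" for k
    by (rule inj_on_finite[OF inj sub]) auto
  have card: "real (card (q -` {k})) \<le> 2 * real m" for k
  proof -
    have "card (q -` {k}) \<le> card (UNIV \<times> {..<m} :: (bool \<times> nat) set)"
      by (rule card_inj_on_le[OF inj sub]) auto
    then show ?thesis by (simp add: card_cartesian_product)
  qed
  have qle: "real m * \<bar>real_of_int (q l)\<bar> \<le> \<bar>real_of_int l\<bar>" for l
  proof -
    have "int m * (\<bar>l\<bar> div int m) \<le> \<bar>l\<bar>"
      using mult_div_mod_eq[of "int m" "\<bar>l\<bar>"] pos_mod_sign[OF m0, of "\<bar>l\<bar>"] by linarith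
    moreover have "\<bar>q l\<bar> = \<bar>l\<bar> div int m"
      using m0 by (auto simp: q_def pos_imp_zdiv_nonneg_iff)
    ultimately have "int m * \<bar>q l\<bar> \<le> \<bar>l\<bar>" by simp
    then show ?thesis using of_int_le_iff[of "int m * \<bar>q l\<bar>" "\<bar>l\<bar>", where 'a = real] by simp
  qed
  define c where "c = real m powr (2 * \<tau>)"
  have c: "c > 0" using m by (simp add: c_def)
  define \<eta> where "\<eta> k = sqrt (c * (\<Sum>l\<in>q -` {k}. (\<theta> l)\<^sup>2))" for k
  have \<eta>2: "(\<eta> k)\<^sup>2 = c * (\<Sum>l\<in>q -` {k}. (\<theta> l)\<^sup>2)" for k
    using c by (simp add: \<eta>_def sum_nonneg)
  note F2 = infsum_fibres[OF D(1), of q, OF fin] and FS = infsum_fibres[OF D(2), of q, OF fin]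
    and F4 = infsum_fibres[OF D(5), of q, OF fin]
  have wle: "\<bar>real_of_int k\<bar> powr (2 * \<tau>) * (\<eta> k)\<^sup>2 \<le>
      (\<Sum>l\<in>q -` {k}. \<bar>real_of_int l\<bar> powr (2 * \<tau>) * (\<theta> l)\<^sup>2)" for k
    unfolding \<eta>2 sum_distrib_left
  proof (rule sum_mono)
    fix l assume "l \<in> q -` {k}"
    then have k: "q l = k" by simp
    have "\<bar>real_of_int k\<bar> powr (2 * \<tau>) * c = (real m * \<bar>real_of_int k\<bar>) powr (2 * \<tau>)"
      by (simp add: c_def powr_mult mult.commute)
    also have "\<dots> \<le> \<bar>real_of_int l\<bar> powr (2 * \<tau>)"
      using qle[of l] \<tau> unfolding k by (intro powr_mono2) auto
    finally have "\<bar>real_of_int k\<bar> powr (2 * \<tau>) * c * (\<theta> l)\<^sup>2 \<le> \<bar>real_of_int l\<bar> powr (2 * \<tau>) * (\<theta> l)\<^sup>2"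
      by (intro mult_right_mono) auto
    then show "\<bar>real_of_int k\<bar> powr (2 * \<tau>) * (c * (\<theta> l)\<^sup>2) \<le> \<bar>real_of_int l\<bar> powr (2 * \<tau>) * (\<theta> l)\<^sup>2"
      by (simp add: mult.assoc)
  qed
  have ws: "(\<lambda>k. \<bar>real_of_int k\<bar> powr (2 * \<tau>) * (\<eta> k)\<^sup>2) summable_on UNIV"
    by (rule summable_on_comparison_test[OF FS(1) wle]) auto
  have cls: "\<eta> \<in> sobolev_class \<tau> (real m powr \<tau> * r)"
  proof (rule sobolev_classI[OF \<theta> _ ws])
    show "(\<lambda>k. (\<eta> k)\<^sup>2) summable_on UNIV"
      unfolding \<eta>2 by (intro summable_on_cmult_right F2)
    show "(\<Sum>\<^sub>\<infinity>k. \<bar>real_of_int k\<bar> powr (2 * \<tau>) * (\<eta> k)\<^sup>2) \<le> (\<Sum>\<^sub>\<infinity>k. \<bar>real_of_int k\<bar> powr (2 * \<tau>) * (\<theta> k)\<^sup>2)"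
      unfolding FS(2)[symmetric] by (rule infsum_mono[OF ws FS(1) wle])
    have "(real m powr \<tau> * r)\<^sup>2 = c * r\<^sup>2"
      using m by (simp add: c_def power_mult_distrib powr_power mult.commute)
    then show "(real m powr \<tau> * r)\<^sup>2 \<le> (\<Sum>\<^sub>\<infinity>k. (\<eta> k)\<^sup>2)"
      unfolding \<eta>2 infsum_cmult_right' F2(2) using c D(4) by simp
  qed
  have le4: "\<eta> k ^ 4 \<le> Cm * (\<Sum>l\<in>q -` {k}. \<theta> l ^ 4)" for k
  proof -
    have "\<eta> k ^ 4 = ((\<eta> k)\<^sup>2)\<^sup>2" by simp
    also have "\<dots> = c\<^sup>2 * (\<Sum>l\<in>q -` {k}. (\<theta> l)\<^sup>2)\<^sup>2" unfolding \<eta>2 by (simp add: power_mult_distrib)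
    \<comment> \<open>Cauchy-Schwarz on a fibre of at most \<open>2 * m\<close> frequencies; with
      \<open>c\<^sup>2 = real m powr (4 * \<tau>)\<close> this produces the constant
      \<open>Cm\<close>.\<close>
    also have "(\<Sum>l\<in>q -` {k}. (\<theta> l)\<^sup>2)\<^sup>2 \<le> (\<Sum>l\<in>q -` {k}. ((\<theta> l)\<^sup>2)\<^sup>2) * real (card (q -` {k}))"
      by (rule sum_squared_le_sum_of_squares)
    also have "\<dots> \<le> (\<Sum>l\<in>q -` {k}. ((\<theta> l)\<^sup>2)\<^sup>2) * (2 * real m)"
      by (intro mult_left_mono card sum_nonneg) auto
    also have "c\<^sup>2 * ((\<Sum>l\<in>q -` {k}. ((\<theta> l)\<^sup>2)\<^sup>2) * (2 * real m)) = Cm * (\<Sum>l\<in>q -` {k}. \<theta> l ^ 4)"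
      using m by (simp add: Cm_def c_def powr_power mult_ac)
    finally show ?thesis by (simp add: mult_left_mono)
  qed
  have "extremal_inf \<tau> (real m powr \<tau> * r) \<le> (\<Sum>\<^sub>\<infinity>k. \<eta> k ^ 4)" by (rule extremal_inf_le[OF cls])
  also have "\<dots> \<le> (\<Sum>\<^sub>\<infinity>k. Cm * (\<Sum>l\<in>q -` {k}. \<theta> l ^ 4))"
    by (intro infsum_mono le4 summable_on_cmult_right F4 sobolev_classD(5)[OF cls])
  also have "\<dots> = Cm * (\<Sum>\<^sub>\<infinity>k. \<theta> k ^ 4)" unfolding infsum_cmult_right' F4(2) ..
  also have "\<dots> \<le> Cm * (extremal_inf \<tau> r + e / Cm)" using lt Cm by (intro mult_left_mono) auto
  also have "\<dots> = Cm * extremal_inf \<tau> r + e" using Cm by (simp add: distrib_left)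
  finally show "extremal_inf \<tau> (real m powr \<tau> * r) \<le> 2 * real m * real m powr (4 * \<tau>) * extremal_inf \<tau> r + e"
    unfolding Cm_def .
qed

text \<open>Truncation loses energy; it is restored at the frequency \<open>k = 0\<close>, which is free of smoothness cost.\<close>

lemma extremal_inf_approx_finite:
  assumes "\<delta> > 0"
  obtains \<theta> A where "\<theta> \<in> sobolev_class \<tau> r" "finite A" "\<And>k. k \<notin> A \<Longrightarrow> \<theta> k = 0"
    "(\<Sum>k\<in>A. (\<theta> k) ^ 4) < extremal_inf \<tau> r + \<delta>"
proof -
  obtain \<theta> where \<theta>: "\<theta> \<in> sobolev_class \<tau> r" and lt: "(\<Sum>\<^sub>\<infinity>k. (\<theta> k) ^ 4) < extremal_inf \<tau> r + \<delta> / 2"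
    using extremal_inf_approx[of "\<delta> / 2"] assms by auto
  note D = sobolev_classD[OF \<theta>]
  define S where "S = (\<Sum>\<^sub>\<infinity>k. (\<theta> k)\<^sup>2)"
  define tail where "tail A = S - (\<Sum>k\<in>A. (\<theta> k)\<^sup>2)" for A
  have "(tail \<longlongrightarrow> S - S) (finite_subsets_at_top UNIV)"
    unfolding tail_def [abs_def] S_def
    by (intro tendsto_diff tendsto_const has_sum_infsum[OF D(1), unfolded has_sum_def])
  \<comment> \<open>This is the growth of the fourth power at frequency 0 when the lost energy
    \<open>tail A\<close> is added to \<open>(\<theta> 0)\<^sup>2\<close>.\<close>
  then have "((\<lambda>A. 2 * (\<theta> 0)\<^sup>2 * tail A + (tail A)\<^sup>2) \<longlongrightarrow> 2 * (\<theta> 0)\<^sup>2 * 0 + 0\<^sup>2) (finite_subsets_at_top UNIV)"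
    by (intro tendsto_intros) simp_all
  then have "\<forall>\<^sub>F A in finite_subsets_at_top UNIV. 2 * (\<theta> 0)\<^sup>2 * tail A + (tail A)\<^sup>2 < \<delta> / 2"
    by (rule order_tendstoD) (use assms in simp)
  moreover have "\<forall>\<^sub>F A in finite_subsets_at_top UNIV. finite A \<and> {0 :: int} \<subseteq> A \<and> A \<subseteq> UNIV"
    unfolding eventually_finite_subsets_at_top by (rule exI[of _ "{0}"]) auto
  ultimately have "\<forall>\<^sub>F A in finite_subsets_at_top UNIV. finite A \<and> {0 :: int} \<subseteq> A \<and>
      2 * (\<theta> 0)\<^sup>2 * tail A + (tail A)\<^sup>2 < \<delta> / 2"
    by eventually_elim auto
  from eventually_happens'[OF finite_subsets_at_top_neq_bot this]
  obtain A where A: "finite A" "0 \<in> A" and tl: "2 * (\<theta> 0)\<^sup>2 * tail A + (tail A)\<^sup>2 < \<delta> / 2"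
    by (elim exE conjE) simp
  have t0: "tail A \<ge> 0"
    unfolding tail_def S_def using finite_sum_le_infsum[OF D(1) A(1)] by simp
  define \<eta> where "\<eta> k = (if k = 0 then sqrt ((\<theta> 0)\<^sup>2 + tail A) else if k \<in> A then \<theta> k else 0)" for k
  have \<eta>0: "(\<eta> 0)\<^sup>2 = (\<theta> 0)\<^sup>2 + tail A" using t0 by (simp add: \<eta>_def)
  have z: "\<eta> k = 0" if "k \<notin> A" for k using that A by (auto simp: \<eta>_def)
  have sums: "(\<Sum>k\<in>A. f k (\<eta> k)) = f 0 (\<eta> 0) + (\<Sum>k\<in>A-{0}. f k (\<theta> k))" for f :: "int \<Rightarrow> real \<Rightarrow> real"
  proof -
    have "(\<Sum>k\<in>A. f k (\<eta> k)) = f 0 (\<eta> 0) + (\<Sum>k\<in>A-{0}. f k (\<eta> k))"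
      by (rule sum.remove[OF A])
    also have "(\<Sum>k\<in>A-{0}. f k (\<eta> k)) = (\<Sum>k\<in>A-{0}. f k (\<theta> k))"
      by (intro sum.cong) (auto simp: \<eta>_def)
    finally show ?thesis .
  qed
  note HS = summable_on_finite_support[OF A(1)]
  have "\<eta> \<in> sobolev_class \<tau> r"
  proof (rule sobolev_classI[OF \<theta>])
    show "(\<lambda>k. (\<eta> k)\<^sup>2) summable_on UNIV" by (rule HS) (simp add: z)
    show "(\<lambda>k. \<bar>real_of_int k\<bar> powr (2 * \<tau>) * (\<eta> k)\<^sup>2) summable_on UNIV" by (rule HS) (simp add: z)
    have "(\<Sum>\<^sub>\<infinity>k. \<bar>real_of_int k\<bar> powr (2 * \<tau>) * (\<eta> k)\<^sup>2) = (\<Sum>k\<in>A. \<bar>real_of_int k\<bar> powr (2 * \<tau>) * (\<eta> k)\<^sup>2)"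
      by (rule HS) (simp add: z)
    also have "\<dots> = (\<Sum>k\<in>A-{0}. \<bar>real_of_int k\<bar> powr (2 * \<tau>) * (\<theta> k)\<^sup>2)"
      by (subst sums[of "\<lambda>k x. \<bar>real_of_int k\<bar> powr (2 * \<tau>) * x\<^sup>2"]) simp
    also have "\<dots> \<le> (\<Sum>\<^sub>\<infinity>k. \<bar>real_of_int k\<bar> powr (2 * \<tau>) * (\<theta> k)\<^sup>2)"
      by (rule finite_sum_le_infsum[OF D(2)]) (use A in auto)
    finally show "(\<Sum>\<^sub>\<infinity>k. \<bar>real_of_int k\<bar> powr (2 * \<tau>) * (\<eta> k)\<^sup>2) \<le> (\<Sum>\<^sub>\<infinity>k. \<bar>real_of_int k\<bar> powr (2 * \<tau>) * (\<theta> k)\<^sup>2)" .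
    have "(\<Sum>\<^sub>\<infinity>k. (\<eta> k)\<^sup>2) = (\<Sum>k\<in>A. (\<eta> k)\<^sup>2)" by (rule HS) (simp add: z)
    also have "\<dots> = (\<theta> 0)\<^sup>2 + tail A + (\<Sum>k\<in>A-{0}. (\<theta> k)\<^sup>2)"
      by (subst sums[of "\<lambda>k x. x\<^sup>2"]) (simp add: \<eta>0)
    also have "\<dots> = S" using sum.remove[OF A, of "\<lambda>k. (\<theta> k)\<^sup>2"] by (simp add: tail_def)
    finally show "r\<^sup>2 \<le> (\<Sum>\<^sub>\<infinity>k. (\<eta> k)\<^sup>2)" using D(4) by (simp add: S_def)
  qed
  moreover have "(\<Sum>k\<in>A. (\<eta> k) ^ 4) < extremal_inf \<tau> r + \<delta>"
  proof -
    have "(\<eta> 0) ^ 4 = ((\<eta> 0)\<^sup>2)\<^sup>2" by simp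
    also have "\<dots> = (\<theta> 0) ^ 4 + (2 * (\<theta> 0)\<^sup>2 * tail A + (tail A)\<^sup>2)"
      unfolding \<eta>0 by (simp add: power2_sum)
    finally have "(\<Sum>k\<in>A. (\<eta> k) ^ 4) = (\<Sum>k\<in>A. (\<theta> k) ^ 4) + (2 * (\<theta> 0)\<^sup>2 * tail A + (tail A)\<^sup>2)"
      using sum.remove[OF A, of "\<lambda>k. (\<theta> k) ^ 4"] by (subst sums[of "\<lambda>k x. x ^ 4"]) simp
    also have "\<dots> < (\<Sum>\<^sub>\<infinity>k. (\<theta> k) ^ 4) + \<delta> / 2"
      using tl finite_sum_le_infsum[OF D(5) A(1)] by simp
    finally show ?thesis using lt by simp
  qed
  ultimately show thesis using that A(1) z by blast
qed

section \<open>Error probabilities of the chi-square test\<close>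

lemma isCont_cdf_std_normal: "isCont (cdf std_normal_distribution) x"
proof -
  interpret real_distribution std_normal_distribution by (rule real_dist_normal_dist)
  have "AE y in lborel. y \<in> {x} \<longrightarrow> ennreal (std_normal_density y) = 0"
    using AE_lborel_singleton[of x] by eventually_elim auto
  then have "{x} \<in> null_sets std_normal_distribution"
    by (subst null_sets_density_iff) auto
  then have "measure std_normal_distribution {x} = 0" by (simp add: measure_def null_setsD1)
  then show ?thesis by (simp add: isCont_cdf)
qed

text \<open>Continuity makes the level set closed, so its infimum belongs to it; the intermediate
  value theorem supplies a point of value exactly \<open>p\<close>, which gives the reverse
  inequality.\<close>

lemma cdf_std_normal_quantile:
  assumes "0 < p" "p < 1" shows "cdf std_normal_distribution (std_normal_quantile p) = p"
proof -
  let ?F = "cdf std_normal_distribution"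
  interpret real_distribution std_normal_distribution by (rule real_dist_normal_dist)
  obtain a where a: "?F a < p"
    using order_tendstoD(2)[OF cdf_lim_at_bot assms(1)] by (auto simp: eventually_at_bot_linorder)
  obtain c where c: "?F c > p"
    using order_tendstoD(1)[OF cdf_lim_at_top_prob assms(2)] by (auto simp: eventually_at_top_linorder)
  have "a \<le> c" using a c cdf_nondecreasing[of c a] by force
  then obtain x where x: "?F x = p"
    using IVT[of ?F a p c] a c isCont_cdf_std_normal by auto
  let ?S = "{t. p \<le> ?F t}"
  have bdd: "bdd_below ?S"
  proof (rule bdd_belowI)
    fix t assume "t \<in> ?S"
    then show "a \<le> t" using a cdf_nondecreasing[of t a] by force
  qed
  have "closed ?S"
    by (intro closed_Collect_le continuous_on_const continuous_at_imp_continuous_on ballI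
        isCont_cdf_std_normal)
  then have "Inf ?S \<in> ?S" using x bdd by (intro closed_contains_Inf) auto
  moreover have "Inf ?S \<le> x" using bdd x by (intro cInf_lower) auto
  ultimately show ?thesis
    unfolding std_normal_quantile_def using cdf_nondecreasing[of "Inf ?S" x] x by auto
qed

text \<open>Uniformity in \<open>w\<close> is what an arbitrary filter requires, whereas Levy's
  theorem is sequential. Counterexamples to uniformity would form a sequence with growing
  \<open>d\<close>; the weight-free bound on characteristic functions applies along it and gives a
  contradiction.\<close>

lemma shifted_stat_tail_uniform:
  assumes \<alpha>: "0 < \<alpha>" "\<alpha> < 1" and e: "e > 0"
  shows "\<exists>D. \<forall>d w. d \<ge> D \<longrightarrow> chi2_weights d w \<longrightarrow>
    \<bar>measure (noise_law d) {\<eta> \<in> space (noise_law d).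
        chi2_weights.shifted_stat d w (\<lambda>_ _. 0) \<eta> > std_normal_quantile (1 - \<alpha>)} - \<alpha>\<bar> < e"
proof (rule ccontr)
  define q where "q = std_normal_quantile (1 - \<alpha>)"
  define P where "P d w \<longleftrightarrow> \<bar>measure (noise_law d) {\<eta> \<in> space (noise_law d).
      chi2_weights.shifted_stat d w (\<lambda>_ _. 0) \<eta> > q} - \<alpha>\<bar> < e" for d w
  assume "\<not> ?thesis"
  then have "\<not> (\<exists>D. \<forall>d w. d \<ge> D \<longrightarrow> chi2_weights d w \<longrightarrow> P d w)"
    by (simp add: P_def q_def)
  then have "\<forall>D. \<exists>dw. fst dw \<ge> D \<and> chi2_weights (fst dw) (snd dw) \<and> \<not> P (fst dw) (snd dw)"
    by simp
  from choice[OF this] obtain dw where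
    "\<And>n. fst (dw n) \<ge> n \<and> chi2_weights (fst (dw n)) (snd (dw n)) \<and> \<not> P (fst (dw n)) (snd (dw n))"
    by blast
  then obtain d w where d: "\<And>n. d n \<ge> n" and W: "\<And>n. chi2_weights (d n) (w n)" and
    "\<And>n. \<not> P (d n) (w n)"
    using that[of "\<lambda>n. fst (dw n)" "\<lambda>n. snd (dw n)"] by simp
  then have far: "\<bar>measure (noise_law (d n)) {\<eta> \<in> space (noise_law (d n)).
      chi2_weights.shifted_stat (d n) (w n) (\<lambda>_ _. 0) \<eta> > q} - \<alpha>\<bar> \<ge> e" for n
    by (simp add: P_def not_less)
  define X where "X n = chi2_weights.shifted_stat (d n) (w n) (\<lambda>_ _. 0)" for n
  define M where "M n = distr (noise_law (d n)) borel (X n)" for n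
  have X: "X n \<in> borel_measurable (noise_law (d n))" for n
    unfolding X_def by (rule chi2_weights.measurable_shifted_stat[OF W])
  have RD: "real_distribution (M n)" for n
    unfolding M_def by (rule prob_space.real_distribution_distr[OF prob_space_noise_law X])
  obtain C where C: "C \<ge> 0"
    "\<And>s. cmod ((\<integral>x. iexp (s * (x\<^sup>2 - 1)) \<partial>std_normal_distribution) - exp (- (complex_of_real s)\<^sup>2)) \<le> C * \<bar>s\<bar> ^ 3"
    using std_normal_char_square by blast
  have "weak_conv_m M std_normal_distribution"
  proof (rule levy_continuity[OF RD real_dist_normal_dist])
    fix s
    have "(\<lambda>n. char (M n) s - exp (- s\<^sup>2 / 2)) \<longlonglongrightarrow> 0"
    proof (rule Lim_null_comparison)
      show "\<forall>\<^sub>F n in sequentially. norm (char (M n) s - exp (- s\<^sup>2 / 2)) \<le> C * \<bar>s\<bar> ^ 3 / sqrt (real n)"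
        using eventually_gt_at_top[of 0]
      proof eventually_elim
        case (elim n)
        have "norm (char (M n) s - exp (- s\<^sup>2 / 2)) \<le> C * \<bar>s\<bar> ^ 3 / sqrt (real (d n))"
          unfolding M_def X_def by (rule chi2_weights.char_shifted_stat_bound[OF W C])
        also have "\<dots> \<le> C * \<bar>s\<bar> ^ 3 / sqrt (real n)"
          using elim d[of n] C(1) by (intro divide_left_mono) auto
        finally show ?case .
      qed
      show "(\<lambda>n. C * \<bar>s\<bar> ^ 3 / sqrt (real n)) \<longlonglongrightarrow> 0"
        by (intro tendsto_divide_0[OF tendsto_const] filterlim_at_top_imp_at_infinity
            filterlim_compose[OF sqrt_at_top filterlim_real_sequentially])
    qed
    then show "(\<lambda>n. char (M n) s) \<longlonglongrightarrow> char std_normal_distribution s"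
      unfolding char_std_normal_distribution by (simp add: LIM_zero_iff)
  qed
  then have "(\<lambda>n. cdf (M n) q) \<longlonglongrightarrow> cdf std_normal_distribution q"
    unfolding weak_conv_m_def weak_conv_def using isCont_cdf_std_normal by blast
  moreover have "cdf std_normal_distribution q = 1 - \<alpha>"
    unfolding q_def using \<alpha> by (intro cdf_std_normal_quantile) auto
  ultimately have "(\<lambda>n. 1 - cdf (M n) q) \<longlonglongrightarrow> \<alpha>"
    using tendsto_diff[OF tendsto_const, of "\<lambda>n. cdf (M n) q" "1 - \<alpha>" sequentially 1] by simp
  moreover have "1 - cdf (M n) q = measure (noise_law (d n)) {\<eta> \<in> space (noise_law (d n)). X n \<eta> > q}" for n
  proof -
    interpret P: prob_space "noise_law (d n)" by (rule prob_space_noise_law)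
    note [measurable] = X
    have "cdf (M n) q = measure (noise_law (d n)) {\<eta> \<in> space (noise_law (d n)). X n \<eta> \<le> q}"
      unfolding cdf_def M_def using X by (subst measure_distr) (auto intro!: arg_cong[where f = "measure _"])
    also have "\<dots> = 1 - measure (noise_law (d n)) {\<eta> \<in> space (noise_law (d n)). \<not> X n \<eta> \<le> q}"
      by (subst P.prob_neg) auto
    finally show ?thesis by (simp add: not_le)
  qed
  ultimately have "(\<lambda>n. measure (noise_law (d n)) {\<eta> \<in> space (noise_law (d n)). X n \<eta> > q}) \<longlonglongrightarrow> \<alpha>"
    by simp
  then have "\<forall>\<^sub>F n in sequentially. dist (measure (noise_law (d n)) {\<eta> \<in> space (noise_law (d n)). X n \<eta> > q}) \<alpha> < e"
    using e by (rule tendstoD)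
  then obtain n where "\<bar>measure (noise_law (d n)) {\<eta> \<in> space (noise_law (d n)). X n \<eta> > q} - \<alpha>\<bar> < e"
    by (auto simp: eventually_sequentially dist_real_def)
  with far[of n] show False by (simp add: X_def)
qed

text \<open>By the definition of \<open>extremal_a\<close>, the sum of fourth powers of a minimizer
  is \<open>2 * \<epsilon> ^ 4\<close> times its square; the denominator in \<open>weight\<close>
  therefore normalises the squared weights to 1/2. Positivity of \<open>extremal_a\<close> excludes
  division by zero.\<close>

lemma chi2_weights_weight:
  assumes \<epsilon>: "\<epsilon> > 0" and d: "d \<ge> 1" and min: "is_minimizing \<tau> r \<theta>" and a: "extremal_a \<epsilon> \<tau> r > 0"
  shows "chi2_weights d (weight \<epsilon> \<tau> r \<theta>)"
proof
  define a' where "a' = extremal_a \<epsilon> \<tau> r"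
  have \<theta>: "\<theta> \<in> sobolev_class \<tau> r" and eq: "(\<Sum>\<^sub>\<infinity>k. (\<theta> k) ^ 4) = extremal_inf \<tau> r"
    using min by (auto simp: is_minimizing_def)
  note D = sobolev_classD[OF \<theta>]
  have w: "weight \<epsilon> \<tau> r \<theta> k = 1 / (2 * a' * \<epsilon>\<^sup>2) * (\<theta> k)\<^sup>2" for k
    by (simp add: weight_def a'_def)
  have w2: "(weight \<epsilon> \<tau> r \<theta> k)\<^sup>2 = (1 / (2 * a' * \<epsilon>\<^sup>2))\<^sup>2 * (\<theta> k) ^ 4" for k
    by (simp only: w power_mult_distrib flip: power_mult) simp
  show "1 \<le> d" by (rule d)
  show "0 \<le> weight \<epsilon> \<tau> r \<theta> k" for k using a by (simp add: weight_def)
  show "weight \<epsilon> \<tau> r \<theta> summable_on UNIV"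
    unfolding w [abs_def] by (intro summable_on_cmult_right D)
  show "(\<lambda>k. (weight \<epsilon> \<tau> r \<theta> k)\<^sup>2) summable_on UNIV"
    unfolding w2 by (intro summable_on_cmult_right D)
  have a2: "extremal_inf \<tau> r = a'\<^sup>2 * (2 * \<epsilon> ^ 4)"
    using extremal_inf_nonneg[of \<tau> r] \<epsilon> by (simp add: a'_def extremal_a_def)
  have "(\<Sum>\<^sub>\<infinity>k. (weight \<epsilon> \<tau> r \<theta> k)\<^sup>2) = (1 / (2 * a' * \<epsilon>\<^sup>2))\<^sup>2 * extremal_inf \<tau> r"
    unfolding w2 infsum_cmult_right' eq ..
  also have "\<dots> = 1 / (4 * a'\<^sup>2 * \<epsilon> ^ 4) * (a'\<^sup>2 * (2 * \<epsilon> ^ 4))"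
    unfolding a2 by (simp add: power_mult_distrib power_divide)
  also have "\<dots> = 1 / 2" using a \<epsilon> by (simp add: a'_def[symmetric])
  finally show "(\<Sum>\<^sub>\<infinity>k. (weight \<epsilon> \<tau> r \<theta> k)\<^sup>2) = 1/2" .
qed

lemma chi2_stat_obs:
  assumes "\<epsilon> > 0" and "chi2_weights d (weight \<epsilon> \<tau> r \<theta>)"
  shows "chi2_stat \<epsilon> d \<tau> r \<theta> (\<lambda>(j, k)\<in>obs_index d. u j k + \<epsilon> * \<eta> (j, k)) =
    chi2_weights.shifted_stat d (weight \<epsilon> \<tau> r \<theta>) (\<lambda>j k. u j k / \<epsilon>) \<eta>"
  unfolding chi2_stat_def chi2_weights.shifted_stat_def[OF assms(2)]
  using assms(1) by (intro arg_cong2[where f = "(*)"] sum.cong infsum_cong refl)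
    (simp_all add: obs_index_def add_divide_distrib)

lemma measurable_chi2_stat: "chi2_stat \<epsilon> d \<tau> r \<theta> \<in> borel_measurable (obs_space d)"
  unfolding chi2_stat_def [abs_def]
  by (intro borel_measurable_times borel_measurable_const borel_measurable_sum
      borel_measurable_infsum_int borel_measurable_diff borel_measurable_power borel_measurable_divide
      measurable_obs_coordinate) (auto simp: obs_index_def)

lemma is_test_chi2_test: "is_test d (chi2_test \<epsilon> d \<tau> r \<theta> \<alpha>)"
proof -
  note [measurable] = measurable_chi2_stat
  show ?thesis unfolding is_test_def chi2_test_def [abs_def] by simp
qed

lemma
  assumes \<epsilon>: "\<epsilon> > 0" and W: "chi2_weights d (weight \<epsilon> \<tau> r \<theta>)"
  shows type_I_error_chi2_test: "type_I_error \<epsilon> d (chi2_test \<epsilon> d \<tau> r \<theta> \<alpha>) =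
      measure (noise_law d) {\<eta> \<in> space (noise_law d).
        chi2_weights.shifted_stat d (weight \<epsilon> \<tau> r \<theta>) (\<lambda>_ _. 0) \<eta> > std_normal_quantile (1 - \<alpha>)}"
    and miss_probability_chi2_test: "(\<integral>x. 1 - chi2_test \<epsilon> d \<tau> r \<theta> \<alpha> x \<partial>obs_law \<epsilon> d u) =
      measure (noise_law d) {\<eta> \<in> space (noise_law d).
        chi2_weights.shifted_stat d (weight \<epsilon> \<tau> r \<theta>) (\<lambda>j k. u j k / \<epsilon>) \<eta> \<le> std_normal_quantile (1 - \<alpha>)}"
proof -
  interpret P: prob_space "noise_law d" by (rule prob_space_noise_law)
  have m: "chi2_test \<epsilon> d \<tau> r \<theta> \<alpha> \<in> borel_measurable (obs_space d)"
    using is_test_chi2_test by (simp add: is_test_def)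
  note obs = chi2_stat_obs[OF \<epsilon> W]
  note [measurable] = chi2_weights.measurable_shifted_stat[OF W]
  let ?X = "\<lambda>u. chi2_weights.shifted_stat d (weight \<epsilon> \<tau> r \<theta>) (\<lambda>j k. u j k / \<epsilon>)"
    and ?q = "std_normal_quantile (1 - \<alpha>)"
  have "type_I_error \<epsilon> d (chi2_test \<epsilon> d \<tau> r \<theta> \<alpha>) =
      (\<integral>\<eta>. chi2_test \<epsilon> d \<tau> r \<theta> \<alpha> (\<lambda>(j, k)\<in>obs_index d. 0 + \<epsilon> * \<eta> (j, k)) \<partial>noise_law d)"
    unfolding type_I_error_def by (rule integral_obs_law[OF m])
  also have "\<dots> = (\<integral>\<eta>. indicator {\<eta> \<in> space (noise_law d). ?X (\<lambda>_ _. 0) \<eta> > ?q} \<eta> \<partial>noise_law d)"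
    by (intro Bochner_Integration.integral_cong refl)
       (simp only: chi2_test_def obs[of "\<lambda>_ _. 0"], simp add: indicator_def)
  finally show "type_I_error \<epsilon> d (chi2_test \<epsilon> d \<tau> r \<theta> \<alpha>) =
      measure (noise_law d) {\<eta> \<in> space (noise_law d).
        chi2_weights.shifted_stat d (weight \<epsilon> \<tau> r \<theta>) (\<lambda>_ _. 0) \<eta> > ?q}" by simp
  have "(\<integral>x. 1 - chi2_test \<epsilon> d \<tau> r \<theta> \<alpha> x \<partial>obs_law \<epsilon> d u) =
      (\<integral>\<eta>. 1 - chi2_test \<epsilon> d \<tau> r \<theta> \<alpha> (\<lambda>(j, k)\<in>obs_index d. u j k + \<epsilon> * \<eta> (j, k)) \<partial>noise_law d)"
    by (rule integral_obs_law) (use m in measurable)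
  also have "\<dots> = (\<integral>\<eta>. indicator {\<eta> \<in> space (noise_law d). ?X u \<eta> \<le> ?q} \<eta> \<partial>noise_law d)"
    by (intro Bochner_Integration.integral_cong refl)
       (simp only: chi2_test_def obs, simp add: indicator_def)
  finally show "(\<integral>x. 1 - chi2_test \<epsilon> d \<tau> r \<theta> \<alpha> x \<partial>obs_law \<epsilon> d u) =
      measure (noise_law d) {\<eta> \<in> space (noise_law d). ?X u \<eta> \<le> ?q}" by simp
qed

section \<open>Error functionals, the number of active components, and the type II bound\<close>

lemma integral_test_bounds:
  assumes "is_test d \<psi>"
  shows "0 \<le> (\<integral>x. 1 - \<psi> x \<partial>obs_law \<epsilon> d u)" "(\<integral>x. 1 - \<psi> x \<partial>obs_law \<epsilon> d u) \<le> 1"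
    "0 \<le> (\<integral>x. \<psi> x \<partial>obs_law \<epsilon> d u)" "integrable (obs_law \<epsilon> d u) \<psi>"
proof -
  interpret P: prob_space "obs_law \<epsilon> d u" by (rule prob_space_obs_law)
  have [measurable]: "\<psi> \<in> borel_measurable (obs_space d)" and b: "\<And>x. x \<in> space (obs_space d) \<Longrightarrow> 0 \<le> \<psi> x \<and> \<psi> x \<le> 1"
    using assms by (auto simp: is_test_def)
  show i: "integrable (obs_law \<epsilon> d u) \<psi>"
    using b by (intro P.integrable_const_bound[where B = 1] AE_I2) (force simp: space_obs_law)+
  show "0 \<le> (\<integral>x. 1 - \<psi> x \<partial>obs_law \<epsilon> d u)" "0 \<le> (\<integral>x. \<psi> x \<partial>obs_law \<epsilon> d u)"
    by (rule Bochner_Integration.integral_nonneg, simp add: space_obs_law b)+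
  have "(\<integral>x. 1 - \<psi> x \<partial>obs_law \<epsilon> d u) \<le> (\<integral>x. 1 \<partial>obs_law \<epsilon> d u)"
    by (intro integral_mono Bochner_Integration.integrable_diff i) (auto simp: space_obs_law b)
  then show "(\<integral>x. 1 - \<psi> x \<partial>obs_law \<epsilon> d u) \<le> 1" by (simp add: P.prob_space)
qed

text \<open>Miss probabilities are at most 1, so the real supremum is over a bounded set.\<close>

lemma type_II_error_ge:
  assumes "is_test d \<psi>" "u \<in> H"
  shows "(\<integral>x. 1 - \<psi> x \<partial>obs_law \<epsilon> d u) \<le> type_II_error \<epsilon> d \<psi> H"
  unfolding type_II_error_def
  by (rule cSUP_upper[OF assms(2) bdd_aboveI2[where M = 1]]) (rule integral_test_bounds(2)[OF assms(1)])

lemma num_active_bounds: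
  assumes "d \<ge> 1" "0 \<le> b" "b \<le> 1"
  shows "1 \<le> num_active d b" "num_active d b \<le> d" "real (num_active d b) \<le> real d powr (1 - b)"
    "real d powr (1 - b) / 2 \<le> real (num_active d b)"
proof -
  let ?p = "real d powr (1 - b)"
  have p1: "1 \<le> ?p" using assms by (intro ge_one_powr_ge_zero) auto
  have pd: "?p \<le> real d powr 1" using assms by (intro powr_mono) auto
  have f: "1 \<le> \<lfloor>?p\<rfloor>" using p1 by (simp add: le_floor_iff)
  then have K: "real (num_active d b) = of_int \<lfloor>?p\<rfloor>" by (simp add: num_active_def)
  show "1 \<le> num_active d b" using f unfolding num_active_def by linarith
  show le: "real (num_active d b) \<le> ?p" unfolding K by simp
  show "num_active d b \<le> d" using le pd assms by simp
  \<comment> \<open>The integer part is at least 1, so rounding down loses at most a factor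
    2.\<close>
  have "?p < of_int \<lfloor>?p\<rfloor> + 1" by linarith
  moreover have "(1 :: real) \<le> of_int \<lfloor>?p\<rfloor>" using f by linarith
  ultimately show "?p / 2 \<le> real (num_active d b)" unfolding K by linarith
qed

lemma sparse_class_nonempty:
  assumes "d \<ge> 1" "0 \<le> b" "b \<le> 1" shows "sparse_class d \<tau> r b \<noteq> {}"
proof -
  obtain \<theta> where \<theta>: "\<theta> \<in> sobolev_class \<tau> r" using sobolev_class_nonempty by blast
  define \<xi> where "\<xi> j = (if j \<le> num_active d b then 1 else 0 :: real)" for j :: nat
  have "(\<Sum>j=1..d. \<xi> j) = (\<Sum>j\<in>{1..num_active d b}. 1)"
    using num_active_bounds(2)[OF assms] by (intro sum.mono_neutral_cong_right) (auto simp: \<xi>_def)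
  then have "(\<lambda>j k. if j \<in> {1..d} then \<xi> j * \<theta> k else 0) \<in> sparse_class d \<tau> r b"
    unfolding sparse_class_def using \<theta>
    by (intro CollectI exI[of _ \<xi>] exI[of _ "\<lambda>_. \<theta>"]) (auto simp: \<xi>_def)
  then show ?thesis by blast
qed

lemma type_II_error_chi2_test:
  assumes \<epsilon>: "\<epsilon> > 0" and d: "d \<ge> 1" and b: "0 \<le> b" "b \<le> 1" and min: "is_minimizing \<tau> r' \<theta>'"
    and a: "extremal_a \<epsilon> \<tau> r' > 0" and r: "0 < r'" "r' \<le> r"
  shows "0 \<le> type_II_error \<epsilon> d (chi2_test \<epsilon> d \<tau> r' \<theta>' \<alpha>) (sparse_class d \<tau> r b)"
    and "type_II_error \<epsilon> d (chi2_test \<epsilon> d \<tau> r' \<theta>' \<alpha>) (sparse_class d \<tau> r b) \<le>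
      exp (std_normal_quantile (1 - \<alpha>) + 1/2
        - real (num_active d b) / sqrt (real d) * (r / r')\<^sup>2 * extremal_a \<epsilon> \<tau> r' / 3)"
proof -
  let ?w = "weight \<epsilon> \<tau> r' \<theta>'" and ?q = "std_normal_quantile (1 - \<alpha>)" and ?K = "real (num_active d b)"
  define a' where "a' = extremal_a \<epsilon> \<tau> r'"
  have W: "chi2_weights d ?w" by (rule chi2_weights_weight[OF \<epsilon> d min a])
  interpret chi2_weights d ?w by (rule W)
  have ne: "sparse_class d \<tau> r b \<noteq> {}" by (rule sparse_class_nonempty[OF d b])
  then obtain u where u: "u \<in> sparse_class d \<tau> r b" by blast
  show "0 \<le> type_II_error \<epsilon> d (chi2_test \<epsilon> d \<tau> r' \<theta>' \<alpha>) (sparse_class d \<tau> r b)"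
    using integral_test_bounds(1)[OF is_test_chi2_test] type_II_error_ge[OF is_test_chi2_test u]
    by (rule order_trans)
  have a2: "extremal_inf \<tau> r' = a'\<^sup>2 * (2 * \<epsilon> ^ 4)"
    using extremal_inf_nonneg[of \<tau> r'] \<epsilon> by (simp add: a'_def extremal_a_def)
  show "type_II_error \<epsilon> d (chi2_test \<epsilon> d \<tau> r' \<theta>' \<alpha>) (sparse_class d \<tau> r b) \<le>
      exp (?q + 1/2 - ?K / sqrt (real d) * (r / r')\<^sup>2 * extremal_a \<epsilon> \<tau> r' / 3)"
    unfolding type_II_error_def
  proof (rule cSUP_least[OF ne])
    fix u assume "u \<in> sparse_class d \<tau> r b"
    then obtain \<xi> \<theta> where u: "u = (\<lambda>j k. if j \<in> {1..d} then \<xi> j * \<theta> j k else 0)"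
      and \<xi>: "\<forall>j\<in>{1..d}. \<xi> j \<in> {0, 1}" and K: "(\<Sum>j=1..d. \<xi> j) = ?K"
      and \<theta>: "\<forall>j\<in>{1..d}. \<theta> j \<in> sobolev_class \<tau> r"
      unfolding sparse_class_def by blast
    have \<xi>2: "(\<xi> j)\<^sup>2 = \<xi> j" "\<xi> j \<ge> 0" if "j \<in> {1..d}" for j
      using bspec[OF \<xi> that] by auto
    have usq: "(u j k / \<epsilon>)\<^sup>2 = \<xi> j / \<epsilon>\<^sup>2 * (\<theta> j k)\<^sup>2" if "j \<in> {1..d}" for j k
      using that \<xi>2(1)[OF that] by (simp add: u power_divide power_mult_distrib)
    have us: "(\<lambda>k. (u j k / \<epsilon>)\<^sup>2) summable_on UNIV" if j: "j \<in> {1..d}" for j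
    proof -
      have "\<theta> j \<in> sobolev_class \<tau> r" using \<theta> j by blast
      then show ?thesis unfolding usq[OF j] by (intro summable_on_cmult_right sobolev_classD(1))
    qed
    \<comment> \<open>For an active row the weights turn the cross sum into at least
      \<open>(r / r')\<^sup>2\<close> times
      \<open>extremal_inf \<tau> r' / (2 * a' * \<epsilon> ^ 4)\<close>, and the latter quotient
      equals \<open>a'\<close>. An inactive row contributes nothing, as recorded by
      \<open>\<xi> j\<close>.\<close>
    have each: "\<xi> j * ((r / r')\<^sup>2 * a') \<le> (\<Sum>\<^sub>\<infinity>k. ?w k * (u j k / \<epsilon>)\<^sup>2)" if j: "j \<in> {1..d}" for j
    proof -
      have \<theta>j: "\<theta> j \<in> sobolev_class \<tau> r" using \<theta> j by blast
      have "(\<Sum>\<^sub>\<infinity>k. ?w k * (u j k / \<epsilon>)\<^sup>2) = (\<Sum>\<^sub>\<infinity>k. \<xi> j / (2 * a' * \<epsilon> ^ 4) * ((\<theta>' k)\<^sup>2 * (\<theta> j k)\<^sup>2))"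
        unfolding usq[OF j] weight_def a'_def
        by (intro infsum_cong) (simp add: power4_eq_xxxx power2_eq_square mult_ac)
      also have "\<dots> = \<xi> j / (2 * a' * \<epsilon> ^ 4) * (\<Sum>\<^sub>\<infinity>k. (\<theta>' k)\<^sup>2 * (\<theta> j k)\<^sup>2)"
        by (rule infsum_cmult_right')
      also have "\<dots> \<ge> \<xi> j / (2 * a' * \<epsilon> ^ 4) * ((r / r')\<^sup>2 * extremal_inf \<tau> r')"
        using a \<epsilon> \<xi>2(2)[OF j]
        by (intro mult_left_mono minimizing_cross_ge_scaled[OF min \<theta>j r]) (auto simp: a'_def)
      also have "\<xi> j / (2 * a' * \<epsilon> ^ 4) * ((r / r')\<^sup>2 * extremal_inf \<tau> r') = \<xi> j * ((r / r')\<^sup>2 * a')"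
        using a \<epsilon> unfolding a2 by (simp add: a'_def[symmetric] power2_eq_square)
      finally show ?thesis .
    qed
    have "?K * ((r / r')\<^sup>2 * a') = (\<Sum>j=1..d. \<xi> j * ((r / r')\<^sup>2 * a'))"
      unfolding K[symmetric] by (rule sum_distrib_right)
    also have "\<dots> \<le> (\<Sum>j=1..d. \<Sum>\<^sub>\<infinity>k. ?w k * (u j k / \<epsilon>)\<^sup>2)" by (intro sum_mono each)
    finally have le: "1 / sqrt (real d) * (?K * ((r / r')\<^sup>2 * a')) \<le>
        1 / sqrt (real d) * (\<Sum>j=1..d. \<Sum>\<^sub>\<infinity>k. ?w k * (u j k / \<epsilon>)\<^sup>2)"
      by (intro mult_left_mono) auto
    have "measure (noise_law d) {\<eta> \<in> space (noise_law d). shifted_stat (\<lambda>j k. u j k / \<epsilon>) \<eta> \<le> ?q}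
        \<le> exp (?q + 1/2 - 1 / sqrt (real d) * (\<Sum>j=1..d. \<Sum>\<^sub>\<infinity>k. ?w k * (u j k / \<epsilon>)\<^sup>2) / 3)"
      by (rule prob_shifted_stat_le) (rule us)
    then have "measure (noise_law d) {\<eta> \<in> space (noise_law d). shifted_stat (\<lambda>j k. u j k / \<epsilon>) \<eta> \<le> ?q}
        \<le> exp (?q + 1/2 - ?K / sqrt (real d) * (r / r')\<^sup>2 * a' / 3)"
    proof (elim order_trans)
      have eq: "?K / sqrt (real d) * (r / r')\<^sup>2 * a' = 1 / sqrt (real d) * (?K * ((r / r')\<^sup>2 * a'))" by simp
      show "exp (?q + 1/2 - 1 / sqrt (real d) * (\<Sum>j=1..d. \<Sum>\<^sub>\<infinity>k. ?w k * (u j k / \<epsilon>)\<^sup>2) / 3)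
          \<le> exp (?q + 1/2 - ?K / sqrt (real d) * (r / r')\<^sup>2 * a' / 3)"
        unfolding exp_le_cancel_iff eq by (intro diff_left_mono divide_right_mono le) simp
    qed
    then show "(\<integral>x. 1 - chi2_test \<epsilon> d \<tau> r' \<theta>' \<alpha> x \<partial>obs_law \<epsilon> d u) \<le>
        exp (?q + 1/2 - ?K / sqrt (real d) * (r / r')\<^sup>2 * extremal_a \<epsilon> \<tau> r' / 3)"
      unfolding miss_probability_chi2_test[OF \<epsilon> W] a'_def .
  qed
qed

section \<open>The second moment method for the lower bound\<close>

text \<open>Cameron-Martin density of the noise translated by \<open>v\<close>, for \<open>v\<close>
  vanishing outside the finite set \<open>J\<close>.\<close>

definition likelihood :: "(nat \<times> int) set \<Rightarrow> (nat \<times> int \<Rightarrow> real) \<Rightarrow> (nat \<times> int \<Rightarrow> real) \<Rightarrow> real" where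
  "likelihood J v \<eta> = (\<Prod>i\<in>J. exp (v i * \<eta> i - (v i)\<^sup>2 / 2))"

lemma measurable_likelihood:
  assumes "J \<subseteq> obs_index d" shows "likelihood J v \<in> borel_measurable (noise_law d)"
proof -
  have [measurable]: "i \<in> J \<Longrightarrow> (\<lambda>\<eta>. \<eta> i) \<in> borel_measurable (noise_law d)" for i
    using measurable_obs_coordinate[of i d] measurable_cong_sets[OF sets_noise_law refl, of d borel] assms by blast
  show ?thesis unfolding likelihood_def [abs_def] by measurable
qed

lemma likelihood_nonneg: "likelihood J v \<eta> \<ge> 0"
  by (simp add: likelihood_def prod_nonneg)

text \<open>Finite measures on the product agree once they agree on cylinders. On the union of
  \<open>J\<close> and the base \<open>J'\<close> of a cylinder, density and cylinder indicator
  involve the same finitely many independent coordinates, which reduces the claim to one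
  dimension.\<close>

lemma distr_shift_noise_law:
  assumes J: "finite J" "J \<subseteq> obs_index d" and v: "\<And>i. i \<notin> J \<Longrightarrow> v i = 0"
  shows "distr (noise_law d) (obs_space d) (\<lambda>\<eta>. \<lambda>i\<in>obs_index d. v i + \<eta> i) =
    density (noise_law d) (\<lambda>\<eta>. ennreal (likelihood J v \<eta>))"
proof -
  let ?I = "obs_index d" and ?N = std_normal_distribution
  let ?T = "\<lambda>\<eta>. \<lambda>i\<in>?I. v i + \<eta> i"
  interpret P: prob_space "noise_law d" by (rule prob_space_noise_law)
  have coord: "i \<in> ?I \<Longrightarrow> (\<lambda>\<eta>. \<eta> i) \<in> borel_measurable (noise_law d)" for i
    using measurable_obs_coordinate[of i d] measurable_cong_sets[OF sets_noise_law refl, of d borel] by blast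
  have T: "?T \<in> measurable (noise_law d) (obs_space d)"
    unfolding obs_space_def by (intro measurable_restrict borel_measurable_add coord) auto
  note [measurable] = measurable_likelihood[OF J(2), of v]
  show ?thesis
  proof (rule measure_eqI_PiM_infinite[where I = ?I and M = "\<lambda>_. borel"])
    show "sets (distr (noise_law d) (obs_space d) ?T) = sets (\<Pi>\<^sub>M i\<in>?I. borel)"
      by (simp add: obs_space_def)
    show "sets (density (noise_law d) (\<lambda>\<eta>. ennreal (likelihood J v \<eta>))) = sets (\<Pi>\<^sub>M i\<in>?I. borel)"
      by (simp add: sets_noise_law obs_space_def)
    interpret D: prob_space "distr (noise_law d) (obs_space d) ?T" by (rule P.prob_space_distr[OF T])
    show "finite_measure (distr (noise_law d) (obs_space d) ?T)" by unfold_locales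
    fix A :: "nat \<times> int \<Rightarrow> real set" and J'
    assume J': "finite J'" "J' \<subseteq> ?I" and A: "\<And>i. i \<in> J' \<Longrightarrow> A i \<in> sets borel"
    let ?X = "prod_emb ?I (\<lambda>_. borel) J' (Pi\<^sub>E J' A)"
    define B where "B i = (if i \<in> J' then A i else UNIV)" for i
    have B: "B i \<in> sets borel" for i using A by (auto simp: B_def)
    have fin: "finite (J \<union> J')" "J \<union> J' \<subseteq> ?I" using J J' by auto
    have X: "?X \<in> sets (obs_space d)"
      unfolding obs_space_def using J' A by (intro sets_PiM_I) auto
    have ind: "indicator ?X \<eta> = (\<Prod>i\<in>J \<union> J'. indicator (B i) (\<eta> i) :: ennreal)"
      if "\<eta> \<in> space (obs_space d)" for \<eta>
    proof -
      have "(\<Prod>i\<in>J \<union> J'. indicator (B i) (\<eta> i) :: ennreal) = (\<Prod>i\<in>J'. indicator (A i) (\<eta> i))"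
        using fin by (intro prod.mono_neutral_cong_right) (auto simp: B_def)
      also have "\<dots> = indicator ?X \<eta>"
      proof (cases "\<forall>i\<in>J'. \<eta> i \<in> A i")
        case True
        then have "\<eta> \<in> ?X" using that J' by (auto simp: prod_emb_def space_obs_space)
        with True show ?thesis by (simp cong: prod.cong)
      next
        case False
        then have "\<eta> \<notin> ?X" using J' by (auto simp: prod_emb_def)
        moreover from False obtain i where "i \<in> J'" "\<eta> i \<notin> A i" by blast
        then have "\<exists>i\<in>J'. indicator (A i) (\<eta> i) = (0 :: ennreal)" by (intro bexI[of _ i]) auto
        ultimately show ?thesis using J' by (simp add: prod_zero_iff)
      qed
      finally show ?thesis by simp
    qed
    have sp: "space (noise_law d) = space (obs_space d)" by (simp add: space_noise_law space_obs_space)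
    have "emeasure (distr (noise_law d) (obs_space d) ?T) ?X =
        (\<integral>\<^sup>+x. indicator ?X x \<partial>distr (noise_law d) (obs_space d) ?T)"
      using X by simp
    also have "\<dots> = (\<integral>\<^sup>+\<eta>. indicator ?X (?T \<eta>) \<partial>noise_law d)"
      using X by (intro nn_integral_distr[OF T]) simp
    also have "\<dots> = (\<integral>\<^sup>+\<eta>. (\<Prod>i\<in>J \<union> J'. indicator (B i) (v i + \<eta> i)) \<partial>noise_law d)"
    proof (rule nn_integral_cong)
      fix \<eta> assume "\<eta> \<in> space (noise_law d)"
      then have "?T \<eta> \<in> space (obs_space d)" by (simp add: space_obs_space)
      from ind[OF this] show "indicator ?X (?T \<eta>) = (\<Prod>i\<in>J \<union> J'. indicator (B i) (v i + \<eta> i) :: ennreal)"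
        using fin(2) by (auto intro!: prod.cong)
    qed
    also have "\<dots> = (\<Prod>i\<in>J \<union> J'. \<integral>\<^sup>+x. indicator (B i) (v i + x) \<partial>?N)"
      unfolding noise_law_def using B
      by (intro nn_integral_PiM_prod[where f = "\<lambda>i x. indicator (B i) (v i + x)", OF prob_space_std_normal fin]) simp
    also have "\<dots> = (\<Prod>i\<in>J \<union> J'. \<integral>\<^sup>+x. ennreal (exp (v i * x - (v i)\<^sup>2 / 2)) * indicator (B i) x \<partial>?N)"
    proof (rule prod.cong[OF refl])
      fix i
      have "(\<integral>\<^sup>+x. indicator (B i) (v i + x) \<partial>?N) = (\<integral>\<^sup>+x. indicator (B i) x \<partial>distr ?N borel (\<lambda>x. v i + x))"
        using B by (subst nn_integral_distr) auto
      also have "\<dots> = (\<integral>\<^sup>+x. ennreal (exp (v i * x - (v i)\<^sup>2 / 2)) * indicator (B i) x \<partial>?N)"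
        unfolding distr_shift_std_normal using B by (subst nn_integral_density) auto
      finally show "(\<integral>\<^sup>+x. indicator (B i) (v i + x) \<partial>?N) =
        (\<integral>\<^sup>+x. ennreal (exp (v i * x - (v i)\<^sup>2 / 2)) * indicator (B i) x \<partial>?N)" .
    qed
    also have "\<dots> = (\<integral>\<^sup>+\<eta>. (\<Prod>i\<in>J \<union> J'. ennreal (exp (v i * \<eta> i - (v i)\<^sup>2 / 2)) * indicator (B i) (\<eta> i)) \<partial>noise_law d)"
      unfolding noise_law_def using B
      by (intro nn_integral_PiM_prod[where f = "\<lambda>i x. ennreal (exp (v i * x - (v i)\<^sup>2 / 2)) * indicator (B i) x",
            OF prob_space_std_normal fin, symmetric]) simp
    also have "\<dots> = (\<integral>\<^sup>+\<eta>. ennreal (likelihood J v \<eta>) * indicator ?X \<eta> \<partial>noise_law d)"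
    proof (rule nn_integral_cong)
      fix \<eta> assume "\<eta> \<in> space (noise_law d)"
      then have \<eta>: "\<eta> \<in> space (obs_space d)" by (simp add: sp)
      have "ennreal (likelihood J v \<eta>) = (\<Prod>i\<in>J. ennreal (exp (v i * \<eta> i - (v i)\<^sup>2 / 2)))"
        by (simp add: likelihood_def prod_ennreal)
      also have "\<dots> = (\<Prod>i\<in>J \<union> J'. ennreal (exp (v i * \<eta> i - (v i)\<^sup>2 / 2)))"
        using fin v by (intro prod.mono_neutral_left) auto
      finally show "(\<Prod>i\<in>J \<union> J'. ennreal (exp (v i * \<eta> i - (v i)\<^sup>2 / 2)) * indicator (B i) (\<eta> i)) =
          ennreal (likelihood J v \<eta>) * indicator ?X \<eta>"
        unfolding ind[OF \<eta>] by (simp add: prod.distrib)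
    qed
    also have "\<dots> = emeasure (density (noise_law d) (\<lambda>\<eta>. ennreal (likelihood J v \<eta>))) ?X"
      using X by (subst emeasure_density) (auto simp: sets_noise_law)
    finally show "emeasure (distr (noise_law d) (obs_space d) ?T) ?X =
        emeasure (density (noise_law d) (\<lambda>\<eta>. ennreal (likelihood J v \<eta>))) ?X" .
  qed
qed

text \<open>In each coordinate the two densities combine to a multiple of
  \<open>exp ((v i + v' i) * x)\<close>; after integration the squares cancel and only the cross
  term survives. This makes the second moment of a mixture computable.\<close>

lemma
  assumes J: "finite J" "J \<subseteq> obs_index d"
  shows integral_likelihood_mult:
      "(\<integral>\<eta>. likelihood J v \<eta> * likelihood J v' \<eta> \<partial>noise_law d) = exp (\<Sum>i\<in>J. v i * v' i)"
    and integrable_likelihood_mult: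
      "integrable (noise_law d) (\<lambda>\<eta>. likelihood J v \<eta> * likelihood J v' \<eta>)"
proof -
  let ?N = std_normal_distribution
  define f where "f i x = exp (v i * x - (v i)\<^sup>2 / 2) * exp (v' i * x - (v' i)\<^sup>2 / 2)" for i and x :: real
  have eq: "likelihood J v \<eta> * likelihood J v' \<eta> = (\<Prod>i\<in>J. f i (\<eta> i))" for \<eta>
    by (simp add: likelihood_def f_def prod.distrib)
  have nn: "(\<integral>\<^sup>+x. ennreal (f i x) \<partial>?N) = ennreal (exp (v i * v' i))" for i
  proof -
    have "f i x = exp (- ((v i)\<^sup>2 + (v' i)\<^sup>2) / 2) * exp ((v i + v' i) * x)" for x
    proof -
      have "p - a / 2 + (q - b / 2) = - (a + b) / 2 + (p + q)" for a b p q :: real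
        by (simp add: field_simps)
      from this[of "v i * x" "(v i)\<^sup>2" "v' i * x" "(v' i)\<^sup>2"]
      have "v i * x - (v i)\<^sup>2 / 2 + (v' i * x - (v' i)\<^sup>2 / 2) =
          - ((v i)\<^sup>2 + (v' i)\<^sup>2) / 2 + (v i + v' i) * x"
        by (simp add: distrib_right)
      then show ?thesis by (simp add: f_def flip: exp_add)
    qed
    then have "(\<integral>\<^sup>+x. ennreal (f i x) \<partial>?N) =
        (\<integral>\<^sup>+x. ennreal (exp (- ((v i)\<^sup>2 + (v' i)\<^sup>2) / 2)) * ennreal (exp ((v i + v' i) * x)) \<partial>?N)"
      by (simp add: ennreal_mult')
    also have "\<dots> = ennreal (exp (- ((v i)\<^sup>2 + (v' i)\<^sup>2) / 2)) * ennreal (exp ((v i + v' i)\<^sup>2 / 2))"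
      by (subst nn_integral_cmult) (auto simp: nn_integral_exp_std_normal)
    also have "\<dots> = ennreal (exp (- ((v i)\<^sup>2 + (v' i)\<^sup>2) / 2 + (v i + v' i)\<^sup>2 / 2))"
      by (subst exp_add) (simp add: ennreal_mult')
    also have "- ((v i)\<^sup>2 + (v' i)\<^sup>2) / 2 + (v i + v' i)\<^sup>2 / 2 = v i * v' i"
      by (simp add: power2_sum field_simps)
    finally show ?thesis .
  qed
  have "has_bochner_integral ?N (f i) (exp (v i * v' i))" for i
    by (rule has_bochner_integral_nn_integral[OF _ _ _ nn]) (auto simp: f_def [abs_def])
  then have int: "integrable ?N (f i)" and val: "(\<integral>x. f i x \<partial>?N) = exp (v i * v' i)" for i
    by (auto simp: has_bochner_integral_iff)
  show "(\<integral>\<eta>. likelihood J v \<eta> * likelihood J v' \<eta> \<partial>noise_law d) = exp (\<Sum>i\<in>J. v i * v' i)"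
    unfolding eq noise_law_def
    by (subst integral_PiM_prod[OF prob_space_std_normal J int]) (simp add: val exp_sum[OF J(1)])
  show "integrable (noise_law d) (\<lambda>\<eta>. likelihood J v \<eta> * likelihood J v' \<eta>)"
    unfolding eq noise_law_def by (rule integrable_PiM_prod[OF prob_space_std_normal J int])
qed

lemma
  assumes J: "finite J" "J \<subseteq> obs_index d"
  shows integral_likelihood: "(\<integral>\<eta>. likelihood J v \<eta> \<partial>noise_law d) = 1"
    and integrable_likelihood: "integrable (noise_law d) (likelihood J v)"
proof -
  have 0: "likelihood J (\<lambda>_. 0) \<eta> = 1" for \<eta> by (simp add: likelihood_def)
  show "(\<integral>\<eta>. likelihood J v \<eta> \<partial>noise_law d) = 1" "integrable (noise_law d) (likelihood J v)"
    using integral_likelihood_mult[OF J, of v "\<lambda>_. 0"] integrable_likelihood_mult[OF J, of v "\<lambda>_. 0"]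
    by (simp_all add: 0)
qed

text \<open>For every test the integrand is at least the minimum of 1 and \<open>L\<close>, which is
  minorised by quadratic polynomials in \<open>L\<close>, so only two moments enter. The first bound
  serves when \<open>C\<close> is near 1; the second is positive for small \<open>t > 0\<close>
  however large \<open>C\<close> is.\<close>

lemma bayes_error_ge:
  fixes L \<phi> :: "'a \<Rightarrow> real"
  assumes "prob_space M" and \<phi>: "\<phi> \<in> borel_measurable M" "\<And>x. x \<in> space M \<Longrightarrow> 0 \<le> \<phi> x \<and> \<phi> x \<le> 1"
    and L: "integrable M L" "integrable M (\<lambda>x. (L x)\<^sup>2)" "\<And>x. L x \<ge> 0"
    and L1: "(\<integral>x. L x \<partial>M) = 1" and L2: "(\<integral>x. (L x)\<^sup>2 \<partial>M) \<le> C"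
  shows "c > 0 \<Longrightarrow> (\<integral>x. \<phi> x \<partial>M) + (\<integral>x. (1 - \<phi> x) * L x \<partial>M) \<ge> 1 - c / 2 - (C - 1) / (2 * c)"
    and "0 \<le> t \<Longrightarrow> t \<le> 1 \<Longrightarrow> (\<integral>x. \<phi> x \<partial>M) + (\<integral>x. (1 - \<phi> x) * L x \<partial>M) \<ge> t - t\<^sup>2 * C / 4"
proof -
  interpret prob_space M by fact
  have i1: "integrable M \<phi>"
    using \<phi> by (intro integrable_const_bound[where B = 1] AE_I2) (force simp: abs_le_iff)+
  have [measurable]: "L \<in> borel_measurable M" using L(1) by auto
  note [measurable] = \<phi>(1)
  have i2: "integrable M (\<lambda>x. (1 - \<phi> x) * L x)"
  proof (rule Bochner_Integration.integrable_bound[OF L(1)])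
    show "AE x in M. norm ((1 - \<phi> x) * L x) \<le> norm (L x)"
    proof (rule AE_I2)
      fix x assume "x \<in> space M"
      then have "\<bar>1 - \<phi> x\<bar> * \<bar>L x\<bar> \<le> 1 * \<bar>L x\<bar>" using \<phi>(2)[of x] by (intro mult_right_mono) auto
      then show "norm ((1 - \<phi> x) * L x) \<le> norm (L x)" by (simp add: abs_mult)
    qed
  qed measurable
  have sum: "(\<integral>x. \<phi> x \<partial>M) + (\<integral>x. (1 - \<phi> x) * L x \<partial>M) = (\<integral>x. \<phi> x + (1 - \<phi> x) * L x \<partial>M)"
    using i1 i2 by simp
  have ge: "\<phi> x + (1 - \<phi> x) * L x \<ge> y" if x: "x \<in> space M" and y: "y \<le> 1" "y \<le> L x" for x y
  proof -
    have "y = \<phi> x * y + (1 - \<phi> x) * y" by (simp add: algebra_simps)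
    also have "\<dots> \<le> \<phi> x * 1 + (1 - \<phi> x) * L x"
      using \<phi>(2)[OF x] y by (intro add_mono mult_left_mono) auto
    finally show ?thesis by simp
  qed
  show "(\<integral>x. \<phi> x \<partial>M) + (\<integral>x. (1 - \<phi> x) * L x \<partial>M) \<ge> 1 - c / 2 - (C - 1) / (2 * c)" if c: "c > 0"
  proof -
    let ?g = "\<lambda>x. 1 - c / 2 - ((L x)\<^sup>2 - 2 * L x + 1) / (2 * c)"
    have ig: "integrable M ?g"
      by (intro Bochner_Integration.integrable_diff Bochner_Integration.integrable_add integrable_divide_zero
          integrable_const integrable_mult_right L)
    have i3: "integrable M (\<lambda>x. (L x)\<^sup>2 - 2 * L x)"
      by (intro Bochner_Integration.integrable_diff integrable_mult_right L)
    have "(\<integral>x. (L x)\<^sup>2 - 2 * L x + 1 \<partial>M) = (\<integral>x. (L x)\<^sup>2 \<partial>M) - 1"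
      using i3 L L1 prob_space by simp
    then have "(\<integral>x. ?g x \<partial>M) = 1 - c / 2 - ((\<integral>x. (L x)\<^sup>2 \<partial>M) - 1) / (2 * c)"
      using i3 prob_space by (subst Bochner_Integration.integral_diff) auto
    also have "\<dots> \<ge> 1 - c / 2 - (C - 1) / (2 * c)"
      using L2 c by (intro diff_left_mono divide_right_mono) auto
    also have "(\<integral>x. ?g x \<partial>M) \<le> (\<integral>x. \<phi> x + (1 - \<phi> x) * L x \<partial>M)"
    proof (rule integral_mono[OF ig Bochner_Integration.integrable_add[OF i1 i2]])
      fix x assume x: "x \<in> space M"
      have y0: "((L x)\<^sup>2 - 2 * L x + 1) / (2 * c) = (L x - 1)\<^sup>2 / (2 * c)" by (simp add: power2_diff)
      \<comment> \<open>Weighted arithmetic-geometric mean inequality: the shortfall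
        \<open>1 - L x\<close> is traded for its square, and \<open>c\<close> is left free for later
        optimisation.\<close>
      have "0 \<le> (c - (1 - L x))\<^sup>2" by simp
      then have "2 * c * (1 - L x) \<le> c * c + (L x - 1)\<^sup>2" by (simp add: power2_eq_square algebra_simps)
      then have "(2 * c * (1 - L x)) / (2 * c) \<le> (c * c + (L x - 1)\<^sup>2) / (2 * c)"
        using c by (intro divide_right_mono) auto
      then have "1 - L x \<le> c / 2 + (L x - 1)\<^sup>2 / (2 * c)" using c by (simp add: add_divide_distrib)
      moreover have "0 \<le> (L x - 1)\<^sup>2 / (2 * c)" using c by simp
      ultimately show "?g x \<le> \<phi> x + (1 - \<phi> x) * L x"
        unfolding y0 using c by (intro ge[OF x]) linarith+
    qed
    finally show ?thesis unfolding sum .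
  qed
  show "(\<integral>x. \<phi> x \<partial>M) + (\<integral>x. (1 - \<phi> x) * L x \<partial>M) \<ge> t - t\<^sup>2 * C / 4" if t: "0 \<le> t" "t \<le> 1"
  proof -
    let ?g = "\<lambda>x. t * L x - t\<^sup>2 / 4 * (L x)\<^sup>2"
    have ig: "integrable M ?g"
      by (intro Bochner_Integration.integrable_diff integrable_mult_right L)
    have "t - t\<^sup>2 * C / 4 \<le> t - t\<^sup>2 / 4 * (\<integral>x. (L x)\<^sup>2 \<partial>M)"
      using mult_left_mono[OF L2, of "t\<^sup>2 / 4"] by simp
    also have "\<dots> = (\<integral>x. ?g x \<partial>M)"
      using L L1 by (subst Bochner_Integration.integral_diff) auto
    also have "\<dots> \<le> (\<integral>x. \<phi> x + (1 - \<phi> x) * L x \<partial>M)"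
    proof (rule integral_mono[OF ig Bochner_Integration.integrable_add[OF i1 i2]])
      fix x assume x: "x \<in> space M"
      \<comment> \<open>This square puts the polynomial below 1, while \<open>t \<le> 1\<close> puts
        it below \<open>L x\<close>.\<close>
      have "0 \<le> (t * L x / 2 - 1)\<^sup>2" by simp
      then have "?g x \<le> 1" by (simp add: power2_eq_square algebra_simps)
      moreover have "t * L x \<le> 1 * L x" using t L(3) by (intro mult_right_mono) auto
      then have "?g x \<le> L x" by (smt (verit) zero_le_power2 mult_nonneg_nonneg divide_nonneg_nonneg)
      ultimately show "?g x \<le> \<phi> x + (1 - \<phi> x) * L x" by (rule ge[OF x])
    qed
    finally show ?thesis unfolding sum .
  qed
qed

lemma measurable_scale_obs:
  "(\<lambda>\<eta>. \<lambda>i\<in>obs_index d. \<epsilon> * \<eta> i) \<in> measurable (obs_space d) (obs_space d)"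
  unfolding obs_space_def
  by (intro measurable_restrict borel_measurable_times measurable_obs_coordinate[unfolded obs_space_def]) auto

text \<open>The observation map is a translation by \<open>u / \<epsilon>\<close> followed by
  multiplication by \<open>\<epsilon>\<close>. The scaling is absorbed into the test, so that only
  the translation contributes a density.\<close>

lemma obs_law_density:
  assumes \<epsilon>: "\<epsilon> > 0" and J: "finite J" "J \<subseteq> obs_index d" and u: "\<And>j k. (j, k) \<notin> J \<Longrightarrow> u j k = 0"
    and g: "g \<in> borel_measurable (obs_space d)"
  shows "(\<integral>x. g x \<partial>obs_law \<epsilon> d u) =
    (\<integral>\<eta>. likelihood J (\<lambda>(j, k). u j k / \<epsilon>) \<eta> * g (\<lambda>i\<in>obs_index d. \<epsilon> * \<eta> i) \<partial>noise_law d)"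
    (is "_ = (\<integral>\<eta>. likelihood J ?v \<eta> * g (?S \<eta>) \<partial>noise_law d)")
proof -
  let ?T = "\<lambda>\<eta>. \<lambda>i\<in>obs_index d. ?v i + \<eta> i"
  have coord: "i \<in> obs_index d \<Longrightarrow> (\<lambda>\<eta>. \<eta> i) \<in> borel_measurable (obs_space d)" for i
    by (rule measurable_obs_coordinate)
  have T: "?T \<in> measurable (noise_law d) (obs_space d)"
    unfolding obs_space_def
    by (intro measurable_restrict borel_measurable_add)
       (use coord measurable_cong_sets[OF sets_noise_law refl] in \<open>auto\<close>)
  have gS: "(\<lambda>\<eta>. g (?S \<eta>)) \<in> borel_measurable (obs_space d)"
    using measurable_compose[OF measurable_scale_obs g] .
  have "(\<integral>x. g x \<partial>obs_law \<epsilon> d u) = (\<integral>\<eta>. g (?S (?T \<eta>)) \<partial>noise_law d)"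
    unfolding integral_obs_law[OF g]
  proof (intro Bochner_Integration.integral_cong refl arg_cong[where f = g] ext)
    fix \<eta> i
    show "(\<lambda>(j, k)\<in>obs_index d. u j k + \<epsilon> * \<eta> (j, k)) i = ?S (?T \<eta>) i"
      using \<epsilon> by (cases i) (simp add: distrib_left)
  qed
  also have "\<dots> = (\<integral>\<eta>. g (?S \<eta>) \<partial>distr (noise_law d) (obs_space d) ?T)"
    by (rule integral_distr[OF T gS, symmetric])
  also have "distr (noise_law d) (obs_space d) ?T = density (noise_law d) (\<lambda>\<eta>. ennreal (likelihood J ?v \<eta>))"
    by (rule distr_shift_noise_law[OF J]) (auto simp: u)
  also have "(\<integral>\<eta>. g (?S \<eta>) \<partial>\<dots>) = (\<integral>\<eta>. likelihood J ?v \<eta> * g (?S \<eta>) \<partial>noise_law d)"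
  proof (subst integral_density)
    show "likelihood J ?v \<in> borel_measurable (noise_law d)" by (rule measurable_likelihood[OF J(2)])
    show "(\<lambda>\<eta>. g (?S \<eta>)) \<in> borel_measurable (noise_law d)"
      using gS measurable_cong_sets[OF sets_noise_law refl] by blast
  qed (auto simp: likelihood_nonneg)
  finally show ?thesis .
qed

text \<open>The worst case over \<open>H\<close> dominates the average over the uniform distribution
  on \<open>\<Omega>\<close>, and \<open>L\<close> is the likelihood ratio of that mixture. The
  hypothesis on \<open>C\<close> bounds its second moment under the null law.\<close>

lemma
  fixes u :: "'w \<Rightarrow> nat \<Rightarrow> int \<Rightarrow> real"
  assumes \<epsilon>: "\<epsilon> > 0" and J: "finite J" "J \<subseteq> obs_index d" and \<Omega>: "finite \<Omega>" "\<Omega> \<noteq> {}"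
    and u: "\<And>\<omega> j k. \<omega> \<in> \<Omega> \<Longrightarrow> (j, k) \<notin> J \<Longrightarrow> u \<omega> j k = 0"
    and H: "\<And>\<omega>. \<omega> \<in> \<Omega> \<Longrightarrow> u \<omega> \<in> H"
    and C: "(\<Sum>\<omega>\<in>\<Omega>. \<Sum>\<omega>'\<in>\<Omega>. exp (\<Sum>(j, k)\<in>J. u \<omega> j k * u \<omega>' j k / \<epsilon>\<^sup>2)) \<le> C * (real (card \<Omega>))\<^sup>2"
  shows minimax_error_ge_near_one: "c > 0 \<Longrightarrow> minimax_error \<epsilon> d H \<ge> 1 - c / 2 - (C - 1) / (2 * c)"
    and minimax_error_ge_pos: "0 \<le> t \<Longrightarrow> t \<le> 1 \<Longrightarrow> minimax_error \<epsilon> d H \<ge> t - t\<^sup>2 * C / 4"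
proof -
  interpret P: prob_space "noise_law d" by (rule prob_space_noise_law)
  define N where "N = real (card \<Omega>)"
  have N: "N > 0" using \<Omega> by (simp add: N_def card_gt_0_iff)
  define v where "v \<omega> = (\<lambda>(j, k). u \<omega> j k / \<epsilon>)" for \<omega>
  define L where "L \<eta> = (\<Sum>\<omega>\<in>\<Omega>. likelihood J (v \<omega>) \<eta>) / N" for \<eta>
  have L0: "L \<eta> \<ge> 0" for \<eta> using N by (simp add: L_def sum_nonneg likelihood_nonneg)
  have iL: "integrable (noise_law d) L"
    unfolding L_def [abs_def]
    by (intro integrable_divide_zero Bochner_Integration.integrable_sum integrable_likelihood J)
  have L1: "(\<integral>\<eta>. L \<eta> \<partial>noise_law d) = 1"
    unfolding L_def using N
    by (simp add: Bochner_Integration.integral_sum integrable_likelihood[OF J] integral_likelihood[OF J] N_def)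
  have sq: "(L \<eta>)\<^sup>2 = (\<Sum>\<omega>\<in>\<Omega>. \<Sum>\<omega>'\<in>\<Omega>. likelihood J (v \<omega>) \<eta> * likelihood J (v \<omega>') \<eta>) / N\<^sup>2" for \<eta>
    by (simp add: L_def power_divide power2_eq_square[of "sum _ _"] sum_product)
  have iL2: "integrable (noise_law d) (\<lambda>\<eta>. (L \<eta>)\<^sup>2)"
    unfolding sq
    by (intro integrable_divide_zero Bochner_Integration.integrable_sum integrable_likelihood_mult J)
  have "(\<integral>\<eta>. (L \<eta>)\<^sup>2 \<partial>noise_law d) = (\<Sum>\<omega>\<in>\<Omega>. \<Sum>\<omega>'\<in>\<Omega>. exp (\<Sum>i\<in>J. v \<omega> i * v \<omega>' i)) / N\<^sup>2"
    unfolding sq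
    by (simp add: Bochner_Integration.integral_sum Bochner_Integration.integrable_sum
        integrable_likelihood_mult[OF J] integral_likelihood_mult[OF J])
  also have "\<dots> = (\<Sum>\<omega>\<in>\<Omega>. \<Sum>\<omega>'\<in>\<Omega>. exp (\<Sum>(j, k)\<in>J. u \<omega> j k * u \<omega>' j k / \<epsilon>\<^sup>2)) / N\<^sup>2"
    by (simp add: v_def split_beta power2_eq_square[of \<epsilon>])
  also have "\<dots> \<le> C"
    using C N by (simp add: divide_le_eq N_def)
  finally have L2: "(\<integral>\<eta>. (L \<eta>)\<^sup>2 \<partial>noise_law d) \<le> C" .
  have ne: "{\<psi>. is_test d \<psi>} \<noteq> {}"
  proof -
    have "is_test d (\<lambda>_. 0)" by (simp add: is_test_def)
    then show ?thesis by blast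
  qed
  have key: "\<exists>\<phi>. \<phi> \<in> borel_measurable (noise_law d) \<and> (\<forall>x\<in>space (noise_law d). 0 \<le> \<phi> x \<and> \<phi> x \<le> 1) \<and>
      type_I_error \<epsilon> d \<psi> + type_II_error \<epsilon> d \<psi> H \<ge>
        (\<integral>\<eta>. \<phi> \<eta> \<partial>noise_law d) + (\<integral>\<eta>. (1 - \<phi> \<eta>) * L \<eta> \<partial>noise_law d)"
    if \<psi>: "is_test d \<psi>" for \<psi>
  proof -
    let ?S = "\<lambda>\<eta>. \<lambda>i\<in>obs_index d. \<epsilon> * \<eta> i"
    have m\<psi>: "\<psi> \<in> borel_measurable (obs_space d)" and b: "\<And>x. x \<in> space (obs_space d) \<Longrightarrow> 0 \<le> \<psi> x \<and> \<psi> x \<le> 1"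
      using \<psi> by (auto simp: is_test_def)
    define \<phi> where "\<phi> \<eta> = \<psi> (?S \<eta>)" for \<eta>
    have S: "?S \<in> measurable (noise_law d) (obs_space d)"
      using measurable_scale_obs measurable_cong_sets[OF sets_noise_law refl] by blast
    have m: "\<phi> \<in> borel_measurable (noise_law d)"
      unfolding \<phi>_def [abs_def] by (rule measurable_compose[OF S m\<psi>])
    have rng: "0 \<le> \<phi> x \<and> \<phi> x \<le> 1" for x
      unfolding \<phi>_def by (rule b) (simp add: space_obs_space)
    \<comment> \<open>The null parameter has empty support and likelihood 1, so the type I error
      takes the same rescaled form.\<close>
    have lik1: "likelihood {} w \<eta> = 1" for w \<eta> by (simp add: likelihood_def)
    have I: "type_I_error \<epsilon> d \<psi> = (\<integral>\<eta>. \<phi> \<eta> \<partial>noise_law d)"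
      unfolding type_I_error_def \<phi>_def
      using obs_law_density[OF \<epsilon>, of "{}" d "\<lambda>_ _. 0", OF _ _ _ m\<psi>] by (simp add: lik1)
    have ints: "integrable (noise_law d) (\<lambda>\<eta>. likelihood J (v \<omega>) \<eta> * (1 - \<phi> \<eta>))" for \<omega>
    proof (rule Bochner_Integration.integrable_bound[OF integrable_likelihood[OF J]])
      show "(\<lambda>\<eta>. likelihood J (v \<omega>) \<eta> * (1 - \<phi> \<eta>)) \<in> borel_measurable (noise_law d)"
        by (intro borel_measurable_times borel_measurable_diff borel_measurable_const m measurable_likelihood J)
      show "AE \<eta> in noise_law d. norm (likelihood J (v \<omega>) \<eta> * (1 - \<phi> \<eta>)) \<le> norm (likelihood J (v \<omega>) \<eta>)"
      proof (rule AE_I2)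
        fix \<eta>
        have "likelihood J (v \<omega>) \<eta> * (1 - \<phi> \<eta>) \<le> likelihood J (v \<omega>) \<eta> * 1"
          using rng[of \<eta>] by (intro mult_left_mono likelihood_nonneg) auto
        then show "norm (likelihood J (v \<omega>) \<eta> * (1 - \<phi> \<eta>)) \<le> norm (likelihood J (v \<omega>) \<eta>)"
          using rng[of \<eta>] by (simp add: abs_mult likelihood_nonneg)
      qed
    qed
    have II: "(\<integral>\<eta>. likelihood J (v \<omega>) \<eta> * (1 - \<phi> \<eta>) \<partial>noise_law d) \<le> type_II_error \<epsilon> d \<psi> H"
      if \<omega>: "\<omega> \<in> \<Omega>" for \<omega>
    proof -
      have "(\<integral>x. 1 - \<psi> x \<partial>obs_law \<epsilon> d (u \<omega>)) = (\<integral>\<eta>. likelihood J (v \<omega>) \<eta> * (1 - \<phi> \<eta>) \<partial>noise_law d)"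
        unfolding \<phi>_def v_def
        by (rule obs_law_density[OF \<epsilon> J u[OF \<omega>]]) (use m\<psi> in measurable)
      then show ?thesis using type_II_error_ge[OF \<psi> H[OF \<omega>], of \<epsilon>] by simp
    qed
    have "(\<integral>\<eta>. (1 - \<phi> \<eta>) * L \<eta> \<partial>noise_law d) =
        (\<integral>\<eta>. (\<Sum>\<omega>\<in>\<Omega>. likelihood J (v \<omega>) \<eta> * (1 - \<phi> \<eta>)) / N \<partial>noise_law d)"
      by (simp add: L_def sum_distrib_left mult.commute)
    also have "\<dots> = (\<Sum>\<omega>\<in>\<Omega>. \<integral>\<eta>. likelihood J (v \<omega>) \<eta> * (1 - \<phi> \<eta>) \<partial>noise_law d) / N"
      by (simp add: Bochner_Integration.integral_sum ints)
    also have "\<dots> \<le> (\<Sum>\<omega>\<in>\<Omega>. type_II_error \<epsilon> d \<psi> H) / N"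
      using N by (intro divide_right_mono sum_mono II) auto
    also have "\<dots> = type_II_error \<epsilon> d \<psi> H" using N by (simp add: N_def)
    finally show ?thesis using m rng I by (intro exI[of _ \<phi>]) auto
  qed
  note bayes = bayes_error_ge[OF prob_space_noise_law _ _ iL iL2 L0 L1 L2]
  show "minimax_error \<epsilon> d H \<ge> 1 - c / 2 - (C - 1) / (2 * c)" if "c > 0"
    unfolding minimax_error_def
  proof (rule cINF_greatest[OF ne])
    fix \<psi> assume "\<psi> \<in> {\<psi>. is_test d \<psi>}"
    then obtain \<phi> where "\<phi> \<in> borel_measurable (noise_law d)" "\<And>x. x \<in> space (noise_law d) \<Longrightarrow> 0 \<le> \<phi> x \<and> \<phi> x \<le> 1"
      and le: "type_I_error \<epsilon> d \<psi> + type_II_error \<epsilon> d \<psi> H \<ge>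
        (\<integral>\<eta>. \<phi> \<eta> \<partial>noise_law d) + (\<integral>\<eta>. (1 - \<phi> \<eta>) * L \<eta> \<partial>noise_law d)"
      using key by blast
    from bayes(1)[OF this(1,2) that] le
    show "1 - c / 2 - (C - 1) / (2 * c) \<le> type_I_error \<epsilon> d \<psi> + type_II_error \<epsilon> d \<psi> H" by linarith
  qed
  show "minimax_error \<epsilon> d H \<ge> t - t\<^sup>2 * C / 4" if "0 \<le> t" "t \<le> 1"
    unfolding minimax_error_def
  proof (rule cINF_greatest[OF ne])
    fix \<psi> assume "\<psi> \<in> {\<psi>. is_test d \<psi>}"
    then obtain \<phi> where "\<phi> \<in> borel_measurable (noise_law d)" "\<And>x. x \<in> space (noise_law d) \<Longrightarrow> 0 \<le> \<phi> x \<and> \<phi> x \<le> 1"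
      and le: "type_I_error \<epsilon> d \<psi> + type_II_error \<epsilon> d \<psi> H \<ge>
        (\<integral>\<eta>. \<phi> \<eta> \<partial>noise_law d) + (\<integral>\<eta>. (1 - \<phi> \<eta>) * L \<eta> \<partial>noise_law d)"
      using key by blast
    from bayes(2)[OF this(1,2) that] le
    show "t - t\<^sup>2 * C / 4 \<le> type_I_error \<epsilon> d \<psi> + type_II_error \<epsilon> d \<psi> H" by linarith
  qed
qed

text \<open>The test that always rejects errs only under the null hypothesis.\<close>

lemma minimax_error_le_1:
  assumes "H \<noteq> {}" shows "minimax_error \<epsilon> d H \<le> 1"
proof -
  interpret P: prob_space "obs_law \<epsilon> d u" for u by (rule prob_space_obs_law)
  have t: "is_test d (\<lambda>_. 1)" by (simp add: is_test_def)
  have "bdd_below ((\<lambda>\<psi>. type_I_error \<epsilon> d \<psi> + type_II_error \<epsilon> d \<psi> H) ` {\<psi>. is_test d \<psi>})"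
  proof (rule bdd_belowI2[where m = 0])
    fix \<psi> assume "\<psi> \<in> {\<psi>. is_test d \<psi>}"
    then have \<psi>: "is_test d \<psi>" by simp
    obtain u where "u \<in> H" using assms by blast
    from type_II_error_ge[OF \<psi> this, of \<epsilon>] integral_test_bounds(1)[OF \<psi>, of \<epsilon> u]
    show "0 \<le> type_I_error \<epsilon> d \<psi> + type_II_error \<epsilon> d \<psi> H"
      using integral_test_bounds(3)[OF \<psi>, of \<epsilon> "\<lambda>_ _. 0"] by (simp add: type_I_error_def)
  qed
  then have "minimax_error \<epsilon> d H \<le> type_I_error \<epsilon> d (\<lambda>_. 1) + type_II_error \<epsilon> d (\<lambda>_. 1) H"
    unfolding minimax_error_def using t by (intro cINF_lower) auto
  also have "type_I_error \<epsilon> d (\<lambda>_. 1) = 1" by (simp add: type_I_error_def P.prob_space)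
  also have "type_II_error \<epsilon> d (\<lambda>_. 1) H = 0" using assms by (simp add: type_II_error_def)
  finally show ?thesis by simp
qed

section \<open>The block prior and the second moment of its likelihood ratio\<close>

lemma cosh_le_exp_square: "cosh x \<le> exp (x\<^sup>2 / 2)" for x :: real
proof -
  \<comment> \<open>\<open>t - tanh t\<close> is the derivative of
    \<open>t\<^sup>2 / 2 - ln (cosh t)\<close>, so its sign decides the main inequality; its own
    derivative is the square of \<open>tanh\<close>.\<close>
  have tanh_le: "tanh t \<le> t" if "t \<ge> 0" for t :: real
  proof -
    have "0 - tanh 0 \<le> t - tanh t"
    proof (rule DERIV_nonneg_imp_nondecreasing[OF that])
      fix s :: real
      have "((\<lambda>t. t - tanh t) has_real_derivative (1 - (1 - (tanh s)\<^sup>2))) (at s)"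
        by (auto intro!: derivative_eq_intros)
      then show "\<exists>y. ((\<lambda>t. t - tanh t) has_real_derivative y) (at s) \<and> 0 \<le> y"
        by (intro exI conjI) auto
    qed
    then show ?thesis by simp
  qed
  have pos: "cosh t \<le> exp (t\<^sup>2 / 2)" if "t \<ge> 0" for t :: real
  proof -
    have "0\<^sup>2 / 2 - ln (cosh 0) \<le> t\<^sup>2 / 2 - ln (cosh t)"
    proof (rule DERIV_nonneg_imp_nondecreasing[OF that])
      fix s :: real assume "0 \<le> s"
      have "((\<lambda>t. t\<^sup>2 / 2 - ln (cosh t)) has_real_derivative (s - tanh s)) (at s)"
        by (auto intro!: derivative_eq_intros simp: tanh_def cosh_real_pos)
      then show "\<exists>y. ((\<lambda>t. t\<^sup>2 / 2 - ln (cosh t)) has_real_derivative y) (at s) \<and> 0 \<le> y"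
        using tanh_le[OF \<open>0 \<le> s\<close>] by (intro exI conjI) auto
    qed
    then have "ln (cosh t) \<le> t\<^sup>2 / 2" by simp
    then show ?thesis by (metis cosh_real_pos exp_le_cancel_iff exp_ln)
  qed
  show ?thesis using pos[of "\<bar>x\<bar>"] by (simp add: cosh_real_abs)
qed

text \<open>Independence for two draws from a product distribution: the double sum factors over the
  blocks.\<close>

lemma sum_sum_prod_PiE:
  fixes F :: "'a \<Rightarrow> 'b \<Rightarrow> 'b \<Rightarrow> real"
  assumes "finite A" "finite B"
  shows "(\<Sum>f\<in>PiE A (\<lambda>_. B). \<Sum>g\<in>PiE A (\<lambda>_. B). \<Prod>i\<in>A. F i (f i) (g i)) = (\<Prod>i\<in>A. \<Sum>x\<in>B. \<Sum>y\<in>B. F i x y)"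
proof -
  have "(\<Sum>f\<in>PiE A (\<lambda>_. B). \<Sum>g\<in>PiE A (\<lambda>_. B). \<Prod>i\<in>A. F i (f i) (g i)) =
      (\<Sum>f\<in>PiE A (\<lambda>_. B). \<Prod>i\<in>A. \<Sum>y\<in>B. F i (f i) y)"
    by (intro sum.cong refl prod_sum_PiE[symmetric] assms)
  also have "\<dots> = (\<Prod>i\<in>A. \<Sum>x\<in>B. \<Sum>y\<in>B. F i x y)"
    by (intro prod_sum_PiE[symmetric] assms)
  finally show ?thesis .
qed

text \<open>Components are numbered from 1 and block positions from 0, whence \<open>j - 1\<close>.
  Indices from \<open>K * B\<close> on, left over when the blocks do not fill \<open>{1..d}\<close>,
  contribute nothing.\<close>

lemma sum_blocks:
  fixes h :: "nat \<Rightarrow> real"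
  assumes "K * B \<le> d" and "\<And>l. l \<ge> K * B \<Longrightarrow> h l = 0"
  shows "(\<Sum>j=1..d. h (j - 1)) = (\<Sum>m<K. \<Sum>x<B. h (m * B + x))"
proof -
  have "(\<Sum>j=1..d. h (j - 1)) = (\<Sum>l<d. h l)"
    by (simp add: sum.atLeast1_atMost_eq)
  also have "\<dots> = (\<Sum>l<K * B. h l)"
    using assms by (intro sum.mono_neutral_right) auto
  also have "\<dots> = (\<Sum>m<K. sum h {m * B..<m * B + B})" by (rule sum.nat_group[symmetric])
  also have "\<dots> = (\<Sum>m<K. \<Sum>x<B. h (m * B + x))"
  proof (rule sum.cong[OF refl])
    fix m
    have "sum h {m * B..<m * B + B} = sum h {0 + m * B..<B + m * B}" by (simp add: add.commute)
    also have "\<dots> = (\<Sum>x\<in>{0..<B}. h (x + m * B))" by (rule sum.shift_bounds_nat_ivl)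
    finally show "sum h {m * B..<m * B + B} = (\<Sum>x<B. h (m * B + x))"
      by (simp add: add.commute atLeast0LessThan)
  qed
  finally show ?thesis .
qed

text \<open>The prior splits \<open>{1..d}\<close> into \<open>K\<close> blocks of length \<open>B\<close>, activates one uniformly chosen index in each
  block and gives the coordinates of the active component independent random signs. An element of
  the support assigns to each block the position of the active index and the sign pattern.\<close>

locale block_prior =
  fixes K B d :: nat and A :: "int set" and \<theta> :: "int \<Rightarrow> real" and \<epsilon> :: real
  assumes B_pos: "B \<ge> 1" and KB: "K * B \<le> d" and fin_A: "finite A"
    and support: "\<And>k. k \<notin> A \<Longrightarrow> \<theta> k = 0" and eps: "\<epsilon> > 0"
begin

definition signs :: "(int \<Rightarrow> real) set" where
  "signs = PiE A (\<lambda>_. {-1, 1})"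

definition choices :: "(nat \<times> (int \<Rightarrow> real)) set" where
  "choices = {..<B} \<times> signs"

definition configs :: "(nat \<Rightarrow> nat \<times> (int \<Rightarrow> real)) set" where
  "configs = PiE {..<K} (\<lambda>_. choices)"

text \<open>\<open>l\<close> is a zero-based index: it lies in block \<open>l div B\<close> at
  position \<open>l mod B\<close>.\<close>

definition active :: "(nat \<Rightarrow> nat \<times> (int \<Rightarrow> real)) \<Rightarrow> nat \<Rightarrow> real" where
  "active \<omega> l = (if l < K * B \<and> fst (\<omega> (l div B)) = l mod B then 1 else 0)"

text \<open>Indices outside the blocks keep \<open>\<theta>\<close> because
  \<open>sparse_class\<close> asks for a member of the Sobolev class at every index, active or
  not.\<close>

definition signed :: "(nat \<Rightarrow> nat \<times> (int \<Rightarrow> real)) \<Rightarrow> nat \<Rightarrow> int \<Rightarrow> real" where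
  "signed \<omega> l k = (if l < K * B then snd (\<omega> (l div B)) k * \<theta> k else \<theta> k)"

definition signal :: "(nat \<Rightarrow> nat \<times> (int \<Rightarrow> real)) \<Rightarrow> nat \<Rightarrow> int \<Rightarrow> real" where
  "signal \<omega> j k = (if j \<in> {1..d} then active \<omega> (j - 1) * signed \<omega> (j - 1) k else 0)"

text \<open>Contribution of one block to the inner product of two signals in units of the noise
  level; it vanishes unless both activate the same position.\<close>

definition overlap :: "nat \<times> (int \<Rightarrow> real) \<Rightarrow> nat \<times> (int \<Rightarrow> real) \<Rightarrow> real" where
  "overlap c c' = (if fst c = fst c' then \<Sum>k\<in>A. snd c k * snd c' k * ((\<theta> k)\<^sup>2 / \<epsilon>\<^sup>2) else 0)"

lemma finite_signs: "finite signs" unfolding signs_def by (intro finite_PiE fin_A) auto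

lemma finite_choices: "finite choices" using finite_signs by (simp add: choices_def)

lemma card_signs: "card signs = 2 ^ card A"
  unfolding signs_def by (subst card_PiE[OF fin_A]) (simp add: card_insert_if numeral_2_eq_2)

lemma configsD:
  assumes "\<omega> \<in> configs" "m < K"
  shows "fst (\<omega> m) < B" "\<And>k. k \<in> A \<Longrightarrow> (snd (\<omega> m) k)\<^sup>2 = 1"
proof -
  have "\<omega> m \<in> choices" using assms by (auto simp: configs_def PiE_mem)
  then have 1: "fst (\<omega> m) < B" and 2: "snd (\<omega> m) \<in> signs" by (auto simp: choices_def)
  show "fst (\<omega> m) < B" by (rule 1)
  fix k assume "k \<in> A"
  then have "snd (\<omega> m) k \<in> {-1, 1}" using 2 PiE_mem unfolding signs_def by fast
  then show "(snd (\<omega> m) k)\<^sup>2 = 1" by auto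
qed

lemma block_index: "m < K \<Longrightarrow> x < B \<Longrightarrow> m * B + x < K * B"
proof -
  assume "m < K" "x < B"
  then have "m * B + x < Suc m * B" by simp
  also have "\<dots> \<le> K * B" using \<open>m < K\<close> by (intro mult_right_mono) auto
  finally show ?thesis .
qed

lemma active_block: "m < K \<Longrightarrow> x < B \<Longrightarrow> active \<omega> (m * B + x) = (if x = fst (\<omega> m) then 1 else 0)"
  using block_index[of m x] by (auto simp: active_def)

lemma signed_square:
  assumes "\<omega> \<in> configs" shows "(signed \<omega> l k)\<^sup>2 = (\<theta> k)\<^sup>2"
proof (cases "l < K * B \<and> k \<in> A")
  case True
  then have "l div B < K" using B_pos by (simp add: less_mult_imp_div_less)
  then show ?thesis using configsD(2)[OF assms] True by (simp add: signed_def power_mult_distrib)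
next
  case False
  then show ?thesis using support[of k] by (auto simp: signed_def)
qed

text \<open>The Sobolev class sees a sequence only through its squares, so sign changes are
  harmless; each block contributes exactly one active index.\<close>

lemma signal_in_sparse_class:
  assumes \<omega>: "\<omega> \<in> configs" and \<theta>: "\<theta> \<in> sobolev_class \<tau> r" and K: "K = num_active d b"
  shows "signal \<omega> \<in> sparse_class d \<tau> r b"
proof -
  have "(\<Sum>j=1..d. active \<omega> (j - 1)) = (\<Sum>m<K. \<Sum>x<B. active \<omega> (m * B + x))"
    by (rule sum_blocks[OF KB]) (simp add: active_def)
  also have "\<dots> = (\<Sum>m<K. \<Sum>x<B. if x = fst (\<omega> m) then 1 else 0)"
    by (intro sum.cong) (auto simp: active_block)
  also have "\<dots> = (\<Sum>m<K. 1)"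
    using configsD(1)[OF \<omega>] by (intro sum.cong) auto
  finally have sum: "(\<Sum>j=1..d. active \<omega> (j - 1)) = real (num_active d b)" by (simp add: K)
  have "signed \<omega> l \<in> sobolev_class \<tau> r" for l
    using \<theta> by (simp add: sobolev_class_def ell2_def signed_square[OF \<omega>])
  with sum show ?thesis
    unfolding sparse_class_def signal_def [abs_def]
    by (intro CollectI exI[of _ "\<lambda>j. active \<omega> (j - 1)"] exI[of _ "\<lambda>j. signed \<omega> (j - 1)"])
       (auto simp: active_def)
qed

lemma signal_support: "(j, k) \<notin> {1..d} \<times> A \<Longrightarrow> signal \<omega> j k = 0"
  using support[of k] by (auto simp: signal_def signed_def)

lemma signal_inner:
  assumes \<omega>: "\<omega> \<in> configs" "\<omega>' \<in> configs"
  shows "(\<Sum>(j, k)\<in>{1..d} \<times> A. signal \<omega> j k * signal \<omega>' j k / \<epsilon>\<^sup>2) = (\<Sum>m<K. overlap (\<omega> m) (\<omega>' m))"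
proof -
  define h where "h l = active \<omega> l * active \<omega>' l * (\<Sum>k\<in>A. signed \<omega> l k * signed \<omega>' l k / \<epsilon>\<^sup>2)" for l
  have "(\<Sum>(j, k)\<in>{1..d} \<times> A. signal \<omega> j k * signal \<omega>' j k / \<epsilon>\<^sup>2) =
      (\<Sum>j=1..d. \<Sum>k\<in>A. signal \<omega> j k * signal \<omega>' j k / \<epsilon>\<^sup>2)"
    by (rule sum.cartesian_product[symmetric])
  also have "\<dots> = (\<Sum>j=1..d. h (j - 1))"
    by (intro sum.cong) (auto simp: h_def signal_def sum_distrib_left mult_ac intro!: sum.cong)
  also have "\<dots> = (\<Sum>m<K. \<Sum>x<B. h (m * B + x))"
    by (rule sum_blocks[OF KB]) (simp add: h_def active_def)
  also have "\<dots> = (\<Sum>m<K. overlap (\<omega> m) (\<omega>' m))"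
  proof (rule sum.cong[OF refl])
    fix m assume "m \<in> {..<K}"
    then have m: "m < K" by simp
    have "(\<Sum>x<B. h (m * B + x)) = (\<Sum>x<B. if x = fst (\<omega> m) then overlap (\<omega> m) (\<omega>' m) else 0)"
    proof (rule sum.cong[OF refl])
      fix x assume "x \<in> {..<B}"
      then have x: "x < B" by simp
      have s: "signed w (m * B + x) k = snd (w m) k * \<theta> k" for w k
        using block_index[OF m x] x by (simp add: signed_def)
      show "h (m * B + x) = (if x = fst (\<omega> m) then overlap (\<omega> m) (\<omega>' m) else 0)"
        unfolding h_def active_block[OF m x] s overlap_def
        by (auto simp: power2_eq_square mult_ac intro!: sum.cong)
    qed
    also have "\<dots> = overlap (\<omega> m) (\<omega>' m)" using configsD(1)[OF \<omega>(1) m] by simp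
    finally show "(\<Sum>x<B. h (m * B + x)) = overlap (\<omega> m) (\<omega>' m)" .
  qed
  finally show ?thesis .
qed

text \<open>The value of \<open>(extremal_a \<epsilon> \<tau> r)\<^sup>2\<close> with the infimum
  replaced by the fourth-power sum of the given \<open>\<theta>\<close>.\<close>

definition energy :: real where "energy = (\<Sum>k\<in>A. \<theta> k ^ 4) / (2 * \<epsilon> ^ 4)"

text \<open>Two independent uniform choices share a position with probability \<open>1 / B\<close>.
  If they do, averaging over the signs gives the product of the \<open>cosh (q k)\<close>, at most
  \<open>exp energy\<close>; otherwise the exponential is 1.\<close>

lemma sum_exp_overlap:
  "(\<Sum>c\<in>choices. \<Sum>c'\<in>choices. exp (overlap c c')) \<le> (real (card choices))\<^sup>2 * (1 + (exp energy - 1) / real B)"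
proof -
  define q where "q k = (\<theta> k)\<^sup>2 / \<epsilon>\<^sup>2" for k
  define P where "P = (\<Sum>s\<in>signs. \<Sum>s'\<in>signs. exp (\<Sum>k\<in>A. s k * s' k * q k))"
  define T where "T = (4 :: real) ^ card A"
  have T: "(\<Sum>s\<in>signs. \<Sum>s'\<in>signs. 1 :: real) = T"
    by (simp add: card_signs T_def flip: power_mult_distrib)
  have "P = (\<Sum>s\<in>signs. \<Sum>s'\<in>signs. \<Prod>k\<in>A. exp (s k * s' k * q k))"
    by (simp add: P_def exp_sum[OF fin_A])
  also have "\<dots> = (\<Prod>k\<in>A. \<Sum>a\<in>{-1, 1}. \<Sum>b\<in>{-1, 1}. exp (a * b * q k))"
    unfolding signs_def by (rule sum_sum_prod_PiE[OF fin_A]) simp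
  \<comment> \<open>Two of the four sign pairs have product 1 and two have product -1.\<close>
  also have "\<dots> = (\<Prod>k\<in>A. 4 * cosh (q k))"
    by (intro prod.cong) (auto simp: cosh_def)
  also have "\<dots> \<le> (\<Prod>k\<in>A. 4 * exp ((q k)\<^sup>2 / 2))"
    by (intro prod_mono conjI mult_left_mono cosh_le_exp_square) (auto simp: cosh_real_nonneg)
  also have "\<dots> = T * exp (\<Sum>k\<in>A. (q k)\<^sup>2 / 2)"
    by (simp add: prod.distrib T_def exp_sum[OF fin_A])
  also have "(\<Sum>k\<in>A. (q k)\<^sup>2 / 2) = energy"
    by (simp add: energy_def q_def sum_divide_distrib power_divide mult.commute flip: power_mult)
  finally have P: "P \<le> T * exp energy" .
  have "(\<Sum>c\<in>choices. \<Sum>c'\<in>choices. exp (overlap c c')) =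
      (\<Sum>x<B. \<Sum>s\<in>signs. \<Sum>y<B. \<Sum>s'\<in>signs. exp (overlap (x, s) (y, s')))"
    by (simp add: choices_def sum.cartesian_product')
  also have "\<dots> = (\<Sum>x<B. \<Sum>y<B. \<Sum>s\<in>signs. \<Sum>s'\<in>signs. exp (overlap (x, s) (y, s')))"
    by (intro sum.cong refl sum.swap)
  also have "\<dots> = (\<Sum>x<B. \<Sum>y<B. if y = x then P else T)"
    by (intro sum.cong refl) (auto simp: overlap_def P_def q_def T[symmetric])
  also have "\<dots> = (\<Sum>x<B. real (B - 1) * T + P)"
  proof (rule sum.cong[OF refl])
    fix x assume "x \<in> {..<B}"
    then have "(\<Sum>y<B. if y = x then P else T) = P + (\<Sum>y\<in>{..<B}-{x}. T)"
      by (subst sum.remove[of _ x]) (auto intro!: sum.cong)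
    then show "(\<Sum>y<B. if y = x then P else T) = real (B - 1) * T + P"
      using \<open>x \<in> {..<B}\<close> by simp
  qed
  also have "\<dots> \<le> real B * (real (B - 1) * T + T * exp energy)"
    unfolding sum_constant card_lessThan by (intro mult_left_mono add_left_mono P) auto
  also have "\<dots> = (real B)\<^sup>2 * T * (1 + (exp energy - 1) / real B)"
    using B_pos by (simp add: of_nat_diff power2_eq_square field_simps)
  also have "(real B)\<^sup>2 * T = (real (card choices))\<^sup>2"
    by (simp add: choices_def card_cartesian_product card_signs T_def power_mult_distrib
        flip: power_mult) (simp add: power_mult power2_eq_square flip: power_mult_distrib)
  finally show ?thesis .
qed

text \<open>The average over pairs of configurations is a \<open>K\<close>-th power of the one-block
  average, made exponential by \<open>1 + x \<le> exp x\<close>.\<close>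

lemma sum_exp_inner_le:
  "(\<Sum>\<omega>\<in>configs. \<Sum>\<omega>'\<in>configs. exp (\<Sum>(j, k)\<in>{1..d} \<times> A. signal \<omega> j k * signal \<omega>' j k / \<epsilon>\<^sup>2))
    \<le> exp (real K * (exp energy - 1) / real B) * (real (card configs))\<^sup>2"
proof -
  have "(\<Sum>\<omega>\<in>configs. \<Sum>\<omega>'\<in>configs. exp (\<Sum>(j, k)\<in>{1..d} \<times> A. signal \<omega> j k * signal \<omega>' j k / \<epsilon>\<^sup>2)) =
      (\<Sum>\<omega>\<in>configs. \<Sum>\<omega>'\<in>configs. \<Prod>m<K. exp (overlap (\<omega> m) (\<omega>' m)))"
    by (intro sum.cong refl) (simp only: signal_inner, simp add: exp_sum)
  also have "\<dots> = (\<Prod>m<K. \<Sum>c\<in>choices. \<Sum>c'\<in>choices. exp (overlap c c'))"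
    unfolding configs_def by (rule sum_sum_prod_PiE) (auto intro: finite_choices)
  also have "\<dots> \<le> (\<Prod>m<K. (real (card choices))\<^sup>2 * (1 + (exp energy - 1) / real B))"
    by (intro prod_mono conjI sum_exp_overlap sum_nonneg) auto
  also have "\<dots> = (real (card configs))\<^sup>2 * (1 + (exp energy - 1) / real B) ^ K"
    by (simp add: configs_def card_PiE power_mult_distrib mult.commute flip: power_mult)
  also have "\<dots> \<le> (real (card configs))\<^sup>2 * exp ((exp energy - 1) / real B) ^ K"
  proof (intro mult_left_mono power_mono)
    have "0 \<le> exp energy - 1" using eps by (simp add: energy_def sum_nonneg)
    then show "0 \<le> 1 + (exp energy - 1) / real B" by simp
  qed (auto intro: exp_ge_add_one_self)
  also have "\<dots> = exp (real K * (exp energy - 1) / real B) * (real (card configs))\<^sup>2"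
    by (simp add: exp_of_nat_mult[symmetric] mult.commute)
  finally show ?thesis .
qed

lemma configs_ne: "finite configs" "configs \<noteq> {}"
proof -
  have "signs \<noteq> {}" unfolding signs_def by (simp add: PiE_eq_empty_iff)
  then show "configs \<noteq> {}" "finite configs"
    using B_pos finite_choices
    by (auto simp: configs_def choices_def PiE_eq_empty_iff lessThan_empty_iff intro!: finite_PiE)
qed

end

section \<open>Lower bounds at a fixed noise level and dimension\<close>

lemma
  fixes \<epsilon> \<tau> r b :: real
  assumes \<epsilon>: "\<epsilon> > 0" and d: "d \<ge> 1" and b: "0 \<le> b" "b \<le> 1/2"
  defines "X \<equiv> (extremal_a \<epsilon> \<tau> r * real d powr (1/2 - b))\<^sup>2 + 1 / real d"
  shows minimax_error_lower_near_one:
      "c > 0 \<Longrightarrow> minimax_error \<epsilon> d (sparse_class d \<tau> r b) \<ge> 1 - c / 2 - (exp (2 * X * exp X) - 1) / (2 * c)"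
    and minimax_error_lower_pos:
      "0 \<le> t \<Longrightarrow> t \<le> 1 \<Longrightarrow> minimax_error \<epsilon> d (sparse_class d \<tau> r b) \<ge> t - t\<^sup>2 * exp (2 * X * exp X) / 4"
proof -
  \<comment> \<open>Division by \<open>2 * \<epsilon> ^ 4\<close> turns this loss into
    \<open>1 / (real d)\<^sup>2\<close>; after multiplication by \<open>D \<le> real d\<close> at
    most \<open>1 / real d\<close> remains, the second summand of \<open>X\<close>.\<close>
  define \<delta> where "\<delta> = 2 * \<epsilon> ^ 4 / (real d)\<^sup>2"
  have \<delta>: "\<delta> > 0" using \<epsilon> d by (simp add: \<delta>_def)
  obtain \<theta> A where \<theta>: "\<theta> \<in> sobolev_class \<tau> r" and A: "finite A" "\<And>k. k \<notin> A \<Longrightarrow> \<theta> k = 0"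
    and lt: "(\<Sum>k\<in>A. (\<theta> k) ^ 4) < extremal_inf \<tau> r + \<delta>"
    using extremal_inf_approx_finite[OF \<delta>] by blast
  define K B where "K = num_active d b" and "B = d div K"
  have b1: "b \<le> 1" using b by simp
  note NA = num_active_bounds[OF d b(1) b1, folded K_def]
  have B: "B \<ge> 1" using NA(1,2) by (simp add: B_def div_greater_zero_iff Suc_le_eq)
  interpret block_prior K B d A \<theta> \<epsilon>
  proof
    show "K * B \<le> d" by (simp add: B_def)
  qed (use B A \<epsilon> in auto)
  have d0: "real d > 0" using d by simp
  have e0: "energy \<ge> 0" using \<epsilon> by (simp add: energy_def sum_nonneg)
  have "energy \<le> (extremal_inf \<tau> r + \<delta>) / (2 * \<epsilon> ^ 4)"
    unfolding energy_def using lt \<epsilon> by (intro divide_right_mono) auto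
  also have "\<dots> = (extremal_a \<epsilon> \<tau> r)\<^sup>2 + 1 / (real d)\<^sup>2"
    using \<epsilon> extremal_inf_nonneg[of \<tau> r] by (simp add: extremal_a_def \<delta>_def add_divide_distrib)
  finally have en: "energy \<le> (extremal_a \<epsilon> \<tau> r)\<^sup>2 + 1 / (real d)\<^sup>2" .
  define D where "D = real d powr (1 - 2 * b)"
  \<comment> \<open>Here \<open>b \<le> 1/2\<close> enters. With \<open>D \<ge> 1\<close>, the bound
    \<open>energy * D \<le> X\<close> also bounds \<open>energy\<close> itself, so that
    \<open>exp energy - 1\<close> is at most linear in \<open>energy\<close> up to the factor
    \<open>exp X\<close>.\<close>
  have D1: "D \<ge> 1" unfolding D_def using d b by (intro ge_one_powr_ge_zero) auto
  have Dd: "D \<le> real d"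
    unfolding D_def using d b powr_mono[of "1 - 2 * b" 1 "real d"] by simp
  have "energy * D \<le> ((extremal_a \<epsilon> \<tau> r)\<^sup>2 + 1 / (real d)\<^sup>2) * D"
    using en D1 by (intro mult_right_mono) auto
  also have "\<dots> \<le> (extremal_a \<epsilon> \<tau> r)\<^sup>2 * D + 1 / (real d)\<^sup>2 * real d"
    using Dd by (simp add: distrib_right divide_right_mono)
  also have "\<dots> = X"
    using d0 by (simp add: X_def D_def power_mult_distrib powr_power power2_eq_square[of "real d"])
  finally have eD: "energy * D \<le> X" .
  have eX: "energy \<le> X" using eD mult_left_mono[OF D1 e0] by simp
  have "exp energy - 1 \<le> energy * exp energy"
  proof -
    have "exp energy * (1 - energy) \<le> exp energy * exp (- energy)"
      using exp_ge_add_one_self[of "- energy"] by (intro mult_left_mono) auto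
    also have "\<dots> = 1" by (simp flip: exp_add)
    finally show ?thesis by (simp add: algebra_simps)
  qed
  also have "\<dots> \<le> energy * exp X" using eX e0 by (intro mult_left_mono) auto
  finally have ex: "exp energy - 1 \<le> energy * exp X" .
  \<comment> \<open>The factor 2 comes from integer division: \<open>B \<ge> 1\<close> gives
    \<open>d / K < B + 1 \<le> 2 * B\<close>. The rest is
    \<open>K\<^sup>2 / d \<le> D\<close>.\<close>
  have KB2: "real K / real B \<le> 2 * D"
  proof -
    have "d < K * Suc B" using NA(1) dividend_less_times_div[of K d] by (simp add: B_def algebra_simps)
    also have "\<dots> \<le> K * (2 * B)" using B by (intro mult_left_mono) auto
    finally have "real d \<le> real (K * (2 * B))" by (simp only: of_nat_le_iff)
    then have "real d / (2 * real K) \<le> real B" using NA(1) by (simp add: divide_le_eq mult_ac)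
    then have "real K / real B \<le> real K / (real d / (2 * real K))"
      using NA(1) d0 B by (intro divide_left_mono) auto
    also have "\<dots> = 2 * (real K)\<^sup>2 / real d" by (simp add: power2_eq_square)
    also have "\<dots> \<le> 2 * (real d powr (1 - b))\<^sup>2 / real d"
      using NA(3) d0 by (intro divide_right_mono mult_left_mono power_mono) auto
    also have "(real d powr (1 - b))\<^sup>2 = D * real d"
    proof -
      have "(real d powr (1 - b))\<^sup>2 = real d powr ((1 - 2 * b) + 1)"
        using d0 by (simp add: powr_power algebra_simps)
      also have "\<dots> = D * real d" unfolding powr_add D_def using d0 by simp
      finally show ?thesis .
    qed
    also have "2 * (D * real d) / real d = 2 * D" using d0 by simp
    finally show ?thesis .
  qed
  have "real K * (exp energy - 1) / real B = real K / real B * (exp energy - 1)" by simp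
  also have "\<dots> \<le> (2 * D) * (energy * exp X)"
    using KB2 ex D1 e0 by (intro mult_mono) auto
  also have "\<dots> = 2 * (energy * D) * exp X" by simp
  also have "\<dots> \<le> 2 * X * exp X" using eD by (intro mult_right_mono mult_left_mono) auto
  finally have "exp (real K * (exp energy - 1) / real B) \<le> exp (2 * X * exp X)" by simp
  then have C: "(\<Sum>\<omega>\<in>configs. \<Sum>\<omega>'\<in>configs. exp (\<Sum>(j, k)\<in>{1..d} \<times> A. signal \<omega> j k * signal \<omega>' j k / \<epsilon>\<^sup>2))
      \<le> exp (2 * X * exp X) * (real (card configs))\<^sup>2"
    by (intro order_trans[OF sum_exp_inner_le] mult_right_mono) auto
  have J: "finite ({1..d} \<times> A)" "{1..d} \<times> A \<subseteq> obs_index d" using A by (auto simp: obs_index_def)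
  note sc = signal_in_sparse_class[OF _ \<theta> K_def]
  show "minimax_error \<epsilon> d (sparse_class d \<tau> r b) \<ge> 1 - c / 2 - (exp (2 * X * exp X) - 1) / (2 * c)" if "c > 0"
    by (rule minimax_error_ge_near_one[OF \<epsilon> J configs_ne signal_support sc C that])
  show "minimax_error \<epsilon> d (sparse_class d \<tau> r b) \<ge> t - t\<^sup>2 * exp (2 * X * exp X) / 4" if "0 \<le> t" "t \<le> 1"
    by (rule minimax_error_ge_pos[OF \<epsilon> J configs_ne signal_support sc C that])
qed

section \<open>Asymptotics\<close>

lemma extremal_a_nonneg: "extremal_a \<epsilon> \<tau> r \<ge> 0"
  using extremal_inf_nonneg[of \<tau> r] by (simp add: extremal_a_def)

lemma extremal_a_dilation:
  assumes "\<tau> > 0" "m \<ge> 1" "0 \<le> r'" "0 \<le> r" "r \<le> real m powr \<tau> * r'"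
  shows "extremal_a \<epsilon> \<tau> r \<le> sqrt (2 * real m * real m powr (4 * \<tau>)) * extremal_a \<epsilon> \<tau> r'"
proof -
  have "extremal_inf \<tau> r \<le> extremal_inf \<tau> (real m powr \<tau> * r')"
    using assms by (intro extremal_inf_mono)
  also have "\<dots> \<le> 2 * real m * real m powr (4 * \<tau>) * extremal_inf \<tau> r'"
    using assms by (intro extremal_inf_dilation)
  finally have "1 / (2 * \<epsilon> ^ 4) * extremal_inf \<tau> r \<le>
      1 / (2 * \<epsilon> ^ 4) * (2 * real m * real m powr (4 * \<tau>) * extremal_inf \<tau> r')"
    by (intro mult_left_mono) auto
  also have "\<dots> = (2 * real m * real m powr (4 * \<tau>)) * (1 / (2 * \<epsilon> ^ 4) * extremal_inf \<tau> r')"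
    by simp
  finally show ?thesis
    unfolding extremal_a_def real_sqrt_mult[symmetric] by (rule real_sqrt_le_mono)
qed

text \<open>The filter is arbitrary, so the facts used below are bounds valid at each index or
  uniform in the weights.\<close>

theorem theorem5p1:
  fixes \<tau> b :: real
    and F :: "'i filter"
    and \<epsilon> r :: "'i \<Rightarrow> real"
    and d :: "'i \<Rightarrow> nat"
  assumes "\<tau> > 0" and "b \<in> {0<..1/2}"
    and "filterlim \<epsilon> (at_right 0) F"
    and "filterlim d at_top F"
    and "filterlim r (at_right 0) F"
  shows
    "(((\<lambda>i. extremal_a (\<epsilon> i) \<tau> (r i) * real (d i) powr (1/2 - b)) \<in> o[F](\<lambda>_. 1) \<longrightarrow>
         ((\<lambda>i. minimax_error (\<epsilon> i) (d i) (sparse_class (d i) \<tau> (r i) b)) \<longlongrightarrow> 1) F) \<and>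
      ((\<lambda>i. extremal_a (\<epsilon> i) \<tau> (r i) * real (d i) powr (1/2 - b)) \<in> O[F](\<lambda>_. 1) \<longrightarrow>
         Liminf F (\<lambda>i. ereal (minimax_error (\<epsilon> i) (d i) (sparse_class (d i) \<tau> (r i) b))) > 0)) \<and>
     (\<forall>(r_star :: 'i \<Rightarrow> real) (\<theta>_star :: real \<Rightarrow> int \<Rightarrow> real).
        (\<forall>\<^sub>F i in F. r_star i > 0) \<longrightarrow>
        (\<lambda>i. extremal_a (\<epsilon> i) \<tau> (r_star i)) \<in> \<Theta>[F](\<lambda>i. real (d i) powr (b - 1/2)) \<longrightarrow>
        (\<forall>\<rho>>0. is_minimizing \<tau> \<rho> (\<theta>_star \<rho>)) \<longrightarrow>
        (\<forall>\<alpha>\<in>{0<..<1}.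
           ((\<lambda>i. type_I_error (\<epsilon> i) (d i)
                   (chi2_test (\<epsilon> i) (d i) \<tau> (r_star i) (\<theta>_star (r_star i)) \<alpha>)) \<longlongrightarrow> \<alpha>) F \<and>
           (filterlim (\<lambda>i. extremal_a (\<epsilon> i) \<tau> (r i) * real (d i) powr (1/2 - b)) at_top F \<longrightarrow>
            ((\<lambda>i. type_II_error (\<epsilon> i) (d i)
                    (chi2_test (\<epsilon> i) (d i) \<tau> (r_star i) (\<theta>_star (r_star i)) \<alpha>)
                    (sparse_class (d i) \<tau> (r i) b)) \<longlongrightarrow> 0) F)))"
proof -
  have \<tau>: "\<tau> > 0" and b: "0 < b" "b \<le> 1/2" "0 \<le> b" "b \<le> 1" using assms(1,2) by auto
  have ev\<epsilon>: "\<forall>\<^sub>F i in F. \<epsilon> i > 0" and evr: "\<forall>\<^sub>F i in F. r i > 0"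
    using assms(3,5) by (auto simp: filterlim_at elim: eventually_mono)
  have evd: "\<forall>\<^sub>F i in F. d i \<ge> n" for n
    using assms(4) by (simp add: filterlim_at_top)
  define p where "p i = extremal_a (\<epsilon> i) \<tau> (r i) * real (d i) powr (1/2 - b)" for i
  define X where "X i = (p i)\<^sup>2 + 1 / real (d i)" for i
  define mm where "mm i = minimax_error (\<epsilon> i) (d i) (sparse_class (d i) \<tau> (r i) b)" for i
  have p0: "p i \<ge> 0" for i by (simp add: p_def extremal_a_nonneg)
  have inv_d: "((\<lambda>i. 1 / real (d i)) \<longlongrightarrow> 0) F"
    by (intro tendsto_divide_0[OF tendsto_const] filterlim_at_top_imp_at_infinity
        filterlim_compose[OF filterlim_real_sequentially assms(4)])
  have lower1: "(mm \<longlongrightarrow> 1) F" if o: "p \<in> o[F](\<lambda>_. 1)"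
  proof (rule order_tendstoI)
    have "(p \<longlongrightarrow> 0) F" using smalloD_tendsto[OF o] by simp
    then have "(X \<longlongrightarrow> 0\<^sup>2 + 0) F" unfolding X_def [abs_def] by (intro tendsto_intros inv_d)
    then have "((\<lambda>i. exp (2 * X i * exp (X i))) \<longlongrightarrow> exp (2 * 0 * exp 0)) F"
      by (intro tendsto_intros) simp_all
    then have lim: "((\<lambda>i. exp (2 * X i * exp (X i))) \<longlongrightarrow> 1) F" by simp
    fix y :: real assume y: "y < 1"
    \<comment> \<open>Once the second moment is below \<open>1 + c * c\<close>, the two losses are
      at most \<open>c / 2\<close> each, and their sum \<open>c\<close> is half of the available
      margin \<open>1 - y\<close>.\<close>
    define c where "c = (1 - y) / 2"
    have c: "c > 0" using y by (simp add: c_def)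
    have "\<forall>\<^sub>F i in F. exp (2 * X i * exp (X i)) < 1 + c * c"
      using c by (intro order_tendstoD(2)[OF lim]) simp
    then show "\<forall>\<^sub>F i in F. y < mm i" using ev\<epsilon> evd[of 1]
    proof eventually_elim
      case (elim i)
      have "(exp (2 * X i * exp (X i)) - 1) / (2 * c) \<le> (c * c) / (2 * c)"
        using elim(1) c by (intro divide_right_mono) auto
      also have "\<dots> = c / 2" using c by simp
      finally have "1 - c / 2 - c / 2 \<le> 1 - c / 2 - (exp (2 * X i * exp (X i)) - 1) / (2 * c)"
        by (rule diff_left_mono)
      also have "\<dots> \<le> mm i"
        unfolding mm_def X_def p_def using elim(2,3) b c by (intro minimax_error_lower_near_one) auto
      finally have "1 - c / 2 - c / 2 \<le> mm i" .
      moreover have "y < 1 - c / 2 - c / 2" using y by (simp add: c_def field_simps)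
      ultimately show "y < mm i" by (rule less_le_trans[rotated])
    qed
  next
    fix y :: real assume y: "1 < y"
    show "\<forall>\<^sub>F i in F. mm i < y" using evd[of 1]
    proof eventually_elim
      case (elim i)
      have "mm i \<le> 1" unfolding mm_def by (intro minimax_error_le_1 sparse_class_nonempty elim b)
      then show ?case using y by simp
    qed
  qed
  have lower2: "Liminf F (\<lambda>i. ereal (mm i)) > 0" if O: "p \<in> O[F](\<lambda>_. 1)"
  proof -
    obtain M where M: "\<forall>\<^sub>F i in F. norm (p i) \<le> M * norm (1 :: real)"
      using O by (elim landau_o.bigE)
    \<comment> \<open>\<open>C\<close> bounds the second moment. The choice
      \<open>t = 1 / C\<close>, admissible since \<open>C \<ge> 1\<close>, leaves
      \<open>1 / C - 1 / (4 * C) = 3 / (4 * C)\<close>.\<close>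
    define Y C where "Y = M\<^sup>2 + 1" and "C = exp (2 * Y * exp Y)"
    have Y: "Y \<ge> 0" by (simp add: Y_def)
    have C: "C \<ge> 1" using Y by (simp add: C_def)
    have "\<forall>\<^sub>F i in F. ereal (3 / (4 * C)) \<le> ereal (mm i)" using M ev\<epsilon> evd[of 1]
    proof eventually_elim
      case (elim i)
      have "(p i)\<^sup>2 \<le> M\<^sup>2" using elim(1) p0[of i] by (intro power_mono) auto
      moreover have "1 / real (d i) \<le> 1" using elim(3) by simp
      ultimately have X: "X i \<le> Y" unfolding X_def Y_def by (rule add_mono)
      have "exp (2 * X i * exp (X i)) \<le> C"
        unfolding C_def using X Y by (simp add: mult_mono)
      then have "(1 / C)\<^sup>2 * exp (2 * X i * exp (X i)) / 4 \<le> (1 / C)\<^sup>2 * C / 4"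
        by (intro divide_right_mono mult_left_mono) auto
      then have "3 / (4 * C) \<le> 1 / C - (1 / C)\<^sup>2 * exp (2 * X i * exp (X i)) / 4"
        using C by (simp add: power2_eq_square)
      also have "\<dots> \<le> mm i"
        unfolding mm_def X_def p_def using elim(2,3) b C by (intro minimax_error_lower_pos) auto
      finally show ?case by simp
    qed
    then have "ereal (3 / (4 * C)) \<le> Liminf F (\<lambda>i. ereal (mm i))" by (rule Liminf_bounded)
    moreover have "0 < ereal (3 / (4 * C))" using C by simp
    ultimately show ?thesis by (rule less_le_trans[rotated])
  qed
  have upper: "((\<lambda>i. type_I_error (\<epsilon> i) (d i) (chi2_test (\<epsilon> i) (d i) \<tau> (r' i) (\<theta>' (r' i)) \<alpha>)) \<longlongrightarrow> \<alpha>) F \<and>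
      (filterlim p at_top F \<longrightarrow>
        ((\<lambda>i. type_II_error (\<epsilon> i) (d i) (chi2_test (\<epsilon> i) (d i) \<tau> (r' i) (\<theta>' (r' i)) \<alpha>)
          (sparse_class (d i) \<tau> (r i) b)) \<longlongrightarrow> 0) F)"
    if r': "\<forall>\<^sub>F i in F. r' i > 0"
      and \<Theta>: "(\<lambda>i. extremal_a (\<epsilon> i) \<tau> (r' i)) \<in> \<Theta>[F](\<lambda>i. real (d i) powr (b - 1/2))"
      and min: "\<forall>\<rho>>0. is_minimizing \<tau> \<rho> (\<theta>' \<rho>)" and \<alpha>: "\<alpha> \<in> {0<..<1}" for r' \<theta>' \<alpha>
  proof -
    define a' where "a' i = extremal_a (\<epsilon> i) \<tau> (r' i)" for i
    obtain c1 where c1: "c1 > 0" "\<forall>\<^sub>F i in F. norm (a' i) \<ge> c1 * norm (real (d i) powr (b - 1/2))"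
      using landau_omega.bigE[OF bigthetaD2[OF \<Theta>]] unfolding a'_def by blast
    obtain c2 where c2: "c2 > 0" "\<forall>\<^sub>F i in F. norm (a' i) \<le> c2 * norm (real (d i) powr (b - 1/2))"
      using landau_o.bigE[OF bigthetaD1[OF \<Theta>]] unfolding a'_def by blast
    have a'0: "a' i \<ge> 0" for i by (simp add: a'_def extremal_a_nonneg)
    \<comment> \<open>Multiplying by \<open>real (d i) powr (1/2 - b)\<close> turns the order
      relation into a two-sided bound; its lower half makes \<open>a' i\<close> positive, as the
      normalisation of the weights requires.\<close>
    have ev: "\<forall>\<^sub>F i in F. \<epsilon> i > 0 \<and> d i \<ge> 1 \<and> r i > 0 \<and> r' i > 0 \<and> a' i > 0 \<and>
        is_minimizing \<tau> (r' i) (\<theta>' (r' i)) \<and>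
        c1 \<le> a' i * real (d i) powr (1/2 - b) \<and> a' i * real (d i) powr (1/2 - b) \<le> c2"
      using ev\<epsilon> evd[of 1] evr r' c1(2) c2(2)
    proof eventually_elim
      case (elim i)
      have D: "real (d i) powr (b - 1/2) > 0" using elim(2) by simp
      have inv: "real (d i) powr (b - 1/2) * real (d i) powr (1/2 - b) = 1"
        using elim(2) by (simp flip: powr_add)
      have lo: "c1 * real (d i) powr (b - 1/2) \<le> a' i" and hi: "a' i \<le> c2 * real (d i) powr (b - 1/2)"
        using elim(5,6) a'0[of i] by simp_all
      have "c1 * (real (d i) powr (b - 1/2) * real (d i) powr (1/2 - b)) \<le> a' i * real (d i) powr (1/2 - b)"
        using mult_right_mono[OF lo, of "real (d i) powr (1/2 - b)"] by (simp add: mult.assoc)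
      moreover have "a' i * real (d i) powr (1/2 - b) \<le> c2 * (real (d i) powr (b - 1/2) * real (d i) powr (1/2 - b))"
        using mult_right_mono[OF hi, of "real (d i) powr (1/2 - b)"] by (simp add: mult.assoc)
      moreover have "a' i > 0" using lo mult_pos_pos[OF c1(1) D] by linarith
      ultimately show ?case using elim min unfolding inv by simp
    qed
    have I: "((\<lambda>i. type_I_error (\<epsilon> i) (d i) (chi2_test (\<epsilon> i) (d i) \<tau> (r' i) (\<theta>' (r' i)) \<alpha>)) \<longlongrightarrow> \<alpha>) F"
    proof (rule tendstoI)
      fix e :: real assume "e > 0"
      then obtain D where D: "\<forall>d w. d \<ge> D \<longrightarrow> chi2_weights d w \<longrightarrow>
          \<bar>measure (noise_law d) {\<eta> \<in> space (noise_law d).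
            chi2_weights.shifted_stat d w (\<lambda>_ _. 0) \<eta> > std_normal_quantile (1 - \<alpha>)} - \<alpha>\<bar> < e"
        using shifted_stat_tail_uniform[of \<alpha> e] \<alpha> by auto
      show "\<forall>\<^sub>F i in F. dist (type_I_error (\<epsilon> i) (d i) (chi2_test (\<epsilon> i) (d i) \<tau> (r' i) (\<theta>' (r' i)) \<alpha>)) \<alpha> < e"
        using ev evd[of D]
      proof eventually_elim
        case (elim i)
        then have W: "chi2_weights (d i) (weight (\<epsilon> i) \<tau> (r' i) (\<theta>' (r' i)))"
          unfolding a'_def by (intro chi2_weights_weight) auto
        show ?case
          unfolding dist_real_def using elim D W by (subst type_I_error_chi2_test[OF _ W]) auto
      qed
    qed
    have II: "((\<lambda>i. type_II_error (\<epsilon> i) (d i) (chi2_test (\<epsilon> i) (d i) \<tau> (r' i) (\<theta>' (r' i)) \<alpha>)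
          (sparse_class (d i) \<tau> (r i) b)) \<longlongrightarrow> 0) F" if p: "filterlim p at_top F"
    proof -
      have ratio: "filterlim (\<lambda>i. r i / r' i) at_top F"
      proof (subst filterlim_at_top_ge[where c = 1], intro allI impI)
        fix Z :: real assume Z: "1 \<le> Z"
        \<comment> \<open>Chosen so that \<open>real m powr \<tau>\<close> is at least
          \<open>Z\<close>: a ratio below \<open>Z\<close> then falls within the reach of the
          dilation bound with a fixed \<open>m\<close>.\<close>
        define m where "m = nat \<lceil>Z powr (1 / \<tau>)\<rceil>"
        have zm: "Z powr (1 / \<tau>) \<le> real m" unfolding m_def by (rule real_nat_ceiling_ge)
        have m: "m \<ge> 1"
        proof -
          have "Z powr (1 / \<tau>) \<ge> 1" using Z \<tau> by (intro ge_one_powr_ge_zero) auto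
          then show ?thesis using zm by linarith
        qed
        have "Z = (Z powr (1 / \<tau>)) powr \<tau>" using Z \<tau> by (simp add: powr_powr)
        also have "\<dots> \<le> real m powr \<tau>" using zm \<tau> by (intro powr_mono2) auto
        finally have Zm: "Z \<le> real m powr \<tau>" .
        define S where "S = sqrt (2 * real m * real m powr (4 * \<tau>))"
        \<comment> \<open>A ratio bounded by \<open>real m powr \<tau>\<close> would force
          \<open>p i \<le> S * c2\<close>; divergence of \<open>p\<close> eventually excludes
          this.\<close>
        have "\<forall>\<^sub>F i in F. p i \<ge> S * c2 + 1" using p unfolding filterlim_at_top by blast
        then show "\<forall>\<^sub>F i in F. Z \<le> r i / r' i" using ev
        proof eventually_elim
          case (elim i)
          have "\<not> r i \<le> real m powr \<tau> * r' i"
          proof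
            assume "r i \<le> real m powr \<tau> * r' i"
            then have "extremal_a (\<epsilon> i) \<tau> (r i) \<le> S * a' i"
              unfolding S_def a'_def using elim \<tau> m by (intro extremal_a_dilation) auto
            then have "p i \<le> S * a' i * real (d i) powr (1/2 - b)"
              unfolding p_def by (intro mult_right_mono) auto
            also have "\<dots> = S * (a' i * real (d i) powr (1/2 - b))" by simp
            also have "\<dots> \<le> S * c2" using elim by (intro mult_left_mono) (auto simp: S_def)
            finally show False using elim by simp
          qed
          then have "real m powr \<tau> * r' i \<le> r i" by simp
          then have "Z * r' i \<le> r i"
            using mult_right_mono[OF Zm, of "r' i"] elim by linarith
          then show ?case using elim by (simp add: le_divide_eq)
        qed
      qed
      let ?q = "std_normal_quantile (1 - \<alpha>)"
      \<comment> \<open>\<open>c1 / 6\<close> combines the lower constant \<open>c1\<close>, the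
        factor 1/2 lost in the integer part of \<open>d^(1-b)\<close>, and the divisor 3 from the
        Laplace bound.\<close>
      let ?f = "\<lambda>x. exp (?q + 1/2 - c1 / 6 * x\<^sup>2)"
      have f0: "(?f \<longlongrightarrow> 0) at_top"
      proof -
        have "filterlim (\<lambda>x. c1 / 6 * x\<^sup>2) at_top at_top"
          using c1(1) by (intro filterlim_tendsto_pos_mult_at_top[OF tendsto_const] filterlim_pow_at_top filterlim_ident) auto
        then have "filterlim (\<lambda>x. - (c1 / 6 * x\<^sup>2)) at_bot at_top"
          by (simp add: filterlim_uminus_at_bot)
        then have "((\<lambda>x. exp (- (c1 / 6 * x\<^sup>2))) \<longlongrightarrow> 0) at_top"
          by (rule filterlim_compose[OF exp_at_bot])
        then have "((\<lambda>x. exp (?q + 1/2) * exp (- (c1 / 6 * x\<^sup>2))) \<longlongrightarrow> 0) at_top"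
          by (rule tendsto_mult_right_zero)
        then show ?thesis by (simp flip: exp_add)
      qed
      have evR: "\<forall>\<^sub>F i in F. 1 \<le> r i / r' i" using ratio unfolding filterlim_at_top by blast
      have both: "\<forall>\<^sub>F i in F. 0 \<le> type_II_error (\<epsilon> i) (d i) (chi2_test (\<epsilon> i) (d i) \<tau> (r' i) (\<theta>' (r' i)) \<alpha>)
            (sparse_class (d i) \<tau> (r i) b) \<and>
          type_II_error (\<epsilon> i) (d i) (chi2_test (\<epsilon> i) (d i) \<tau> (r' i) (\<theta>' (r' i)) \<alpha>)
            (sparse_class (d i) \<tau> (r i) b) \<le> ?f (r i / r' i)"
        using ev evR
      proof eventually_elim
        case (elim i)
        then have d1: "d i \<ge> 1" and le: "r' i \<le> r i" by (auto simp: le_divide_eq)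
        have d0: "real (d i) > 0" using d1 by simp
        define K where "K = real (num_active (d i) b)"
        have "real (d i) powr (1/2 - b) / 2 = real (d i) powr (1 - b) / 2 / sqrt (real (d i))"
        proof -
          have "real (d i) powr (1 - b) = real (d i) powr ((1/2 - b) + 1/2)" by simp
          also have "\<dots> = real (d i) powr (1/2 - b) * sqrt (real (d i))"
            unfolding powr_add using d0 by (simp add: powr_half_sqrt)
          finally show ?thesis using d0 by simp
        qed
        also have "\<dots> \<le> K / sqrt (real (d i))"
          unfolding K_def using num_active_bounds(4)[OF d1 b(3,4)] by (intro divide_right_mono) auto
        finally have "real (d i) powr (1/2 - b) / 2 * a' i \<le> K / sqrt (real (d i)) * a' i"
          using a'0 by (intro mult_right_mono)
        then have "c1 / 2 \<le> K / sqrt (real (d i)) * a' i" using elim by (simp add: mult.commute)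
        then have "c1 / 2 * (r i / r' i)\<^sup>2 \<le> K / sqrt (real (d i)) * a' i * (r i / r' i)\<^sup>2"
          by (intro mult_right_mono) auto
        also have "\<dots> = K / sqrt (real (d i)) * (r i / r' i)\<^sup>2 * a' i" by simp
        finally have "c1 / 2 * (r i / r' i)\<^sup>2 / 3 \<le> K / sqrt (real (d i)) * (r i / r' i)\<^sup>2 * a' i / 3"
          by (rule divide_right_mono) simp
        then have "c1 / 6 * (r i / r' i)\<^sup>2 \<le> K / sqrt (real (d i)) * (r i / r' i)\<^sup>2 * a' i / 3"
          by simp
        then have "exp (?q + 1/2 - K / sqrt (real (d i)) * (r i / r' i)\<^sup>2 * a' i / 3) \<le> ?f (r i / r' i)"
          unfolding exp_le_cancel_iff by (rule diff_left_mono)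
        moreover have "type_II_error (\<epsilon> i) (d i) (chi2_test (\<epsilon> i) (d i) \<tau> (r' i) (\<theta>' (r' i)) \<alpha>)
            (sparse_class (d i) \<tau> (r i) b) \<le> exp (?q + 1/2 - K / sqrt (real (d i)) * (r i / r' i)\<^sup>2 * a' i / 3)"
          unfolding K_def a'_def using elim le b d1
          by (intro type_II_error_chi2_test(2)) (auto simp: a'_def)
        moreover have "0 \<le> type_II_error (\<epsilon> i) (d i) (chi2_test (\<epsilon> i) (d i) \<tau> (r' i) (\<theta>' (r' i)) \<alpha>)
            (sparse_class (d i) \<tau> (r i) b)"
          using elim le b d1 by (intro type_II_error_chi2_test(1)) (auto simp: a'_def)
        ultimately show ?case by (meson order_trans)
      qed
      show ?thesis
      proof (rule tendsto_sandwich[OF _ _ tendsto_const])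
        show "((\<lambda>i. ?f (r i / r' i)) \<longlongrightarrow> 0) F" by (rule filterlim_compose[OF f0 ratio])
      qed (use both in \<open>auto elim: eventually_mono\<close>)
    qed
    show ?thesis using I II by blast
  qed
  show ?thesis
    using lower1 lower2 upper unfolding p_def [abs_def] mm_def [abs_def] by blast
qed

end
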